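(* The optimistic bilevel uniform-parallel-machine scheduling problem $Q\,|\,V_i\in\{V_0,V_1\},\,OPT\text{-}n\,|\,\sum_j C_j^F,\ \sum_j w_jU_j^L$ can be solved exactly by a (dynamic programming) algorithm requiring $$\mathcal O\Big(2^m\Big(\sum_{j=1}^{N}p_j\Big)^m N\,n^2\log n\Big)$$ time and space.
   Context: Bilevel problem. An instance consists of: $m=m_0+m_1$ machines, where the $m_0\ge 0$ machines of the set $\mathcal V_0$ have low speed $V_0$ and the $m_1\ge 0$ machines of the set $\mathcal V_1$ have high speed $V_1$ ($0<V_0\le V_1$); a set $\mathcal J$ of $N$ jobs, job $J_j$ having processing time $p_j$ (a positive integer), weight $w_j$ and due date $d_j$; and an integer $n\le N$. Processing job $J_j$ on machine $M_i$ of speed $V_i$ takes $p_j/V_i$ time units, each machine processes at most one job at a time, without preemption, and all jobs and machines are available from time $0$. In a schedule $s$, $C_j^F(s)$ denotes the completion time of $J_j$, and $U_j^L(s)=1$ if $C_j^F(s)>d_j$ (the job is tardy) and $U_j^L(s)=0$ otherwise. For a set $\mathcal I$ of $n$ jobs let $\mathfrak S_{\mathcal I}$ be the set of schedules of all the jobs of $\mathcal I$ on the $m$ machines. The leader selects $\mathcal I\subset\mathcal J$ with $|\mathcal I|=n$; the follower then schedules the jobs of $\mathcal I$ so as to minimize $\sum_{j} C_j^F$ and, in the optimistic setting, returns among all schedules minimizing $\sum_j C_j^F$ one that minimizes $\sum_j w_jU_j^L$. The problem is $$\min_{\mathcal I\subset\mathcal J,\ |\mathcal I|=n}\ \sum_{j\in\mathcal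 I} w_jU_j^L(s^* )\quad\text{s.t.}\quad s^*\in\operatorname*{argmin}_{s\in\mathfrak S_{\mathcal I}} Lex\Big(\sum_{j\in s}C_j^F(s),\ \sum_{j\in s}w_jU_j^L(s)\Big),$$ where $Lex(f,g)$ means lexicographic minimization: minimize $f$ first, then minimize $g$ among the minimizers of $f$. Arithmetic operations are counted at unit cost. *)

theory Defs
  imports Complex_Main
begin

section \<open>The bilevel scheduling problem\<close>

text \<open>Jobs are \<open>0, \<dots>, N - 1\<close>; machines are \<open>0, \<dots>, m\<^sub>0 + m\<^sub>1 - 1\<close>, the low-speed ones first.\<close>

record bilevel_instance =
  low_machines  :: nat
  high_machines :: nat
  low_speed     :: real
  high_speed    :: real
  num_jobs      :: nat
  proc          :: "nat \<Rightarrow> nat"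
  weight        :: "nat \<Rightarrow> real"
  due           :: "nat \<Rightarrow> real"
  num_selected  :: nat

definition valid_instance :: "bilevel_instance \<Rightarrow> bool" where
  "valid_instance P \<longleftrightarrow>
     0 < low_speed P \<and> low_speed P \<le> high_speed P \<and>
     (\<forall>j<num_jobs P. 0 < proc P j \<and> 0 \<le> weight P j) \<and>
     num_selected P \<le> num_jobs P"

definition num_machines :: "bilevel_instance \<Rightarrow> nat" where
  "num_machines P = low_machines P + high_machines P"

definition speed :: "bilevel_instance \<Rightarrow> nat \<Rightarrow> real" where
  "speed P i = (if i < low_machines P then low_speed P else high_speed P)"

text \<open>Values of the two fields at jobs that are not scheduled are irrelevant.\<close>

record schedule =
  machine_of :: "nat \<Rightarrow> nat"
  start_of   :: "nat \<Rightarrow> real"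

definition completion :: "bilevel_instance \<Rightarrow> schedule \<Rightarrow> nat \<Rightarrow> real" where
  "completion P s j = start_of s j + real (proc P j) / speed P (machine_of s j)"

definition schedules :: "bilevel_instance \<Rightarrow> nat set \<Rightarrow> schedule set" where
  "schedules P I = {s.
     (\<forall>j\<in>I. machine_of s j < num_machines P \<and> 0 \<le> start_of s j) \<and>
     (\<forall>j\<in>I. \<forall>k\<in>I. j \<noteq> k \<and> machine_of s j = machine_of s k \<longrightarrow>
        completion P s j \<le> start_of s k \<or> completion P s k \<le> start_of s j)}"

definition total_completion :: "bilevel_instance \<Rightarrow> nat set \<Rightarrow> schedule \<Rightarrow> real" where
  "total_completion P I s = (\<Sum>j\<in>I. completion P s j)"

definition tardy :: "bilevel_instance \<Rightarrow> schedule \<Rightarrow> nat \<Rightarrow> real" where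
  "tardy P s j = (if completion P s j > due P j then 1 else 0)"

definition weighted_tardy :: "bilevel_instance \<Rightarrow> nat set \<Rightarrow> schedule \<Rightarrow> real" where
  "weighted_tardy P I s = (\<Sum>j\<in>I. weight P j * tardy P s j)"

definition lex_argmin :: "('a \<Rightarrow> real) \<Rightarrow> ('a \<Rightarrow> real) \<Rightarrow> 'a set \<Rightarrow> 'a set" where
  "lex_argmin f g S = {s. is_arg_min g (is_arg_min f (\<lambda>s. s \<in> S)) s}"

definition bilevel_feasible :: "bilevel_instance \<Rightarrow> nat set \<times> schedule \<Rightarrow> bool" where
  "bilevel_feasible P = (\<lambda>(I, s).
     I \<subseteq> {..<num_jobs P} \<and> card I = num_selected P \<and>
     s \<in> lex_argmin (total_completion P I) (weighted_tardy P I) (schedules P I))"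

definition bilevel_optimal :: "bilevel_instance \<Rightarrow> nat set \<Rightarrow> schedule \<Rightarrow> bool" where
  "bilevel_optimal P I s \<longleftrightarrow>
     is_arg_min (\<lambda>(I, s). weighted_tardy P I s) (bilevel_feasible P) (I, s)"


section \<open>A unit-cost random access machine\<close>

text \<open>
  Programs are finite texts over a heap of real-valued cells and finitely many real-valued
  registers. Arithmetic, comparison and memory access have unit cost. There is no rounding
  operation, and the only constants are integers, so that no information can be hidden in
  a program constant. A cell is addressed by a value that is a natural number below the heap size
  \<open>M\<close>; any other access, and division by zero, leaves the program without an execution.
\<close>

datatype expr =
    Lit int
  | Reg nat
  | Mem expr
  | Add expr expr
  | Sub expr expr
  | Mul expr expr
  | Div expr expr

datatype cond =
    Less expr expr
  | Not cond
  | And cond cond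

datatype com =
    Skip
  | Assign nat expr
  | Store expr expr
  | Seq com com
  | If cond com com
  | While cond com

record state =
  regs :: "nat \<Rightarrow> real"
  heap :: "nat \<Rightarrow> real"

definition is_address :: "nat \<Rightarrow> real \<Rightarrow> bool" where
  "is_address M r \<longleftrightarrow> (\<exists>a<M. r = real a)"

definition address :: "real \<Rightarrow> nat" where
  "address r = nat \<lfloor>r\<rfloor>"

primrec expr_val :: "expr \<Rightarrow> state \<Rightarrow> real" where
  "expr_val (Lit c) s = of_int c"
| "expr_val (Reg x) s = regs s x"
| "expr_val (Mem e) s = heap s (address (expr_val e s))"
| "expr_val (Add e f) s = expr_val e s + expr_val f s"
| "expr_val (Sub e f) s = expr_val e s - expr_val f s"
| "expr_val (Mul e f) s = expr_val e s * expr_val f s"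
| "expr_val (Div e f) s = expr_val e s / expr_val f s"

primrec expr_ok :: "nat \<Rightarrow> expr \<Rightarrow> state \<Rightarrow> bool" where
  "expr_ok M (Lit c) s \<longleftrightarrow> True"
| "expr_ok M (Reg x) s \<longleftrightarrow> True"
| "expr_ok M (Mem e) s \<longleftrightarrow> expr_ok M e s \<and> is_address M (expr_val e s)"
| "expr_ok M (Add e f) s \<longleftrightarrow> expr_ok M e s \<and> expr_ok M f s"
| "expr_ok M (Sub e f) s \<longleftrightarrow> expr_ok M e s \<and> expr_ok M f s"
| "expr_ok M (Mul e f) s \<longleftrightarrow> expr_ok M e s \<and> expr_ok M f s"
| "expr_ok M (Div e f) s \<longleftrightarrow> expr_ok M e s \<and> expr_ok M f s \<and> expr_val f s \<noteq> 0"

primrec expr_cost :: "expr \<Rightarrow> nat" where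
  "expr_cost (Lit c) = 1"
| "expr_cost (Reg x) = 1"
| "expr_cost (Mem e) = expr_cost e + 1"
| "expr_cost (Add e f) = expr_cost e + expr_cost f + 1"
| "expr_cost (Sub e f) = expr_cost e + expr_cost f + 1"
| "expr_cost (Mul e f) = expr_cost e + expr_cost f + 1"
| "expr_cost (Div e f) = expr_cost e + expr_cost f + 1"

primrec cond_val :: "cond \<Rightarrow> state \<Rightarrow> bool" where
  "cond_val (Less e f) s \<longleftrightarrow> expr_val e s < expr_val f s"
| "cond_val (Not b) s \<longleftrightarrow> \<not> cond_val b s"
| "cond_val (And b c) s \<longleftrightarrow> cond_val b s \<and> cond_val c s"

primrec cond_ok :: "nat \<Rightarrow> cond \<Rightarrow> state \<Rightarrow> bool" where
  "cond_ok M (Less e f) s \<longleftrightarrow> expr_ok M e s \<and> expr_ok M f s"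
| "cond_ok M (Not b) s \<longleftrightarrow> cond_ok M b s"
| "cond_ok M (And b c) s \<longleftrightarrow> cond_ok M b s \<and> cond_ok M c s"

primrec cond_cost :: "cond \<Rightarrow> nat" where
  "cond_cost (Less e f) = expr_cost e + expr_cost f + 1"
| "cond_cost (Not b) = cond_cost b + 1"
| "cond_cost (And b c) = cond_cost b + cond_cost c + 1"

text \<open>\<open>exec M c s t s'\<close>: on a heap of \<open>M\<close> cells, \<open>c\<close> started in \<open>s\<close> halts in \<open>s'\<close> after \<open>t\<close> steps.\<close>

inductive exec :: "nat \<Rightarrow> com \<Rightarrow> state \<Rightarrow> nat \<Rightarrow> state \<Rightarrow> bool" for M where
  Skip: "exec M Skip s 1 s"
| Assign: "expr_ok M e s \<Longrightarrow>
    exec M (Assign x e) s (expr_cost e + 1) (s\<lparr>regs := (regs s)(x := expr_val e s)\<rparr>)"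
| Store: "expr_ok M e s \<Longrightarrow> is_address M (expr_val e s) \<Longrightarrow> expr_ok M f s \<Longrightarrow>
    exec M (Store e f) s (expr_cost e + expr_cost f + 1)
      (s\<lparr>heap := (heap s)(address (expr_val e s) := expr_val f s)\<rparr>)"
| Seq: "exec M c s t s' \<Longrightarrow> exec M d s' u s'' \<Longrightarrow> exec M (Seq c d) s (t + u) s''"
| IfTrue: "cond_ok M b s \<Longrightarrow> cond_val b s \<Longrightarrow> exec M c s t s' \<Longrightarrow>
    exec M (If b c d) s (cond_cost b + t) s'"
| IfFalse: "cond_ok M b s \<Longrightarrow> \<not> cond_val b s \<Longrightarrow> exec M d s t s' \<Longrightarrow>
    exec M (If b c d) s (cond_cost b + t) s'"
| WhileFalse: "cond_ok M b s \<Longrightarrow> \<not> cond_val b s \<Longrightarrow> exec M (While b c) s (cond_cost b) s"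
| WhileTrue: "cond_ok M b s \<Longrightarrow> cond_val b s \<Longrightarrow> exec M c s t s' \<Longrightarrow>
    exec M (While b c) s' u s'' \<Longrightarrow> exec M (While b c) s (cond_cost b + t + u) s''"

inductive_cases SkipE: "exec M Skip s t s'"
inductive_cases AssignE: "exec M (Assign x e) s t s'"
inductive_cases StoreE: "exec M (Store e f) s t s'"
inductive_cases SeqE: "exec M (Seq c d) s t s'"
inductive_cases IfE: "exec M (If b c d) s t s'"
inductive_cases WhileE: "exec M (While b c) s t s'"

lemma exec_deterministic:
  "exec M c s t s' \<Longrightarrow> exec M c s u s'' \<Longrightarrow> u = t \<and> s'' = s'"
proof (induction arbitrary: u s'' rule: exec.induct)
  case Skip
  then show ?case by (auto elim: SkipE)
next
  case Assign
  then show ?case by (auto elim: AssignE)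
next
  case Store
  then show ?case by (auto elim: StoreE)
next
  case (Seq c s t s1 d u1 s2)
  from Seq.prems show ?case by (rule SeqE) (use Seq.IH in blast)
next
  case (IfTrue b s c t s' d)
  from IfTrue.prems show ?case by (rule IfE) (use IfTrue in blast)+
next
  case (IfFalse b s d t s' c)
  from IfFalse.prems show ?case by (rule IfE) (use IfFalse in blast)+
next
  case (WhileFalse b s c)
  from WhileFalse.prems show ?case by (rule WhileE) (use WhileFalse in blast)+
next
  case (WhileTrue b s c t s1 u1 s2)
  from WhileTrue.prems show ?case by (rule WhileE) (use WhileTrue in blast)+
qed

definition initial_state :: "real list \<Rightarrow> state" where
  "initial_state xs = \<lparr>regs = (\<lambda>_. 0), heap = (\<lambda>a. if a < length xs then xs ! a else 0)\<rparr>"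

text \<open>
  The heap size \<open>M\<close> is the space: it includes input, output and all intermediate cells. The
  registers are not counted, as their number is a constant of the program text.
\<close>

definition computes_within :: "com \<Rightarrow> real list \<Rightarrow> real list \<Rightarrow> nat \<Rightarrow> nat \<Rightarrow> bool" where
  "computes_within c xs ys t M \<longleftrightarrow> length xs \<le> M \<and> length ys \<le> M \<and>
     (\<exists>s. exec M c (initial_state xs) t s \<and> (\<forall>a<length ys. heap s a = ys ! a))"


section \<open>Solving the problem\<close>

definition encode_instance :: "bilevel_instance \<Rightarrow> real list" where
  "encode_instance P =
     [real (low_machines P), real (high_machines P), low_speed P, high_speed P,
      real (num_jobs P), real (num_selected P)]
     @ map (\<lambda>j. real (proc P j)) [0..<num_jobs P]
     @ map (weight P) [0..<num_jobs P]
     @ map (due P) [0..<num_jobs P]"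

text \<open>
  A flag, the objective value, for every job \<open>0\<close> if it is not selected and otherwise one plus
  its machine, and finally the start times.
\<close>

definition encode_solution :: "bilevel_instance \<Rightarrow> nat set \<Rightarrow> schedule \<Rightarrow> real list" where
  "encode_solution P I s =
     [1, weighted_tardy P I s]
     @ map (\<lambda>j. if j \<in> I then real (machine_of s j + 1) else 0) [0..<num_jobs P]
     @ map (\<lambda>j. if j \<in> I then start_of s j else 0) [0..<num_jobs P]"

text \<open>The output \<open>[0]\<close> covers instances with jobs to be scheduled but no machine.\<close>

definition exact_output :: "bilevel_instance \<Rightarrow> real list \<Rightarrow> bool" where
  "exact_output P ys \<longleftrightarrow>
     (if \<exists>I s. bilevel_optimal P I s
      then \<exists>I s. bilevel_optimal P I s \<and> ys = encode_solution P I s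
      else ys = [0])"

text \<open>
  The factor \<open>log n\<close> vanishes for \<open>n = 1\<close>, where no algorithm takes zero steps; it is read as
  \<open>1\<close> there. For \<open>n \<ge> 2\<close> the maximum is \<open>log 2 n\<close>.
\<close>

definition dp_bound :: "bilevel_instance \<Rightarrow> real" where
  "dp_bound P =
     2 ^ num_machines P * real (\<Sum>j<num_jobs P. proc P j) ^ num_machines P *
     real (num_jobs P) * real (num_selected P) ^ 2 * max 1 (log 2 (real (num_selected P)))"

end

theory Submission
  imports Defs
begin

text \<open>
  The follower's objective is separable by positions: a job that is the \<open>k\<close>-th last
  on a machine of speed \<open>v\<close> contributes \<open>k / v\<close> times its processing
  time. An optimal schedule of a set of \<open>n\<close> jobs therefore uses the \<open>n\<close>
  cheapest positions, the longest job in the cheapest one. The resulting coefficients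
  \<open>coef\<close> depend on the number of the selected jobs only, not on the selection, so
  that the optimal value \<open>follower_opt\<close> of a selection is a sum over its jobs in the
  order of their processing times. Hence the excess of a schedule, its total completion time minus
  \<open>follower_opt\<close>, can be accumulated while jobs are appended to the machines by
  increasing processing time. No schedule has a negative excess (\<open>follower_opt_le\<close>),
  and every selection admits excess zero (\<open>follower_opt_attained\<close>). Minimizing the
  pair of excess and weighted tardiness lexicographically over all selections and all schedules at
  once thus yields a schedule of excess zero, that is, one the follower may choose, and among
  these one of least weighted tardiness. The two levels collapse into one, and ties between
  positions need no separate treatment.

  Appending the jobs of equal processing time by increasing due date would lose solutions: the
  on-time jobs among them may be taken in this order, but a late one must be able to give way to
  all of them. A late job is therefore only declared, at the price of its weight, and remains
  pending until its group of equal processing times has been passed; then all pending jobs of the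
  group are appended. The exchange argument \<open>early_block\<close> shows that this form is
  reached from any optimal schedule of the follower without changing the machine of a job and
  without making an on-time job late. A state of the dynamic program \<open>dp\<close> consists of
  the number of the jobs not yet considered, the number of the jobs still to be appended, the
  number of the pending ones and the vector of the machine loads. Lemma \<open>dp_le\<close>
  bounds the entries from above by the cost of every such plan, and the lemmas on
  \<open>tracing\<close> turn the stored decisions into a schedule that attains the initial entry;
  both meet in \<open>tracing_optimal\<close>.

  As long as a job is still to be appended, each load is smaller than the sum \<open>T\<close> of
  all processing times, so that \<open>T ^ m\<close> indices in base \<open>T\<close> represent
  the loads. The total load \<open>T\<close> is reached in final states only, whose entries do not
  depend on the loads, and the index of such a load vector is at most \<open>T ^ m\<close>. This
  makes \<open>(N + 1) (n + 1)\<^sup>2 (T ^ m + 1)\<close> entries, computed in \<open>O (m +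
  1)\<close> steps each, and \<open>m + 1 \<le> 2 ^ m\<close>.

  The program is verified with a calculus for terminating runs with a bound on their time
  (\<open>run\<close>). Its loop-free parts are executed symbolically by \<open>line\<close>, with
  a bound on their time that is read off the text; the loops are handled by \<open>run_For\<close>
  and \<open>run_While\<close>.
\<close>

section \<open>Mixed radix numbers\<close>

lemma mat_less: "k < a \<Longrightarrow> i < b \<Longrightarrow> k * b + i < a * (b::nat)"
proof -
  assume "k < a" "i < b"
  then have "k * b + i < (k + 1) * b" by simp
  also have "\<dots> \<le> a * b" using \<open>k < a\<close> by (intro mult_right_mono) auto
  finally show ?thesis .
qed

lemma mat_inj: "\<lbrakk>k' * b + i' = k * b + i; i < b; i' < b\<rbrakk> \<Longrightarrow> k' = k \<and> i' = (i::nat)"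
  by (metis add.commute add_left_cancel div_mult_self3 less_nat_zero_code mult.commute div_less add_0_right div_mult_self1)

lemma digit_sum:
  fixes T :: nat
  shows "(\<And>i. i < c \<Longrightarrow> L i < T) \<Longrightarrow> l < c \<Longrightarrow> (\<Sum>i<c. L i * T ^ i) div T ^ l mod T = L l"
proof (induction c arbitrary: L l)
  case (Suc c)
  have T: "0 < T" using Suc.prems(1)[of 0] by simp
  have e: "(\<Sum>i<Suc c. L i * T ^ i) = L 0 + T * (\<Sum>i<c. L (Suc i) * T ^ i)"
    by (simp only: sum.lessThan_Suc_shift) (simp add: sum_distrib_left algebra_simps)
  show ?case
  proof (cases l)
    case 0
    then show ?thesis unfolding e using Suc.prems(1)[of 0] by simp
  next
    case (Suc l')
    have "(L 0 + T * (\<Sum>i<c. L (Suc i) * T ^ i)) div T = (\<Sum>i<c. L (Suc i) * T ^ i)"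
      using T Suc.prems(1)[of 0] by simp
    then have "(\<Sum>i<Suc c. L i * T ^ i) div T ^ l mod T = (\<Sum>i<c. L (Suc i) * T ^ i) div T ^ l' mod T"
      unfolding e Suc power_Suc div_mult2_eq by simp
    then show ?thesis using Suc.IH[of "\<lambda>i. L (Suc i)" l'] Suc.prems Suc by simp
  qed
qed simp

section \<open>Greedy position coefficients\<close>

lemma speed_pos: "valid_instance P \<Longrightarrow> 0 < speed P i"
  by (auto simp: valid_instance_def speed_def)

text \<open>
  The first index below the bound at which the least value is attained; the strict comparison is
  that of the program, which has to pick the same machine.
\<close>

primrec first_min :: "(nat \<Rightarrow> real) \<Rightarrow> nat \<Rightarrow> nat" where
  "first_min f 0 = 0"
| "first_min f (Suc k) = (if f k < f (first_min f k) then k else first_min f k)"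

lemma first_min_less: "0 < k \<Longrightarrow> first_min f k < k"
  by (induction k) (auto simp: less_Suc_eq gr0_conv_Suc)

lemma first_min_le: "i < k \<Longrightarrow> f (first_min f k) \<le> f i"
  by (induction k) (auto simp: less_Suc_eq)

context
  fixes P :: bilevel_instance
begin

text \<open>
  The cost coefficient of the next position on machine \<open>i\<close>, counted from the end of
  the schedule, when \<open>c\<close> lists the numbers of the positions in use.
\<close>

definition position_cost :: "(nat \<Rightarrow> nat) \<Rightarrow> nat \<Rightarrow> real" where
  "position_cost c i = (real (c i) + 1) / speed P i"

primrec greedy :: "nat \<Rightarrow> nat \<Rightarrow> nat" where
  "greedy 0 = (\<lambda>_. 0)"
| "greedy (Suc r) = (let i = first_min (position_cost (greedy r)) (num_machines P)
     in (greedy r)(i := greedy r i + 1))"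

definition pick :: "nat \<Rightarrow> nat" where
  "pick r = first_min (position_cost (greedy r)) (num_machines P)"

definition coef :: "nat \<Rightarrow> real" where
  "coef r = position_cost (greedy r) (pick r)"

definition coef_sum :: "nat \<Rightarrow> real" where
  "coef_sum r = (\<Sum>k<r. coef k)"

definition total_proc :: nat where
  "total_proc = (\<Sum>j<num_jobs P. proc P j)"

text \<open>
  The sum of the processing time of the \<open>r\<close>-th longest job times \<open>coef (r -
  1)\<close>, over all jobs of \<open>I\<close>, regrouped by layers: in layer \<open>h\<close>
  all jobs of length at least \<open>h\<close> count once. The layers make this value comparable
  with that of an arbitrary assignment without sorting the jobs.
\<close>

definition follower_opt :: "nat set \<Rightarrow> real" where
  "follower_opt I = (\<Sum>h\<in>{1..total_proc}. coef_sum (card {j\<in>I. h \<le> proc P j}))"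

text \<open>
  The total completion time if each machine processes its jobs without idle time by increasing
  processing time. Of two jobs on a machine the longer one waits for the shorter one; the double
  sum counts each such wait twice and each job with itself once, which the second sum completes to
  twice the total.
\<close>

definition spt_total :: "(nat \<Rightarrow> nat) \<Rightarrow> nat set \<Rightarrow> real" where
  "spt_total \<mu> I = ((\<Sum>j\<in>I. \<Sum>k\<in>{k\<in>I. \<mu> k = \<mu> j}. real (min (proc P j) (proc P k)) / speed P (\<mu> j))
     + (\<Sum>j\<in>I. real (proc P j) / speed P (\<mu> j))) / 2"

end

text \<open>
  Without a machine there is a schedule only for the empty selection; that case needs no
  coefficients and is treated together with the regular one.
\<close>

locale machines =
  fixes P :: bilevel_instance
  assumes valid: "valid_instance P" and machines: "0 < num_machines P \<or> num_selected P = 0"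
begin

abbreviation "m \<equiv> num_machines P"
abbreviation "N \<equiv> num_jobs P"
abbreviation "n \<equiv> num_selected P"
abbreviation "p \<equiv> proc P"
abbreviation "V \<equiv> speed P"

lemma V_pos[simp]: "0 < V i" "V i \<noteq> 0" "0 \<le> V i"
  using speed_pos[OF valid, of i] by auto

lemma p_pos: "j < N \<Longrightarrow> 0 < p j" using valid by (auto simp: valid_instance_def)

lemma weight_nonneg: "j < N \<Longrightarrow> 0 \<le> weight P j" using valid by (auto simp: valid_instance_def)

lemma p_le_total: "j < N \<Longrightarrow> p j \<le> total_proc P"
  unfolding total_proc_def by (rule member_le_sum) auto

lemma greedy_Suc: "greedy P (Suc r) = (greedy P r)(pick P r := greedy P r (pick P r) + 1)"
  by (simp add: pick_def Let_def)

declare greedy.simps(2)[simp del]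

lemma pick_less: "0 < m \<Longrightarrow> pick P r < m"
  by (simp add: pick_def first_min_less)

lemma pick_least: "i < m \<Longrightarrow> coef P r \<le> position_cost P (greedy P r) i"
  unfolding coef_def pick_def by (rule first_min_le)

lemma sum_greedy: "0 < m \<Longrightarrow> (\<Sum>i<m. greedy P r i) = r"
proof (induction r)
  case (Suc r)
  have "(\<Sum>i<m. greedy P (Suc r) i) = (\<Sum>i<m. greedy P r i + (if i = pick P r then 1 else 0))"
    by (rule sum.cong) (auto simp: greedy_Suc)
  also have "\<dots> = Suc r" using Suc pick_less[OF Suc.prems, of r] by (simp add: sum.distrib)
  finally show ?case .
qed simp

text \<open>
  A machine receives a position only when it is the cheapest one available, and the costs of the
  next positions never decrease.
\<close>

lemma greedy_balanced:
  "i < m \<Longrightarrow> l < m \<Longrightarrow> real (greedy P r i) / V i \<le> position_cost P (greedy P r) l"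
proof (induction r arbitrary: i l)
  case 0
  then show ?case by (simp add: position_cost_def)
next
  case (Suc r)
  let ?k = "pick P r"
  have mono: "position_cost P (greedy P r) l \<le> position_cost P (greedy P (Suc r)) l"
    by (auto simp: position_cost_def greedy_Suc divide_right_mono)
  have "real (greedy P (Suc r) i) / V i \<le> position_cost P (greedy P r) l"
  proof (cases "i = ?k")
    case True
    then have "real (greedy P (Suc r) i) / V i = coef P r"
      by (simp add: greedy_Suc coef_def position_cost_def add.commute)
    then show ?thesis using pick_least Suc.prems by simp
  next
    case False
    then show ?thesis using Suc by (simp add: greedy_Suc)
  qed
  with mono show ?case by linarith
qed

abbreviation triangle :: "nat \<Rightarrow> real" where "triangle k \<equiv> real k * (real k + 1) / 2"

lemma coef_sum_greedy: "0 < m \<Longrightarrow> coef_sum P r = (\<Sum>i<m. triangle (greedy P r i) / V i)"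
proof (induction r)
  case 0
  then show ?case by (simp add: coef_sum_def)
next
  case (Suc r)
  have "(\<Sum>i<m. triangle (greedy P (Suc r) i) / V i)
      = (\<Sum>i<m. triangle (greedy P r i) / V i + (if i = pick P r then coef P r else 0))"
    by (rule sum.cong) (auto simp: greedy_Suc coef_def position_cost_def field_simps)
  also have "\<dots> = (\<Sum>i<m. triangle (greedy P r i) / V i) + coef P r"
    using pick_less[OF Suc.prems, of r] by (simp add: sum.distrib)
  finally show ?case using Suc by (simp add: coef_sum_def)
qed

lemma triangle_below:
  fixes A B C x y z e :: real
  assumes "x + y \<le> z" "e \<le> y" "A = C + x + (y + e) / 2" "B = - z"
  shows "A + B \<le> C"
proof -
  have "(y + e) / 2 \<le> y" using assms(2) by simp
  then show ?thesis using assms by linarith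
qed

lemma triangle_above:
  fixes A B C x y z e :: real
  assumes "z \<le> x + e" "e \<le> y" "C = A + x + (y + e) / 2" "B = z"
  shows "A + B \<le> C"
proof -
  have "e \<le> (y + e) / 2" using assms(2) by simp
  then show ?thesis using assms by linarith
qed

text \<open>
  Convexity makes the greedy counts optimal: the largest greedy slope \<open>\<lambda>\<close> is a common subgradient
  of the machines' cost functions, so any other distribution of the same number of positions costs
  at least as much.
\<close>

lemma coef_sum_le:
  assumes m: "0 < m" and r: "(\<Sum>i<m. k i) = r"
  shows "coef_sum P r \<le> (\<Sum>i<m. triangle (k i) / V i)"
proof -
  let ?g = "greedy P r"
  define l where "l = Max ((\<lambda>i. real (?g i) / V i) ` {..<m})"
  have l1: "real (?g i) / V i \<le> l" if "i < m" for i
    unfolding l_def using that by (intro Max_ge) auto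
  have "l \<in> (\<lambda>i. real (?g i) / V i) ` {..<m}"
    unfolding l_def using m by (intro Max_in) auto
  then have l2: "l \<le> position_cost P ?g i" if "i < m" for i
    using greedy_balanced that by auto
  have "triangle (?g i) / V i + l * (real (k i) - real (?g i)) \<le> triangle (k i) / V i" if "i < m" for i
  proof -
    have a: "real (?g i) \<le> l * V i" using l1[OF that] by (simp add: pos_divide_le_eq)
    have b: "l * V i \<le> real (?g i) + 1"
      using l2[OF that] by (simp add: position_cost_def pos_le_divide_eq)
    have "triangle (?g i) + (l * V i) * (real (k i) - real (?g i)) \<le> triangle (k i)"
    proof (cases "k i \<le> ?g i")
      case True
      then obtain e where e: "?g i = k i + e" using le_Suc_ex by blast
      have "real (?g i) * e \<le> (l * V i) * e" using a by (intro mult_right_mono) auto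
      then have "real (k i) * e + real e * e \<le> (l * V i) * e" unfolding e by (simp add: algebra_simps)
      moreover have "real e \<le> real e * real e" by (cases e) auto
      moreover have "triangle (?g i) = triangle (k i) + real (k i) * e + (real e * e + e) / 2"
        unfolding e by (simp add: field_simps)
      moreover have "(l * V i) * (real (k i) - real (?g i)) = - ((l * V i) * e)" unfolding e by simp
      ultimately show ?thesis by (rule triangle_below)
    next
      case False
      then obtain e where e: "k i = ?g i + e" using le_Suc_ex nat_le_linear by blast
      have "(l * V i) * e \<le> (real (?g i) + 1) * e" using b by (intro mult_right_mono) auto
      then have "(l * V i) * e \<le> real (?g i) * e + e" by (simp add: algebra_simps)
      moreover have "real e \<le> real e * real e" by (cases e) auto
      moreover have "triangle (k i) = triangle (?g i) + real (?g i) * e + (real e * e + e) / 2"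
        unfolding e by (simp add: field_simps)
      moreover have "(l * V i) * (real (k i) - real (?g i)) = (l * V i) * e" unfolding e by simp
      ultimately show ?thesis by (rule triangle_above)
    qed
    then have "(triangle (?g i) + (l * V i) * (real (k i) - real (?g i))) / V i \<le> triangle (k i) / V i"
      by (rule divide_right_mono) simp
    then show ?thesis by (simp add: add_divide_distrib)
  qed
  then have "(\<Sum>i<m. triangle (?g i) / V i + l * (real (k i) - real (?g i))) \<le> (\<Sum>i<m. triangle (k i) / V i)"
    by (intro sum_mono) auto
  moreover have "(\<Sum>i<m. l * (real (k i) - real (?g i))) = 0"
    using r sum_greedy[OF m, of r]
    by (simp add: sum_distrib_left[symmetric] sum_subtractf of_nat_sum[symmetric] del: of_nat_sum)
  ultimately show ?thesis using coef_sum_greedy[OF m, of r] by (simp add: sum.distrib)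
qed

section \<open>The follower's optimum\<close>

lemma finite_jobs: "I \<subseteq> {..<N} \<Longrightarrow> finite I" using finite_subset by blast

text \<open>
  A new shortest job raises the count by one in precisely the layers up to its length.
\<close>

lemma follower_opt_insert:
  assumes I: "I \<subseteq> {..<N}" and q: "q < N" "q \<notin> I" and le: "\<And>j. j \<in> I \<Longrightarrow> p q \<le> p j"
  shows "follower_opt P (insert q I) = follower_opt P I + p q * coef P (card I)"
proof -
  note fin = finite_jobs[OF I]
  have "coef_sum P (card {j\<in>insert q I. h \<le> p j})
      = coef_sum P (card {j\<in>I. h \<le> p j}) + (if h \<le> p q then coef P (card I) else 0)" for h
  proof (cases "h \<le> p q")
    case True
    then have "{j\<in>insert q I. h \<le> p j} = insert q I" "{j\<in>I. h \<le> p j} = I"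
      using le by force+
    then show ?thesis using True fin q by (simp add: coef_sum_def)
  next
    case False
    then have "{j\<in>insert q I. h \<le> p j} = {j\<in>I. h \<le> p j}" by auto
    then show ?thesis using False by simp
  qed
  then have "follower_opt P (insert q I) = follower_opt P I
      + (\<Sum>h\<in>{1..total_proc P}. if h \<le> p q then coef P (card I) else 0)"
    by (simp add: follower_opt_def sum.distrib)
  also have "(\<Sum>h\<in>{1..total_proc P}. if h \<le> p q then coef P (card I) else 0)
      = (\<Sum>h\<in>{1..p q}. coef P (card I))"
    using p_le_total[OF q(1)] by (intro sum.mono_neutral_cong_right) auto
  finally show ?thesis by simp
qed

lemma spt_total_insert:
  assumes I: "finite I" and q: "q \<notin> I"
  shows "spt_total P \<mu> (insert q I) = spt_total P \<mu> I
    + (real (p q) + (\<Sum>k\<in>{k\<in>I. \<mu> k = \<mu> q}. real (min (p q) (p k)))) / V (\<mu> q)"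
proof -
  let ?w = "\<lambda>j k. if \<mu> k = \<mu> j then real (min (p j) (p k)) / V (\<mu> j) else 0"
  have W: "(\<Sum>j\<in>I. \<Sum>k\<in>{k\<in>I. \<mu> k = \<mu> j}. real (min (p j) (p k)) / V (\<mu> j)) = (\<Sum>j\<in>I. \<Sum>k\<in>I. ?w j k)"
    if "finite I" for I
    by (rule sum.cong[OF refl]) (simp add: sum.inter_filter that)
  have sym: "?w j k = ?w k j" for j k by (auto simp: min.commute)
  have "(\<Sum>j\<in>insert q I. \<Sum>k\<in>insert q I. ?w j k)
      = ?w q q + (\<Sum>k\<in>I. ?w q k) + (\<Sum>j\<in>I. ?w j q) + (\<Sum>j\<in>I. \<Sum>k\<in>I. ?w j k)"
    using I q by (simp add: sum.distrib)
  also have "(\<Sum>j\<in>I. ?w j q) = (\<Sum>k\<in>I. ?w q k)"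
    by (intro sum.cong refl sym)
  finally have *: "(\<Sum>j\<in>insert q I. \<Sum>k\<in>insert q I. ?w j k)
      = real (p q) / V (\<mu> q) + 2 * (\<Sum>k\<in>I. ?w q k) + (\<Sum>j\<in>I. \<Sum>k\<in>I. ?w j k)" by simp
  have "(\<Sum>k\<in>I. ?w q k) = (\<Sum>k\<in>{k\<in>I. \<mu> k = \<mu> q}. real (min (p q) (p k))) / V (\<mu> q)"
    using I by (simp add: sum.inter_filter[symmetric] sum_divide_distrib)
  with * show ?thesis
    unfolding spt_total_def using W[OF I] W[of "insert q I"] I q
    by (simp add: add_divide_distrib)
qed

lemma min_layers: "j < N \<Longrightarrow> real (min (p j) x) = (\<Sum>h\<in>{1..total_proc P}. if h \<le> p j \<and> h \<le> x then 1 else 0)"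
proof -
  assume j: "j < N"
  have "(\<Sum>h\<in>{1..total_proc P}. if h \<le> p j \<and> h \<le> x then (1::real) else 0) = (\<Sum>h\<in>{1..min (p j) x}. 1)"
    using p_le_total[OF j] by (intro sum.mono_neutral_cong_right) auto
  then show ?thesis by simp
qed

text \<open>
  A processing time is the number of the layers below it; in each layer only the numbers of long
  jobs per machine matter.
\<close>

lemma spt_total_layers:
  assumes I: "I \<subseteq> {..<N}" and \<mu>: "\<And>j. j \<in> I \<Longrightarrow> \<mu> j < m"
  shows "spt_total P \<mu> I
    = (\<Sum>h\<in>{1..total_proc P}. \<Sum>i<m. triangle (card {j\<in>I. \<mu> j = i \<and> h \<le> p j}) / V i)"
proof -
  note fin = finite_jobs[OF I]
  let ?T = "{1..total_proc P}"
  let ?o = "\<lambda>i h j. if \<mu> j = i \<and> h \<le> p j then (1::real) else 0"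
  have c: "(\<Sum>j\<in>I. ?o i h j) = real (card {j\<in>I. \<mu> j = i \<and> h \<le> p j})" for i h
    using fin by (simp add: sum.If_cases Int_def)
  have c1: "(\<Sum>i<m. ?o i h j / V i) = (if h \<le> p j then 1 else 0) / V (\<mu> j)" if "j \<in> I" for h j
  proof -
    have "(\<Sum>i<m. ?o i h j / V i) = (\<Sum>i<m. if i = \<mu> j then (if h \<le> p j then 1 else 0) / V i else 0)"
      by (rule sum.cong) auto
    then show ?thesis using \<mu>[OF that] by simp
  qed
  have c2: "(\<Sum>i<m. ?o i h j * ?o i h k / V i)
      = (if \<mu> k = \<mu> j then (if h \<le> p j \<and> h \<le> p k then 1 else 0) / V (\<mu> j) else 0)" if "j \<in> I" for h j k
  proof -
    have "(\<Sum>i<m. ?o i h j * ?o i h k / V i)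
      = (\<Sum>i<m. if i = \<mu> j then (if \<mu> k = \<mu> j \<and> h \<le> p j \<and> h \<le> p k then 1 else 0) / V i else 0)"
      by (rule sum.cong) auto
    then show ?thesis using \<mu>[OF that] by simp
  qed
  have A: "(\<Sum>j\<in>I. real (p j) / V (\<mu> j)) = (\<Sum>h\<in>?T. \<Sum>i<m. (\<Sum>j\<in>I. ?o i h j) / V i)"
  proof -
    have "real (p j) / V (\<mu> j) = (\<Sum>h\<in>?T. \<Sum>i<m. ?o i h j / V i)" if "j \<in> I" for j
      using that c1[OF that] min_layers[of j "p j"] I
      by (auto simp: sum_divide_distrib[symmetric] subset_eq)
    then have "(\<Sum>j\<in>I. real (p j) / V (\<mu> j)) = (\<Sum>j\<in>I. \<Sum>h\<in>?T. \<Sum>i<m. ?o i h j / V i)"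
      by (rule sum.cong[OF refl])
    also have "\<dots> = (\<Sum>h\<in>?T. \<Sum>j\<in>I. \<Sum>i<m. ?o i h j / V i)" by (rule sum.swap)
    also have "\<dots> = (\<Sum>h\<in>?T. \<Sum>i<m. \<Sum>j\<in>I. ?o i h j / V i)" by (intro sum.cong refl sum.swap)
    finally show ?thesis by (simp add: sum_divide_distrib)
  qed
  have B: "(\<Sum>j\<in>I. \<Sum>k\<in>{k\<in>I. \<mu> k = \<mu> j}. real (min (p j) (p k)) / V (\<mu> j))
      = (\<Sum>h\<in>?T. \<Sum>i<m. (\<Sum>j\<in>I. ?o i h j) * (\<Sum>j\<in>I. ?o i h j) / V i)"
  proof -
    have "(\<Sum>j\<in>I. \<Sum>k\<in>{k\<in>I. \<mu> k = \<mu> j}. real (min (p j) (p k)) / V (\<mu> j))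
       = (\<Sum>j\<in>I. \<Sum>k\<in>I. if \<mu> k = \<mu> j then real (min (p j) (p k)) / V (\<mu> j) else 0)"
      by (rule sum.cong[OF refl]) (simp add: sum.inter_filter fin)
    also have "\<dots> = (\<Sum>j\<in>I. \<Sum>k\<in>I. \<Sum>h\<in>?T. \<Sum>i<m. ?o i h j * ?o i h k / V i)"
    proof (intro sum.cong refl)
      fix j k assume j: "j \<in> I" and k: "k \<in> I"
      have "real (min (p j) (p k)) = (\<Sum>h\<in>?T. if h \<le> p j \<and> h \<le> p k then 1 else 0)"
        using min_layers[of j "p k"] j I by auto
      then show "(if \<mu> k = \<mu> j then real (min (p j) (p k)) / V (\<mu> j) else 0)
          = (\<Sum>h\<in>?T. \<Sum>i<m. ?o i h j * ?o i h k / V i)"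
        unfolding c2[OF j] by (simp add: sum_divide_distrib)
    qed
    also have "\<dots> = (\<Sum>j\<in>I. \<Sum>h\<in>?T. \<Sum>k\<in>I. \<Sum>i<m. ?o i h j * ?o i h k / V i)"
      by (intro sum.cong refl sum.swap)
    also have "\<dots> = (\<Sum>h\<in>?T. \<Sum>j\<in>I. \<Sum>k\<in>I. \<Sum>i<m. ?o i h j * ?o i h k / V i)"
      by (rule sum.swap)
    also have "\<dots> = (\<Sum>h\<in>?T. \<Sum>j\<in>I. \<Sum>i<m. \<Sum>k\<in>I. ?o i h j * ?o i h k / V i)"
      by (intro sum.cong refl sum.swap)
    also have "\<dots> = (\<Sum>h\<in>?T. \<Sum>i<m. \<Sum>j\<in>I. \<Sum>k\<in>I. ?o i h j * ?o i h k / V i)"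
      by (intro sum.cong refl sum.swap)
    also have "\<dots> = (\<Sum>h\<in>?T. \<Sum>i<m. (\<Sum>j\<in>I. ?o i h j) * (\<Sum>j\<in>I. ?o i h j) / V i)"
      by (simp only: sum_product sum_divide_distrib)
    finally show ?thesis .
  qed
  show ?thesis
    unfolding spt_total_def A B c sum.distrib[symmetric] add_divide_distrib[symmetric]
      sum_divide_distrib[of _ _ "2::real"]
    by (intro sum.cong refl) (simp add: field_simps)
qed

lemma follower_opt_le_spt_total:
  assumes I: "I \<subseteq> {..<N}" and \<mu>: "\<And>j. j \<in> I \<Longrightarrow> \<mu> j < m"
  shows "follower_opt P I \<le> spt_total P \<mu> I"
proof (cases "I = {}")
  case True
  then show ?thesis by (simp add: follower_opt_def spt_total_def coef_sum_def)
next
  case False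
  then have m: "0 < m" using \<mu> by fastforce
  have c: "(\<Sum>i<m. card {j\<in>I. \<mu> j = i \<and> h \<le> p j}) = card {j\<in>I. h \<le> p j}" for h
  proof -
    have "{j\<in>I. h \<le> p j} = (\<Union>i<m. {j\<in>I. \<mu> j = i \<and> h \<le> p j})" using \<mu> by auto
    then show ?thesis
      using finite_jobs[OF I] by (simp add: card_UN_disjoint disjoint_iff)
  qed
  have layers: "spt_total P \<mu> I
      = (\<Sum>h\<in>{1..total_proc P}. \<Sum>i<m. triangle (card {j\<in>I. \<mu> j = i \<and> h \<le> p j}) / V i)"
    using I \<mu> by (rule spt_total_layers)
  show ?thesis
    unfolding follower_opt_def layers by (intro sum_mono coef_sum_le m c)
qed

text \<open>
  Inserting the jobs from the longest to the shortest, each at the machine that the greedy rule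
  picks, the increments of the two sides agree.
\<close>

lemma follower_opt_attained:
  assumes m: "0 < m" and I: "I \<subseteq> {..<N}"
  shows "\<exists>\<mu>. (\<forall>j\<in>I. \<mu> j < m) \<and> spt_total P \<mu> I = follower_opt P I"
proof -
  have "\<exists>\<mu>. (\<forall>j\<in>I. \<mu> j < m) \<and> (\<forall>i<m. card {j\<in>I. \<mu> j = i} = greedy P (card I) i)
      \<and> spt_total P \<mu> I = follower_opt P I"
    using finite_jobs[OF I] I
  proof (induction "card I" arbitrary: I)
    case 0
    then show ?case by (auto simp: follower_opt_def spt_total_def coef_sum_def intro!: exI[of _ "\<lambda>_. 0"] m)
  next
    case (Suc r)
    then have "I \<noteq> {}" by auto
    then obtain q where q: "q \<in> I" and qmin: "\<And>j. j \<in> I \<Longrightarrow> p q \<le> p j"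
      using Suc.prems(1) by (metis arg_min_if_finite(1) arg_min_least)
    define J where "J = I - {q}"
    have IJ: "I = insert q J" and qJ: "q \<notin> J" and J: "finite J" "J \<subseteq> {..<N}"
      using q Suc.prems by (auto simp: J_def)
    have cJ: "card J = r" using Suc.hyps(2) IJ qJ J by simp
    then obtain \<mu> where \<mu>: "\<forall>j\<in>J. \<mu> j < m" "\<forall>i<m. card {j\<in>J. \<mu> j = i} = greedy P r i"
      "spt_total P \<mu> J = follower_opt P J"
      using Suc.hyps(1)[of J] J by metis
    define \<nu> where "\<nu> = \<mu>(q := pick P r)"
    have \<nu>J: "\<And>j. j \<in> J \<Longrightarrow> \<nu> j = \<mu> j" and \<nu>q: "\<nu> q = pick P r" using qJ by (auto simp: \<nu>_def)
    have on: "{j\<in>J. \<nu> j = i} = {j\<in>J. \<mu> j = i}" for i using \<nu>J by auto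
    have "\<forall>j\<in>I. \<nu> j < m" using \<mu> \<nu>J \<nu>q pick_less[OF m] by (auto simp: IJ)
    moreover have "card {j\<in>I. \<nu> j = i} = greedy P (card I) i" if "i < m" for i
    proof -
      have "{j\<in>I. \<nu> j = i} = (if i = pick P r then insert q {j\<in>J. \<mu> j = i} else {j\<in>J. \<mu> j = i})"
        using \<nu>J \<nu>q by (auto simp: IJ)
      then show ?thesis using \<mu>(2) that J qJ Suc.hyps(2)[symmetric] by (auto simp: greedy_Suc)
    qed
    moreover have "spt_total P \<nu> I = follower_opt P I"
    proof -
      have "spt_total P \<nu> J = spt_total P \<mu> J"
        unfolding spt_total_def using \<nu>J on by simp
      moreover have "(\<Sum>k\<in>{k\<in>J. \<nu> k = \<nu> q}. real (min (p q) (p k)))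
          = real (greedy P r (pick P r)) * real (p q)"
      proof -
        have "(\<Sum>k\<in>{k\<in>J. \<nu> k = \<nu> q}. real (min (p q) (p k))) = (\<Sum>k\<in>{k\<in>J. \<mu> k = pick P r}. real (p q))"
          unfolding on \<nu>q using qmin by (intro sum.cong refl) (auto simp: IJ min_def)
        then show ?thesis using \<mu>(2) pick_less[OF m, of r] by simp
      qed
      ultimately show ?thesis
        using follower_opt_insert[OF J(2), of q] Suc.prems(2) qJ qmin \<mu>(3) spt_total_insert[OF J(1) qJ, of \<nu>]
        by (simp add: IJ \<nu>q cJ coef_def position_cost_def algebra_simps add_divide_distrib)
    qed
    ultimately show ?case by blast
  qed
  then show ?thesis by blast
qed


section \<open>Optimal schedules of the follower\<close>

definition before :: "schedule \<Rightarrow> nat \<Rightarrow> nat \<Rightarrow> bool" where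
  "before s k j \<longleftrightarrow> machine_of s k = machine_of s j \<and> completion P s k \<le> start_of s j"

lemma completion_gt: "j < N \<Longrightarrow> start_of s j < completion P s j"
  by (simp add: completion_def p_pos)

lemma before_asym: "\<lbrakk>j < N; k < N; before s k j\<rbrakk> \<Longrightarrow> \<not> before s j k"
  using completion_gt[of j s] completion_gt[of k s] by (auto simp: before_def)

lemma before_total:
  "\<lbrakk>s \<in> schedules P I; j \<in> I; k \<in> I; j \<noteq> k; machine_of s k = machine_of s j\<rbrakk>
    \<Longrightarrow> before s j k \<or> before s k j"
proof -
  assume s: "s \<in> schedules P I" and j: "j \<in> I" and k: "k \<in> I" and ne: "j \<noteq> k" and eq: "machine_of s k = machine_of s j"
  have "completion P s j \<le> start_of s k \<or> completion P s k \<le> start_of s j"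
    using s j k ne eq[symmetric] unfolding schedules_def by blast
  then show ?thesis using eq by (simp add: before_def)
qed

text \<open>
  Induction removes the job that starts last: all the others are completed when it starts.
\<close>

lemma machine_capacity:
  assumes s: "s \<in> schedules P I" and I: "I \<subseteq> {..<N}"
  shows "\<lbrakk>K \<subseteq> I; \<And>k. k \<in> K \<Longrightarrow> machine_of s k = i \<and> completion P s k \<le> x; 0 \<le> x\<rbrakk>
    \<Longrightarrow> (\<Sum>k\<in>K. real (p k)) / V i \<le> x"
proof (induction "card K" arbitrary: K x)
  case 0
  then have "K = {}" using finite_subset[OF _ finite_jobs[OF I]] by auto
  then show ?case using 0 by simp
next
  case (Suc c)
  have fin: "finite K" using Suc.prems(1) finite_subset finite_jobs[OF I] by blast
  have "K \<noteq> {}" using Suc.hyps(2) by auto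
  then have "Max (start_of s ` K) \<in> start_of s ` K" using fin by (intro Max_in) auto
  then obtain l where l: "l \<in> K" "start_of s l = Max (start_of s ` K)" by auto
  have lmax: "start_of s k \<le> start_of s l" if "k \<in> K" for k
    unfolding l(2) using fin that by simp
  have "completion P s k \<le> start_of s l" if k: "k \<in> K - {l}" for k
  proof -
    have "before s k l \<or> before s l k"
      using before_total[OF s, of k l] k l Suc.prems(1,2) by force
    moreover have "\<not> before s l k"
      using lmax[of k] completion_gt[of l s] k l(1) Suc.prems(1) I by (auto simp: before_def)
    ultimately show ?thesis by (auto simp: before_def)
  qed
  moreover have "0 \<le> start_of s l" using s l(1) Suc.prems(1) by (auto simp: schedules_def)
  ultimately have "(\<Sum>k\<in>K - {l}. real (p k)) / V i \<le> start_of s l"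
    using Suc.hyps(2) Suc.prems(1,2) l(1) fin by (intro Suc.hyps(1)) auto
  moreover have "(\<Sum>k\<in>K. real (p k)) = real (p l) + (\<Sum>k\<in>K - {l}. real (p k))"
    by (rule sum.remove[OF fin l(1)])
  moreover have "start_of s l + real (p l) / V i \<le> x"
    using Suc.prems(2)[OF l(1)] by (auto simp: completion_def)
  ultimately show ?case by (simp add: add_divide_distrib)
qed

text \<open>
  Of two jobs on one machine one waits for the other. The total completion time is at least what
  these waits amount to, and a wait for a longer job exceeds the minimum that \<open>spt_total\<close> charges.
\<close>

lemma spt_total_le_total_completion:
  assumes s: "s \<in> schedules P I" and I: "I \<subseteq> {..<N}"
  shows "spt_total P (machine_of s) I
      + (\<Sum>j\<in>I. \<Sum>k\<in>{k\<in>I. before s k j}. real (p k - min (p j) (p k)) / V (machine_of s j))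
    \<le> total_completion P I s"
proof -
  note fin = finite_jobs[OF I]
  let ?\<mu> = "machine_of s"
  let ?w = "\<lambda>j k. real (min (p j) (p k)) / V (?\<mu> j)"
  have irr: "\<not> before s j j" if "j \<in> I" for j
    using completion_gt[of j s] that I by (auto simp: before_def)
  have pairs: "(\<Sum>j\<in>I. \<Sum>k\<in>{k\<in>I. ?\<mu> k = ?\<mu> j}. ?w j k)
      = (\<Sum>j\<in>I. real (p j) / V (?\<mu> j)) + 2 * (\<Sum>j\<in>I. \<Sum>k\<in>{k\<in>I. before s k j}. ?w j k)"
  proof -
    have split: "(\<Sum>k\<in>{k\<in>I. ?\<mu> k = ?\<mu> j}. ?w j k) = real (p j) / V (?\<mu> j)
        + (\<Sum>k\<in>I. if before s k j then ?w j k else 0) + (\<Sum>k\<in>I. if before s j k then ?w k j else 0)"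
      if j: "j \<in> I" for j
    proof -
      have "(\<Sum>k\<in>{k\<in>I. ?\<mu> k = ?\<mu> j}. ?w j k) = (\<Sum>k\<in>I. if ?\<mu> k = ?\<mu> j then ?w j k else 0)"
        by (simp add: sum.inter_filter fin)
      also have "\<dots> = (\<Sum>k\<in>I. (if k = j then real (p j) / V (?\<mu> j) else 0)
          + (if before s k j then ?w j k else 0) + (if before s j k then ?w k j else 0))"
      proof (rule sum.cong[OF refl])
        fix k assume k: "k \<in> I"
        show "(if ?\<mu> k = ?\<mu> j then ?w j k else 0) = (if k = j then real (p j) / V (?\<mu> j) else 0)
          + (if before s k j then ?w j k else 0) + (if before s j k then ?w k j else 0)"
        proof (cases "?\<mu> k = ?\<mu> j")
          case False
          then show ?thesis by (auto simp: before_def)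
        next
          case True
          show ?thesis
          proof (cases "k = j")
            case True
            then show ?thesis using irr[OF j] by simp
          next
            case False
            have jk: "j < N" "k < N" using I j k by auto
            have "before s j k \<and> \<not> before s k j \<or> before s k j \<and> \<not> before s j k"
              using before_total[OF s j k] before_asym[OF jk] before_asym[OF jk(2,1)] False True by blast
            moreover have "?w k j = ?w j k" using True by (simp add: min.commute)
            ultimately show ?thesis
              using False True by (elim disjE conjE) simp_all
          qed
        qed
      qed
      also have "\<dots> = real (p j) / V (?\<mu> j)
        + (\<Sum>k\<in>I. if before s k j then ?w j k else 0) + (\<Sum>k\<in>I. if before s j k then ?w k j else 0)"
        using fin j by (simp add: sum.distrib)
      finally show ?thesis .
    qed
    have "(\<Sum>j\<in>I. \<Sum>k\<in>I. if before s j k then ?w k j else 0) = (\<Sum>j\<in>I. \<Sum>k\<in>I. if before s k j then ?w j k else 0)"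
      by (rule sum.swap)
    moreover have "(\<Sum>j\<in>I. \<Sum>k\<in>I. if before s k j then ?w j k else 0) = (\<Sum>j\<in>I. \<Sum>k\<in>{k\<in>I. before s k j}. ?w j k)"
      by (rule sum.cong[OF refl]) (simp add: sum.inter_filter fin)
    moreover have "(\<Sum>j\<in>I. \<Sum>k\<in>{k\<in>I. ?\<mu> k = ?\<mu> j}. ?w j k)
      = (\<Sum>j\<in>I. real (p j) / V (?\<mu> j)) + (\<Sum>j\<in>I. \<Sum>k\<in>I. if before s k j then ?w j k else 0)
        + (\<Sum>j\<in>I. \<Sum>k\<in>I. if before s j k then ?w k j else 0)"
      unfolding sum.distrib[symmetric] by (rule sum.cong[OF refl split])
    ultimately show ?thesis by linarith
  qed
  have compl: "real (p j) / V (?\<mu> j) + (\<Sum>k\<in>{k\<in>I. before s k j}. real (p k) / V (?\<mu> j)) \<le> completion P s j"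
    if j: "j \<in> I" for j
  proof -
    have "(\<Sum>k\<in>{k\<in>I. before s k j}. real (p k)) / V (?\<mu> j) \<le> start_of s j"
      using s j by (intro machine_capacity[OF s I]) (auto simp: before_def schedules_def)
    then show ?thesis by (simp add: completion_def sum_divide_distrib)
  qed
  have "(\<Sum>j\<in>I. real (p j) / V (?\<mu> j) + (\<Sum>k\<in>{k\<in>I. before s k j}. real (p k) / V (?\<mu> j)))
      \<le> total_completion P I s"
    unfolding total_completion_def by (intro sum_mono compl)
  moreover have "real (p k) / V (?\<mu> j) = ?w j k + real (p k - min (p j) (p k)) / V (?\<mu> j)" for j k
  proof -
    have "p k = min (p j) (p k) + (p k - min (p j) (p k))" by simp
    then have "real (p k) = real (min (p j) (p k)) + real (p k - min (p j) (p k))"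
      by (metis of_nat_add)
    then show ?thesis by (metis add_divide_distrib)
  qed
  then have "(\<Sum>j\<in>I. real (p j) / V (?\<mu> j) + (\<Sum>k\<in>{k\<in>I. before s k j}. real (p k) / V (?\<mu> j)))
    = (\<Sum>j\<in>I. real (p j) / V (?\<mu> j)) + ((\<Sum>j\<in>I. \<Sum>k\<in>{k\<in>I. before s k j}. ?w j k)
      + (\<Sum>j\<in>I. \<Sum>k\<in>{k\<in>I. before s k j}. real (p k - min (p j) (p k)) / V (?\<mu> j)))"
    unfolding sum.distrib[symmetric] by (intro sum.cong refl arg_cong2[of _ _ _ _ "(+)"])
  moreover have "(a + 2 * b + a) / 2 = a + b" for a b :: real by simp
  ultimately show ?thesis
    unfolding spt_total_def pairs by (simp only:)
qed

lemma schedules_machine: "s \<in> schedules P I \<Longrightarrow> j \<in> I \<Longrightarrow> machine_of s j < m"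
  by (auto simp: schedules_def)

lemma follower_opt_le:
  assumes s: "s \<in> schedules P I" and I: "I \<subseteq> {..<N}"
  shows "follower_opt P I \<le> total_completion P I s"
proof -
  have "0 \<le> (\<Sum>j\<in>I. \<Sum>k\<in>{k\<in>I. before s k j}. real (p k - min (p j) (p k)) / V (machine_of s j))"
    by (intro sum_nonneg) simp
  moreover have "follower_opt P I \<le> spt_total P (machine_of s) I"
    using I schedules_machine[OF s] by (rule follower_opt_le_spt_total)
  ultimately show ?thesis using spt_total_le_total_completion[OF s I] by linarith
qed

text \<open>
  In an optimal schedule the surplus of the preceding estimate vanishes, and with it each of its
  non-negative summands.
\<close>

lemma follower_optimal_spt:
  assumes s: "s \<in> schedules P I" and I: "I \<subseteq> {..<N}" and opt: "total_completion P I s = follower_opt P I"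
  shows "spt_total P (machine_of s) I = follower_opt P I"
    and "\<lbrakk>j \<in> I; k \<in> I; before s k j\<rbrakk> \<Longrightarrow> p k \<le> p j"
proof -
  let ?x = "\<lambda>j k. real (p k - min (p j) (p k)) / V (machine_of s j)"
  let ?X = "\<Sum>j\<in>I. \<Sum>k\<in>{k\<in>I. before s k j}. ?x j k"
  have X: "0 \<le> ?X" by (intro sum_nonneg) simp
  have le: "follower_opt P I \<le> spt_total P (machine_of s) I"
    using I schedules_machine[OF s] by (rule follower_opt_le_spt_total)
  show "spt_total P (machine_of s) I = follower_opt P I"
    using spt_total_le_total_completion[OF s I] X le opt by linarith
  have X0: "?X = 0" using spt_total_le_total_completion[OF s I] X le opt by linarith
  assume j: "j \<in> I" and k: "k \<in> I" "before s k j"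
  have "(\<Sum>k\<in>{k\<in>I. before s k j}. ?x j k) = 0"
    using X0 j finite_jobs[OF I] by (subst (asm) sum_nonneg_eq_0_iff) (auto intro!: sum_nonneg)
  then have "?x j k = 0"
    using k finite_jobs[OF I] by (subst (asm) sum_nonneg_eq_0_iff) auto
  then show "p k \<le> p j" by auto
qed


section \<open>The order of the jobs\<close>

text \<open>
  The program takes the jobs in the reverse of this order: by increasing processing time, and by
  increasing due date among jobs of the same processing time.
\<close>

definition precedes :: "nat \<Rightarrow> nat \<Rightarrow> bool" where
  "precedes i j \<longleftrightarrow> p j < p i \<or> p i = p j \<and> (due P j < due P i \<or> due P i = due P j \<and> i < j)"

definition rank :: "nat \<Rightarrow> nat" where
  "rank j = card {i. i < N \<and> precedes i j}"

definition ord :: "nat \<Rightarrow> nat" where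
  "ord = inv_into {..<N} rank"

lemma precedes_trans: "precedes i j \<Longrightarrow> precedes j k \<Longrightarrow> precedes i k"
  by (auto simp: precedes_def)

lemma precedes_irrefl: "\<not> precedes i i" by (simp add: precedes_def)

lemma precedes_total: "i \<noteq> j \<Longrightarrow> precedes i j \<or> precedes j i"
  by (auto simp: precedes_def)

lemma rank_mono: "i < N \<Longrightarrow> precedes i j \<Longrightarrow> rank i < rank j"
proof -
  assume i: "i < N" and ij: "precedes i j"
  have "{k. k < N \<and> precedes k i} \<subseteq> {k. k < N \<and> precedes k j}"
    using precedes_trans[OF _ ij] by blast
  moreover have "i \<in> {k. k < N \<and> precedes k j}" "i \<notin> {k. k < N \<and> precedes k i}"
    using i ij precedes_irrefl by auto
  ultimately show ?thesis unfolding rank_def by (intro psubset_card_mono) auto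
qed

lemma rank_less: "j < N \<Longrightarrow> rank j < N"
proof -
  assume "j < N"
  then have "j \<in> {..<N}" "j \<notin> {i. i < N \<and> precedes i j}" using precedes_irrefl by auto
  then have "{i. i < N \<and> precedes i j} \<subset> {..<N}" by blast
  then have "rank j < card {..<N}"
    unfolding rank_def by (intro psubset_card_mono) auto
  then show ?thesis by simp
qed

lemma rank_inj: "inj_on rank {..<N}"
proof (rule inj_onI)
  fix i j assume ij: "i \<in> {..<N}" "j \<in> {..<N}" and eq: "rank i = rank j"
  show "i = j"
    using precedes_total[of i j] rank_mono[of i j] rank_mono[of j i] ij eq by auto
qed

lemma rank_image: "rank ` {..<N} = {..<N}"
  using rank_inj rank_less by (intro endo_inj_surj) auto

lemma ord_rank: "j < N \<Longrightarrow> ord (rank j) = j"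
  unfolding ord_def using rank_inj by simp

lemma ord_less: "a < N \<Longrightarrow> ord a < N"
  unfolding ord_def using inv_into_into[of a rank "{..<N}"] rank_image by simp

lemma rank_ord: "a < N \<Longrightarrow> rank (ord a) = a"
  unfolding ord_def using f_inv_into_f[of a rank "{..<N}"] rank_image by simp

lemma ord_inj: "inj_on ord {..<N}"
  by (rule inj_on_inverseI[of _ rank]) (simp add: rank_ord)

lemma ord_precedes: "a < b \<Longrightarrow> b < N \<Longrightarrow> precedes (ord a) (ord b)"
proof -
  assume ab: "a < b" "b < N"
  have r: "rank (ord a) = a" "rank (ord b) = b" using ab by (simp_all add: rank_ord)
  then have "ord a \<noteq> ord b" using ab by auto
  moreover have "\<not> precedes (ord b) (ord a)"
    using rank_mono[OF ord_less[OF ab(2)], of "ord a"] r ab by auto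
  ultimately show ?thesis using precedes_total by blast
qed

definition later :: "nat \<Rightarrow> nat set" where
  "later r = ord ` {r..<N}"

lemma later_N[simp]: "later N = {}" by (simp add: later_def)

lemma later_0: "later 0 = {..<N}"
proof -
  have "ord ` {..<N} = {..<N}" using ord_inj ord_less by (intro endo_inj_surj) auto
  then show ?thesis by (simp add: later_def lessThan_atLeast0)
qed

lemma later_subset: "later r \<subseteq> {..<N}" by (auto simp: later_def ord_less)

lemma later_Suc: "r < N \<Longrightarrow> later r = insert (ord r) (later (Suc r))"
proof -
  assume "r < N"
  then have "{r..<N} = insert r {Suc r..<N}" by auto
  then show ?thesis by (simp add: later_def)
qed

lemma ord_notin_later: "r < N \<Longrightarrow> ord r \<notin> later (Suc r)"
  using ord_inj by (fastforce simp: later_def inj_on_def)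

lemma finite_later: "finite (later r)" by (simp add: later_def)

lemma ord_in_later: "r < N \<Longrightarrow> ord r \<in> later r" by (simp add: later_def)

lemma later_le: "j \<in> later r \<Longrightarrow> r < N \<Longrightarrow> p j \<le> p (ord r)"
proof -
  assume "j \<in> later r" and "r < N"
  then obtain b where "j = ord b" "r \<le> b" "b < N" by (auto simp: later_def)
  then show ?thesis
    using ord_precedes[of r b] by (cases "r = b") (auto simp: precedes_def)
qed

lemma later_precedes: "j \<in> later (Suc r) \<Longrightarrow> precedes (ord r) j"
  by (auto simp: later_def intro!: ord_precedes)


section \<open>The dynamic program\<close>

definition states :: nat where "states = total_proc P ^ m"

definition load_index :: "(nat \<Rightarrow> nat) \<Rightarrow> nat" where
  "load_index L = (\<Sum>i<m. L i * total_proc P ^ i)"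

definition digit :: "nat \<Rightarrow> nat \<Rightarrow> nat" where
  "digit k i = k div total_proc P ^ i mod total_proc P"

text \<open>
  Whether the next job to be considered, \<open>ord (r - 1)\<close>, has the processing time of
  the jobs that may be pending when \<open>r\<close> jobs remain, which is that of the job
  considered last, \<open>ord r\<close>.
\<close>

definition same_group :: "nat \<Rightarrow> bool" where
  "same_group r \<longleftrightarrow> 0 < r \<and> p (ord (r - 1)) = p (ord r)"

text \<open>
  Excess, weight and decision. The decision is \<open>0\<close> if there is none, \<open>1\<close>
  for skipping the next job, \<open>2\<close> for declaring it late and \<open>i + 3\<close> for
  appending a job to machine \<open>i\<close>.
\<close>

type_synonym entry = "real \<times> real \<times> nat"

definition offer :: "real \<Rightarrow> real \<Rightarrow> nat \<Rightarrow> entry \<Rightarrow> entry" where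
  "offer e g d cur = (if snd (snd cur) = 0 \<or> e < fst cur \<or> e = fst cur \<and> g < fst (snd cur)
     then (e, g, d) else cur)"

definition ending :: "nat \<Rightarrow> nat \<Rightarrow> nat \<Rightarrow> real" where
  "ending q k i = (real (digit k i) + real q) / V i"

text \<open>
  Appending a job of length \<open>q\<close> as the \<open>u\<close>-th last one of all changes
  the excess by its completion time minus its share \<open>q * coef (u - 1)\<close> of the
  follower's optimum. The test of the new index only keeps the program within the table; it
  succeeds in every state that can be reached.
\<close>

primrec try_machines ::
  "(nat \<Rightarrow> entry) \<Rightarrow> nat \<Rightarrow> nat \<Rightarrow> (real \<Rightarrow> bool) \<Rightarrow> nat \<Rightarrow> entry \<Rightarrow> nat \<Rightarrow> entry" where
  "try_machines nxt q u ok k cur 0 = cur"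
| "try_machines nxt q u ok k cur (Suc i) = (let prev = try_machines nxt q u ok k cur i;
      k' = k + q * total_proc P ^ i; c = ending q k i in
      if k' \<le> states \<and> ok c
      then offer (fst (nxt k') + c - real q * coef P (u - 1)) (fst (snd (nxt k'))) (i + 3) prev
      else prev)"

definition flush_entry :: "(nat \<Rightarrow> entry) \<Rightarrow> nat \<Rightarrow> nat \<Rightarrow> nat \<Rightarrow> entry" where
  "flush_entry nxt q u k =
     (if k < states then try_machines nxt q u (\<lambda>_. True) k (0, 0, 0) m else (0, 0, 0))"

definition job_entry ::
  "(nat \<Rightarrow> entry) \<Rightarrow> (nat \<Rightarrow> entry) \<Rightarrow> (nat \<Rightarrow> entry) \<Rightarrow> nat \<Rightarrow> nat \<Rightarrow> nat \<Rightarrow> nat \<Rightarrow> entry" where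
  "job_entry nskip ntardy nearly r u b k = (if k < states then
     let j = ord r;
       c1 = (if u \<le> b + r then offer (fst (nskip k)) (fst (snd (nskip k))) 1 (0, 0, 0) else (0, 0, 0));
       c2 = (if b < u then offer (fst (ntardy k)) (fst (snd (ntardy k)) + weight P j) 2 c1 else c1)
     in if b < u then try_machines nearly (p j) u (\<lambda>c. c \<le> due P j) k c2 m else c2
   else (0, 0, 0))"

text \<open>
  Arguments: \<open>r\<close> jobs are not yet considered, \<open>u\<close> jobs are still to be
  appended, and \<open>b\<close> of these are pending, declared late, and have the length of
  \<open>ord r\<close>. Once the group of that length is finished, the pending jobs must be
  appended before another job is considered. The function returned maps the index of the loads to
  an entry.
\<close>

function dp :: "nat \<Rightarrow> nat \<Rightarrow> nat \<Rightarrow> nat \<Rightarrow> entry" where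
  "dp r u b = (if 0 < b \<and> \<not> same_group r then flush_entry (dp r (u - 1) (b - 1)) (p (ord r)) u
     else if r = 0 then (\<lambda>_. (0, 0, 0))
     else job_entry (dp (r - 1) u b) (dp (r - 1) u (b + 1)) (dp (r - 1) (u - 1) b) (r - 1) u b)"
  by pat_completeness auto
termination by (relation "measure (\<lambda>(r, u, b). 2 * r + b)") auto

declare dp.simps[simp del]

lemma dp_flush: "0 < b \<Longrightarrow> \<not> same_group r \<Longrightarrow>
    dp r u b = flush_entry (dp r (u - 1) (b - 1)) (p (ord r)) u"
  by (subst dp.simps) simp

lemma dp_done: "dp 0 u 0 = (\<lambda>_. (0, 0, 0))" by (simp add: dp.simps[of 0])

lemma dp_job: "b = 0 \<or> same_group (Suc r) \<Longrightarrow>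
    dp (Suc r) u b = job_entry (dp r u b) (dp r u (b + 1)) (dp r (u - 1) b) r u b"
  by (subst dp.simps) auto

lemma digit_load_index: "\<lbrakk>(\<Sum>i<m. L i) < total_proc P; i < m\<rbrakk> \<Longrightarrow> digit (load_index L) i = L i"
  unfolding digit_def load_index_def
  by (rule digit_sum) (auto intro: le_less_trans[OF member_le_sum])

lemma load_index_bound:
  assumes "(\<Sum>i<m. L i) \<le> c" and T: "0 < total_proc P" and m: "0 < m"
  shows "load_index L \<le> c * total_proc P ^ (m - 1)"
proof -
  have "L i * total_proc P ^ i \<le> L i * total_proc P ^ (m - 1)" if "i < m" for i
    using that T by (intro mult_left_mono power_increasing) auto
  then have "load_index L \<le> (\<Sum>i<m. L i * total_proc P ^ (m - 1))"
    unfolding load_index_def by (intro sum_mono) auto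
  also have "\<dots> = (\<Sum>i<m. L i) * total_proc P ^ (m - 1)" by (simp add: sum_distrib_right)
  also have "\<dots> \<le> c * total_proc P ^ (m - 1)" using assms(1) by (intro mult_right_mono) auto
  finally show ?thesis .
qed

lemma load_index_le: "(\<Sum>i<m. L i) \<le> total_proc P \<Longrightarrow> load_index L \<le> states"
proof -
  assume L: "(\<Sum>i<m. L i) \<le> total_proc P"
  show ?thesis
  proof (cases "0 < m \<and> 0 < total_proc P")
    case True
    then have "load_index L \<le> total_proc P * total_proc P ^ (m - 1)" using load_index_bound[OF L] by simp
    then show ?thesis using True by (cases m) (simp_all add: states_def)
  next
    case False
    then show ?thesis using L by (cases "m = 0") (auto simp: load_index_def states_def)
  qed
qed

lemma load_index_less: "(\<Sum>i<m. L i) < total_proc P \<Longrightarrow> load_index L < states"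
proof -
  assume L: "(\<Sum>i<m. L i) < total_proc P"
  show ?thesis
  proof (cases "0 < m")
    case True
    have "load_index L \<le> (total_proc P - 1) * total_proc P ^ (m - 1)"
      using L by (intro load_index_bound True) auto
    also have "\<dots> < total_proc P * total_proc P ^ (m - 1)" using L by (intro mult_strict_right_mono) auto
    finally show ?thesis using True by (cases m) (simp_all add: states_def)
  next
    case False
    then show ?thesis by (simp add: load_index_def states_def)
  qed
qed

text \<open>
  Loads are measured in units of processing, not of time, to keep them integral.
\<close>

definition load :: "(nat \<Rightarrow> nat) \<Rightarrow> nat set \<Rightarrow> nat \<Rightarrow> nat" where
  "load \<mu> Q i = (\<Sum>k\<in>{k\<in>Q. \<mu> k = i}. p k)"

abbreviation key :: "(nat \<Rightarrow> nat) \<Rightarrow> nat set \<Rightarrow> nat" where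
  "key \<mu> Q \<equiv> load_index (load \<mu> Q)"

lemma load_cong: "(\<And>k. k \<in> Q \<Longrightarrow> \<mu> k = \<nu> k) \<Longrightarrow> load \<mu> Q = load \<nu> Q"
  unfolding load_def by (rule ext, rule sum.cong) auto

lemma load_insert:
  "finite Q \<Longrightarrow> j \<notin> Q \<Longrightarrow> load \<mu> (insert j Q) = (load \<mu> Q)(\<mu> j := load \<mu> Q (\<mu> j) + p j)"
proof (rule ext)
  fix i assume "finite Q" "j \<notin> Q"
  moreover have "{k\<in>insert j Q. \<mu> k = i} = (if \<mu> j = i then insert j {k\<in>Q. \<mu> k = i} else {k\<in>Q. \<mu> k = i})"
    by auto
  ultimately show "load \<mu> (insert j Q) i = ((load \<mu> Q)(\<mu> j := load \<mu> Q (\<mu> j) + p j)) i"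
    by (simp add: load_def)
qed

lemma sum_load: "finite Q \<Longrightarrow> \<forall>k\<in>Q. \<mu> k < m \<Longrightarrow> (\<Sum>i<m. load \<mu> Q i) = (\<Sum>k\<in>Q. p k)"
  unfolding load_def by (rule sum.group) auto

lemma key_insert:
  assumes "finite Q" "j \<notin> Q" "\<mu> j < m"
  shows "key \<mu> (insert j Q) = key \<mu> Q + p j * total_proc P ^ \<mu> j"
proof -
  have "key \<mu> (insert j Q) = (\<Sum>i<m. load \<mu> Q i * total_proc P ^ i
      + (if i = \<mu> j then p j * total_proc P ^ i else 0))"
    unfolding load_index_def load_insert[OF assms(1,2)] by (rule sum.cong) (auto simp: algebra_simps)
  then show ?thesis using assms(3) by (simp add: sum.distrib load_index_def)
qed

text \<open>
  The length of a job not yet appended keeps every load below the base of the index.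
\<close>

lemma room:
  assumes Q: "Q \<subseteq> {..<N}" and j: "j < N" "j \<notin> Q" and \<mu>: "\<forall>k\<in>Q. \<mu> k < m"
  shows "(\<Sum>i<m. load \<mu> Q i) + p j \<le> total_proc P"
proof -
  have "(\<Sum>k\<in>insert j Q. p k) \<le> total_proc P"
    unfolding total_proc_def using Q j by (intro sum_mono2) auto
  then show ?thesis using sum_load[OF finite_jobs[OF Q] \<mu>] j finite_jobs[OF Q] by simp
qed

lemma
  assumes Q: "Q \<subseteq> {..<N}" and j: "j < N" "j \<notin> Q" and \<mu>: "\<forall>k\<in>Q. \<mu> k < m"
  shows key_less: "key \<mu> Q < states"
    and digit_key: "i < m \<Longrightarrow> digit (key \<mu> Q) i = load \<mu> Q i"
    and key_place: "\<mu> j < m \<Longrightarrow> key \<mu> Q + p j * total_proc P ^ \<mu> j \<le> states"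
proof -
  have l: "(\<Sum>i<m. load \<mu> Q i) < total_proc P" using room[OF Q j \<mu>] p_pos[OF j(1)] by linarith
  show "key \<mu> Q < states" by (rule load_index_less[OF l])
  show "i < m \<Longrightarrow> digit (key \<mu> Q) i = load \<mu> Q i" by (rule digit_load_index[OF l])
  assume \<mu>j: "\<mu> j < m"
  have iQ: "insert j Q \<subseteq> {..<N}" using Q j by auto
  have "(\<Sum>k\<in>insert j Q. p k) \<le> total_proc P"
    unfolding total_proc_def using Q j by (intro sum_mono2) auto
  moreover have "(\<Sum>i<m. load \<mu> (insert j Q) i) = (\<Sum>k\<in>insert j Q. p k)"
    using \<mu> \<mu>j by (intro sum_load finite_jobs[OF iQ]) auto
  ultimately have "key \<mu> (insert j Q) \<le> states" by (intro load_index_le) simp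
  then show "key \<mu> Q + p j * total_proc P ^ \<mu> j \<le> states"
    using key_insert[where \<mu>=\<mu>, OF finite_jobs[OF Q] j(2) \<mu>j] by simp
qed

section \<open>Comparison of entries\<close>

definition lex_le :: "real \<Rightarrow> real \<Rightarrow> real \<Rightarrow> real \<Rightarrow> bool" where
  "lex_le e g e' g' \<longleftrightarrow> e < e' \<or> e = e' \<and> g \<le> g'"

text \<open>
  Entries without a decision are no values, although their first components are zero.
\<close>

definition at_most :: "entry \<Rightarrow> real \<Rightarrow> real \<Rightarrow> bool" where
  "at_most x e g \<longleftrightarrow> snd (snd x) \<noteq> 0 \<and> lex_le (fst x) (fst (snd x)) e g"

lemma at_most_offer: "d \<noteq> 0 \<Longrightarrow> at_most (offer e g d cur) e g"
  by (auto simp: at_most_def offer_def lex_le_def)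

lemma at_most_offer_other: "d \<noteq> 0 \<Longrightarrow> at_most cur e' g' \<Longrightarrow> at_most (offer e g d cur) e' g'"
  by (auto simp: at_most_def offer_def lex_le_def)

lemma offer_cases: "offer e g d cur = (e, g, d) \<or> offer e g d cur = cur"
  by (simp add: offer_def)

lemma try_machines_other: "at_most cur e g \<Longrightarrow> at_most (try_machines nxt q u ok k cur c) e g"
  by (induction c) (auto simp: Let_def intro: at_most_offer_other)

lemma try_machines_at_most:
  "\<lbrakk>i < c; k + q * total_proc P ^ i \<le> states; ok (ending q k i)\<rbrakk> \<Longrightarrow>
   at_most (try_machines nxt q u ok k cur c)
     (fst (nxt (k + q * total_proc P ^ i)) + ending q k i - real q * coef P (u - 1))
     (fst (snd (nxt (k + q * total_proc P ^ i))))"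
  by (induction c) (auto simp: Let_def less_Suc_eq intro: at_most_offer_other at_most_offer)

lemma try_machines_cases:
  "try_machines nxt q u ok k cur c = cur \<or>
   (\<exists>i<c. k + q * total_proc P ^ i \<le> states \<and> ok (ending q k i) \<and>
     try_machines nxt q u ok k cur c =
      (fst (nxt (k + q * total_proc P ^ i)) + ending q k i - real q * coef P (u - 1),
       fst (snd (nxt (k + q * total_proc P ^ i))), i + 3))"
proof (induction c)
  case (Suc c)
  show ?case
  proof (cases "try_machines nxt q u ok k cur (Suc c) = try_machines nxt q u ok k cur c")
    case True
    then show ?thesis using Suc less_SucI by (simp only: True) blast
  next
    case False
    then show ?thesis
      using offer_cases by (intro disjI2 exI[of _ c]) (auto simp: Let_def offer_def split: if_splits)
  qed
qed simp

lemma job_entry_skip: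
  assumes "k < states" "u \<le> b + r"
  shows "at_most (job_entry nskip ntardy nearly r u b k) (fst (nskip k)) (fst (snd (nskip k)))"
proof -
  have 1: "at_most (offer (fst (nskip k)) (fst (snd (nskip k))) 1 (0, 0, 0)) (fst (nskip k)) (fst (snd (nskip k)))"
    by (rule at_most_offer) simp
  have 2: "at_most (offer e g 2 (offer (fst (nskip k)) (fst (snd (nskip k))) 1 (0, 0, 0)))
      (fst (nskip k)) (fst (snd (nskip k)))" for e g
    by (rule at_most_offer_other[OF _ 1]) simp
  show ?thesis
    using assms 1 try_machines_other[OF 2] by (simp add: job_entry_def Let_def)
qed

lemma job_entry_tardy:
  assumes "k < states" "b < u"
  shows "at_most (job_entry nskip ntardy nearly r u b k) (fst (ntardy k)) (fst (snd (ntardy k)) + weight P (ord r))"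
  using assms by (simp add: job_entry_def Let_def try_machines_other at_most_offer)

lemma job_entry_early:
  assumes "k < states" "b < u" "i < m" "k + p (ord r) * total_proc P ^ i \<le> states"
    "ending (p (ord r)) k i \<le> due P (ord r)"
  shows "at_most (job_entry nskip ntardy nearly r u b k)
     (fst (nearly (k + p (ord r) * total_proc P ^ i)) + ending (p (ord r)) k i - real (p (ord r)) * coef P (u - 1))
     (fst (snd (nearly (k + p (ord r) * total_proc P ^ i))))"
  unfolding job_entry_def Let_def using assms(1,2)
  by (simp only: if_True) (rule try_machines_at_most, use assms in auto)

section \<open>The dynamic program is a lower bound\<close>

text \<open>
  The part of the follower's optimum that belongs to the appended jobs \<open>Q\<close>, which are
  the shortest ones of a selection of \<open>n\<close> jobs: in layer \<open>h\<close> the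
  appended jobs shorter than \<open>h\<close> do not count, and the remaining jobs, the \<open>n -
  card Q\<close> longest ones, have yet to be paid for.
\<close>

definition partial_opt :: "nat set \<Rightarrow> real" where
  "partial_opt Q = (\<Sum>h\<in>{1..total_proc P}.
     coef_sum P (n - card {j\<in>Q. p j < h}) - coef_sum P (n - card Q))"

lemma partial_opt_empty: "partial_opt {} = 0" by (simp add: partial_opt_def)

lemma partial_opt_insert:
  assumes Q: "Q \<subseteq> {..<N}" "card Q < n" and j: "j < N" "j \<notin> Q" and le: "\<forall>k\<in>Q. p k \<le> p j"
  shows "partial_opt (insert j Q) = partial_opt Q + real (p j) * coef P (n - card Q - 1)"
proof -
  note fin = finite_jobs[OF Q(1)]
  obtain x where x: "n - card Q = Suc x" using Q(2) by (metis Suc_diff_Suc)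
  then have x': "n - card (insert j Q) = x" using j fin by simp
  have "coef_sum P (n - card {k\<in>insert j Q. p k < h}) - coef_sum P (n - card (insert j Q))
      = (coef_sum P (n - card {k\<in>Q. p k < h}) - coef_sum P (n - card Q))
        + (if h \<le> p j then coef P x else 0)" for h
  proof (cases "h \<le> p j")
    case True
    then have "{k\<in>insert j Q. p k < h} = {k\<in>Q. p k < h}" by auto
    then show ?thesis using True by (simp add: x x' coef_sum_def)
  next
    case False
    then have "{k\<in>insert j Q. p k < h} = insert j Q" "{k\<in>Q. p k < h} = Q" using le by fastforce+
    then show ?thesis using False by (simp add: x x')
  qed
  then have "partial_opt (insert j Q) = partial_opt Q
      + (\<Sum>h\<in>{1..total_proc P}. if h \<le> p j then coef P x else 0)"
    by (simp add: partial_opt_def sum.distrib)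
  also have "(\<Sum>h\<in>{1..total_proc P}. if h \<le> p j then coef P x else 0) = (\<Sum>h\<in>{1..p j}. coef P x)"
    using p_le_total[OF j(1)] by (intro sum.mono_neutral_cong_right) auto
  finally show ?thesis by (simp add: x)
qed

lemma partial_opt_full:
  assumes Q: "Q \<subseteq> {..<N}" "card Q = n"
  shows "partial_opt Q = follower_opt P Q"
proof -
  note fin = finite_jobs[OF Q(1)]
  have "n - card {j\<in>Q. p j < h} = card {j\<in>Q. h \<le> p j}" for h
  proof -
    have "{j\<in>Q. h \<le> p j} = Q - {j\<in>Q. p j < h}" by auto
    then show ?thesis using Q fin by (simp add: card_Diff_subset)
  qed
  then show ?thesis unfolding partial_opt_def follower_opt_def using Q by (simp add: coef_sum_def)
qed

lemma spt_total_insert_last: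
  assumes Q: "finite Q" "j \<notin> Q" and le: "\<forall>k\<in>Q. p k \<le> p j"
  shows "spt_total P \<mu> (insert j Q) = spt_total P \<mu> Q + (real (load \<mu> Q (\<mu> j)) + real (p j)) / V (\<mu> j)"
proof -
  have "(\<Sum>k\<in>{k\<in>Q. \<mu> k = \<mu> j}. real (min (p j) (p k))) = real (load \<mu> Q (\<mu> j))"
    unfolding load_def of_nat_sum using le by (intro sum.cong) (fastforce simp: min_def)+
  then show ?thesis using spt_total_insert[OF Q, of \<mu>] by (simp add: add.commute)
qed

lemma lex_le_trans: "lex_le a b c d \<Longrightarrow> lex_le c d e f \<Longrightarrow> lex_le a b e f"
  by (auto simp: lex_le_def)

lemma lex_le_add: "lex_le a b c d \<Longrightarrow> a' = a + x \<Longrightarrow> b' = b + y \<Longrightarrow> c' = c + x \<Longrightarrow> d' = d + y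
    \<Longrightarrow> lex_le a' b' c' d'"
  by (auto simp: lex_le_def)

text \<open>
  A plan consists of a selection \<open>I\<close>, the machines \<open>\<mu>\<close>, and a set
  \<open>T\<close> of jobs to be declared late; the remaining ones must be on time when, on each
  machine, the jobs are ordered by length, with the declared ones last among equals. The induction
  follows the states that the plan runs through. Their cost to come is a difference of order-free
  totals, so that the order in which the pending jobs are appended does not matter.
\<close>

lemma dp_le:
  assumes I: "I \<subseteq> {..<N}" "card I = n" and \<mu>: "\<And>j. j \<in> I \<Longrightarrow> \<mu> j < m" and T: "T \<subseteq> I"
    and early: "\<And>j. j \<in> I - T \<Longrightarrow> real (\<Sum>k\<in>{k\<in>I. \<mu> k = \<mu> j \<and>
        (p k < p j \<or> p k = p j \<and> k \<notin> T \<and> (k = j \<or> precedes j k))}. p k) / V (\<mu> j) \<le> due P j"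
  shows "\<lbrakk>r \<le> N; B \<subseteq> T \<inter> later r; \<And>j. j \<in> B \<Longrightarrow> p j = p (ord r);
      \<And>j. \<lbrakk>same_group r; j \<in> T \<inter> later r; p j = p (ord r)\<rbrakk> \<Longrightarrow> j \<in> B; Q = I \<inter> later r - B\<rbrakk>
    \<Longrightarrow> lex_le (fst (dp r (n - card Q) (card B) (key \<mu> Q))) (fst (snd (dp r (n - card Q) (card B) (key \<mu> Q))))
       (spt_total P \<mu> I - partial_opt I - (spt_total P \<mu> Q - partial_opt Q))
       (\<Sum>j\<in>T - later r. weight P j)"
proof (induction "2 * r + card B" arbitrary: r B Q rule: less_induct)
  case less
  note r = less.prems(1) and B = less.prems(2) and Bp = less.prems(3) and grp = less.prems(4) and Q = less.prems(5)
  have finI: "finite I" using finite_jobs[OF I(1)] .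
  have QI: "Q \<subseteq> I" and QN: "Q \<subseteq> {..<N}" and BI: "B \<subseteq> I" using Q I B T by auto
  note finQ = finite_jobs[OF QN]
  have finB: "finite B" using finite_subset[OF BI finI] .
  have QB: "Q \<inter> B = {}" using Q by auto
  have \<mu>Q: "\<forall>k\<in>Q. \<mu> k < m" using \<mu> QI by auto
  have cardQ: "card Q < n" if "j \<in> I" "j \<notin> Q" for j
    unfolding I(2)[symmetric] using that QI finI by (intro psubset_card_mono) auto
  have lt: "r < N" if "B \<noteq> {}" using that B r by (cases "r = N") auto
  consider (flush) "B \<noteq> {}" "\<not> same_group r" | (finished) "r = 0" "B = {}" | (job) r' where "r = Suc r'" "B = {} \<or> same_group r"
    by (cases r) (auto simp: same_group_def)
  then show ?case
  proof cases
    case flush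
    then obtain j where j: "j \<in> B" by auto
    have jN: "j < N" and jQ: "j \<notin> Q" and jI: "j \<in> I" using j BI I QB by auto
    have le: "\<forall>k\<in>Q. p k \<le> p j"
      using Q later_le[of _ r] lt flush Bp[OF j] by auto
    let ?Q = "insert j Q" and ?B = "B - {j}"
    have cB: "card ?B = card B - 1" and cB': "0 < card B" using j finB by (auto simp: card_gt_0_iff)
    have uQ: "n - card ?Q = n - card Q - 1" using jQ finQ by simp
    have IH: "lex_le (fst (dp r (n - card ?Q) (card ?B) (key \<mu> ?Q))) (fst (snd (dp r (n - card ?Q) (card ?B) (key \<mu> ?Q))))
       (spt_total P \<mu> I - partial_opt I - (spt_total P \<mu> ?Q - partial_opt ?Q)) (\<Sum>j\<in>T - later r. weight P j)"
    proof (rule less.hyps)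
      show "?Q = I \<inter> later r - ?B" using Q j B BI by auto
    qed (use r B Bp flush cB cB' in auto)
    have key': "key \<mu> ?Q = key \<mu> Q + p j * total_proc P ^ \<mu> j"
      by (rule key_insert) (use finQ jQ \<mu> jI in auto)
    have "dp r (n - card Q) (card B) (key \<mu> Q)
      = try_machines (dp r (n - card ?Q) (card ?B)) (p j) (n - card Q) (\<lambda>_. True) (key \<mu> Q) (0, 0, 0) m"
      using dp_flush[of "card B" r "n - card Q"] cB' flush key_less[OF QN jN jQ \<mu>Q] Bp[OF j]
      by (simp add: flush_entry_def uQ cB)
    then have "at_most (dp r (n - card Q) (card B) (key \<mu> Q))
      (fst (dp r (n - card ?Q) (card ?B) (key \<mu> ?Q)) + ending (p j) (key \<mu> Q) (\<mu> j) - real (p j) * coef P (n - card Q - 1))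
      (fst (snd (dp r (n - card ?Q) (card ?B) (key \<mu> ?Q))))"
      unfolding key' by (simp only:)
        (rule try_machines_at_most, use \<mu> jI key_place[OF QN jN jQ \<mu>Q] in auto)
    moreover have "ending (p j) (key \<mu> Q) (\<mu> j) = (real (load \<mu> Q (\<mu> j)) + real (p j)) / V (\<mu> j)"
      using digit_key[OF QN jN jQ \<mu>Q] \<mu> jI by (simp add: ending_def)
    ultimately show ?thesis
      using spt_total_insert_last[OF finQ jQ le, of \<mu>] partial_opt_insert[OF QN cardQ[OF jI jQ] jN jQ le]
      unfolding at_most_def
      by (elim conjE lex_le_trans)
        (rule lex_le_add[OF IH, of _ "ending (p j) (key \<mu> Q) (\<mu> j) - real (p j) * coef P (n - card Q - 1)" _ 0], auto)
  next
    case finished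
    then have "Q = I" using Q later_0 I by auto
    then show ?thesis using finished later_0 T I by (simp add: dp_done lex_le_def subset_iff Diff_eq_empty_iff[THEN iffD2])
  next
    case job
    note r' = job(1)
    let ?j = "ord r'"
    have r'N: "r' < N" using r r' by simp
    have jN: "?j < N" using ord_less[OF r'N] .
    have jl: "?j \<notin> later r" using ord_notin_later[OF r'N] r' by simp
    have lat: "later r' = insert ?j (later r)" using later_Suc[OF r'N] r' by simp
    have jQ: "?j \<notin> Q" and jB: "?j \<notin> B" using jl Q B by auto
    have le: "\<forall>k\<in>Q. p k \<le> p ?j"
      using Q lat later_le[OF _ r'N] by auto
    have dpj: "dp r (n - card Q) (card B) = job_entry (dp r' (n - card Q) (card B))
       (dp r' (n - card Q) (card B + 1)) (dp r' (n - card Q - 1) (card B)) r' (n - card Q) (card B)"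
      unfolding r' by (rule dp_job) (use job finB in auto)
    note kl = key_less[OF QN jN jQ \<mu>Q]
    have nQ: "n - card Q = card (I - Q)" using I QI finI by (simp add: card_Diff_subset finQ)
    have IQ: "I - Q = B \<union> (I - later r)" using Q B BI by auto
    have cIQ: "n - card Q = card B + card (I - later r)"
      unfolding nQ IQ using B finB finI by (intro card_Un_disjoint) auto
    have Bp': "p k = p ?j" if "k \<in> B" for k
      using job(2) that Bp[OF that] by (auto simp: same_group_def r')
    have grp': "k \<in> B" if k: "k \<in> T \<inter> later r" "p k = p ?j" for k
    proof -
      have "r < N" using k r by (cases "r = N") auto
      have "p k \<le> p (ord r)" using later_le[of k r] k \<open>r < N\<close> by auto
      moreover have "p (ord r) \<le> p ?j"
        using later_le[OF _ r'N, of "ord r"] lat ord_in_later[OF \<open>r < N\<close>] by auto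
      ultimately have "same_group r" using k(2) by (simp add: same_group_def r')
      then show ?thesis using grp[of k] k by (auto simp: same_group_def r')
    qed
    consider (skip) "?j \<notin> I" | (tardy) "?j \<in> T" | (early) "?j \<in> I - T" by blast
    then show ?thesis
    proof cases
      case skip
      have IH: "lex_le (fst (dp r' (n - card Q) (card B) (key \<mu> Q))) (fst (snd (dp r' (n - card Q) (card B) (key \<mu> Q))))
         (spt_total P \<mu> I - partial_opt I - (spt_total P \<mu> Q - partial_opt Q)) (\<Sum>j\<in>T - later r'. weight P j)"
      proof (rule less.hyps)
        show "Q = I \<inter> later r' - B" using Q skip lat by auto
        show "\<And>j. \<lbrakk>same_group r'; j \<in> T \<inter> later r'; p j = p (ord r')\<rbrakk> \<Longrightarrow> j \<in> B"
          using grp' skip T lat by auto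
      qed (use r r' B Bp' lat in auto)
      have "card (I - later r) \<le> card ({..<r'})"
      proof (rule card_inj_on_le[of rank])
        show "rank ` (I - later r) \<subseteq> {..<r'}"
        proof
          fix x assume "x \<in> rank ` (I - later r)"
          then obtain k where k: "k \<in> I" "k \<notin> later r" "x = rank k" by auto
          have kN: "k < N" using k I by auto
          have "x < N" using rank_less[OF kN] k by simp
          have "ord x = k" using ord_rank[OF kN] k by simp
          have "x < r'" using k skip \<open>x < N\<close> \<open>ord x = k\<close> r'
            by (metis Suc_leI atLeastLessThan_iff image_eqI later_def linorder_neqE_nat)
          then show "x \<in> {..<r'}" by simp
        qed
        show "inj_on rank (I - later r)" using rank_inj I by (rule_tac inj_on_subset) auto
      qed auto
      then have "n - card Q \<le> card B + r'" using cIQ by simp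
      then have "at_most (dp r (n - card Q) (card B) (key \<mu> Q)) (fst (dp r' (n - card Q) (card B) (key \<mu> Q)))
          (fst (snd (dp r' (n - card Q) (card B) (key \<mu> Q))))"
        unfolding dpj using kl by (intro job_entry_skip)
      moreover have "T - later r' = T - later r" using lat skip T by auto
      ultimately show ?thesis using lex_le_trans[OF _ IH] by (simp add: at_most_def)
    next
      case tardy
      let ?B = "insert ?j B"
      have cB: "card ?B = card B + 1" using finB jB by simp
      have IH: "lex_le (fst (dp r' (n - card Q) (card ?B) (key \<mu> Q))) (fst (snd (dp r' (n - card Q) (card ?B) (key \<mu> Q))))
         (spt_total P \<mu> I - partial_opt I - (spt_total P \<mu> Q - partial_opt Q)) (\<Sum>j\<in>T - later r'. weight P j)"
      proof (rule less.hyps)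
        show "Q = I \<inter> later r' - ?B" using Q jl lat by auto
        show "\<And>j. \<lbrakk>same_group r'; j \<in> T \<inter> later r'; p j = p (ord r')\<rbrakk> \<Longrightarrow> j \<in> ?B"
          using grp' lat by auto
        show "2 * r' + card ?B < 2 * r + card B" using cB r' by simp
      qed (use r r' B Bp' lat tardy in auto)
      have "?j \<in> I - later r" using tardy T jl by auto
      then have "0 < card (I - later r)" using finI by (auto simp: card_gt_0_iff)
      then have "card B < n - card Q" using cIQ by simp
      then have "at_most (dp r (n - card Q) (card B) (key \<mu> Q)) (fst (dp r' (n - card Q) (card ?B) (key \<mu> Q)))
          (fst (snd (dp r' (n - card Q) (card ?B) (key \<mu> Q))) + weight P ?j)"
        unfolding dpj cB using kl by (intro job_entry_tardy)
      moreover have "(\<Sum>j\<in>T - later r. weight P j) = weight P ?j + (\<Sum>j\<in>T - later r'. weight P j)"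
      proof -
        have "T - later r = insert ?j (T - later r')" using lat tardy jl by auto
        moreover have "?j \<notin> T - later r'" using lat by auto
        moreover have "finite (T - later r')" using finite_subset[OF T finI] by simp
        ultimately show ?thesis by (metis sum.insert)
      qed
      ultimately show ?thesis
        unfolding at_most_def
        by (elim conjE lex_le_trans) (rule lex_le_add[OF IH, of _ 0 _ "weight P ?j"], simp_all only: add_0_right add.commute)
    next
      case early
      let ?Q = "insert ?j Q"
      have uQ: "n - card ?Q = n - card Q - 1" using jQ finQ by simp
      have IH: "lex_le (fst (dp r' (n - card ?Q) (card B) (key \<mu> ?Q))) (fst (snd (dp r' (n - card ?Q) (card B) (key \<mu> ?Q))))
         (spt_total P \<mu> I - partial_opt I - (spt_total P \<mu> ?Q - partial_opt ?Q)) (\<Sum>j\<in>T - later r'. weight P j)"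
      proof (rule less.hyps)
        show "?Q = I \<inter> later r' - B" using Q early lat jB by auto
        show "\<And>j. \<lbrakk>same_group r'; j \<in> T \<inter> later r'; p j = p (ord r')\<rbrakk> \<Longrightarrow> j \<in> B"
          using grp' lat early by auto
      qed (use r r' B Bp' lat in auto)
      have \<mu>j: "\<mu> ?j < m" using \<mu> early by auto
      have key': "key \<mu> ?Q = key \<mu> Q + p ?j * total_proc P ^ \<mu> ?j"
        by (rule key_insert) (use finQ jQ \<mu>j in auto)
      have e_eq: "ending (p ?j) (key \<mu> Q) (\<mu> ?j) = (real (load \<mu> Q (\<mu> ?j)) + real (p ?j)) / V (\<mu> ?j)"
        using digit_key[OF QN jN jQ \<mu>Q] \<mu>j by (simp add: ending_def)
      have "load \<mu> Q (\<mu> ?j) + p ?j = load \<mu> ?Q (\<mu> ?j)" by (simp add: load_insert[OF finQ jQ])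
      also have "\<dots> \<le> (\<Sum>k\<in>{k\<in>I. \<mu> k = \<mu> ?j \<and>
          (p k < p ?j \<or> p k = p ?j \<and> k \<notin> T \<and> (k = ?j \<or> precedes ?j k))}. p k)"
        unfolding load_def
      proof (rule sum_mono2)
        show "{k \<in> ?Q. \<mu> k = \<mu> ?j} \<subseteq> {k\<in>I. \<mu> k = \<mu> ?j \<and>
            (p k < p ?j \<or> p k = p ?j \<and> k \<notin> T \<and> (k = ?j \<or> precedes ?j k))}"
        proof
          fix k assume k: "k \<in> {k \<in> ?Q. \<mu> k = \<mu> ?j}"
          show "k \<in> {k\<in>I. \<mu> k = \<mu> ?j \<and> (p k < p ?j \<or> p k = p ?j \<and> k \<notin> T \<and> (k = ?j \<or> precedes ?j k))}"
          proof (cases "k = ?j")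
            case True
            then show ?thesis using early by simp
          next
            case False
            then have kQ: "k \<in> Q" using k by simp
            then have "precedes ?j k" using Q r' by (auto intro: later_precedes)
            moreover have "k \<notin> T" if "p k = p ?j" using grp'[of k] that kQ Q by auto
            ultimately show ?thesis using kQ k QI bspec[OF le kQ] by auto
          qed
        qed
      qed (use finI in auto)
      finally have "(real (load \<mu> Q (\<mu> ?j)) + real (p ?j)) / V (\<mu> ?j)
        \<le> real (\<Sum>k\<in>{k\<in>I. \<mu> k = \<mu> ?j \<and>
          (p k < p ?j \<or> p k = p ?j \<and> k \<notin> T \<and> (k = ?j \<or> precedes ?j k))}. p k) / V (\<mu> ?j)"
        by (intro divide_right_mono) (simp_all only: of_nat_add[symmetric] of_nat_le_iff V_pos)
      then have ok: "ending (p ?j) (key \<mu> Q) (\<mu> ?j) \<le> due P ?j"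
        using early[THEN assms(5)] unfolding e_eq by linarith
      have "?j \<in> I - later r" using early jl by auto
      then have "0 < card (I - later r)" using finI by (auto simp: card_gt_0_iff)
      then have cb: "card B < n - card Q" using cIQ by simp
      have "at_most (dp r (n - card Q) (card B) (key \<mu> Q))
        (fst (dp r' (n - card ?Q) (card B) (key \<mu> ?Q)) + ending (p ?j) (key \<mu> Q) (\<mu> ?j) - real (p ?j) * coef P (n - card Q - 1))
        (fst (snd (dp r' (n - card ?Q) (card B) (key \<mu> ?Q))))"
        unfolding dpj uQ key' using kl cb \<mu>j key_place[OF QN jN jQ \<mu>Q \<mu>j] ok by (rule job_entry_early)
      then have "lex_le (fst (dp r (n - card Q) (card B) (key \<mu> Q))) (fst (snd (dp r (n - card Q) (card B) (key \<mu> Q))))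
        (fst (dp r' (n - card ?Q) (card B) (key \<mu> ?Q)) + ending (p ?j) (key \<mu> Q) (\<mu> ?j) - real (p ?j) * coef P (n - card Q - 1))
        (fst (snd (dp r' (n - card ?Q) (card B) (key \<mu> ?Q))))"
        by (simp only: at_most_def)
      then show ?thesis
      proof (rule lex_le_trans)
        have T': "T - later r' = T - later r" using lat early by auto
        have spt: "spt_total P \<mu> ?Q = spt_total P \<mu> Q + ending (p ?j) (key \<mu> Q) (\<mu> ?j)"
          unfolding e_eq by (rule spt_total_insert_last[OF finQ jQ le])
        have opt: "partial_opt ?Q = partial_opt Q + real (p ?j) * coef P (n - card Q - 1)"
          using early by (intro partial_opt_insert[OF QN cardQ[OF _ jQ] jN jQ le]) auto
        show "lex_le (fst (dp r' (n - card ?Q) (card B) (key \<mu> ?Q)) + ending (p ?j) (key \<mu> Q) (\<mu> ?j)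
            - real (p ?j) * coef P (n - card Q - 1))
          (fst (snd (dp r' (n - card ?Q) (card B) (key \<mu> ?Q))))
          (spt_total P \<mu> I - partial_opt I - (spt_total P \<mu> Q - partial_opt Q))
          (\<Sum>j\<in>T - later r. weight P j)"
          using spt opt T'
          by (intro lex_le_add[OF IH, of _ "ending (p ?j) (key \<mu> Q) (\<mu> ?j) - real (p ?j) * coef P (n - card Q - 1)" _ 0])
            simp_all
      qed
    qed
  qed
qed


section \<open>Decisions of the dynamic program build an optimal schedule\<close>

lemma job_entry_cases:
  assumes "snd (snd (job_entry nskip ntardy nearly r u b k)) \<noteq> 0"
  obtains (skip) "u \<le> b + r" "job_entry nskip ntardy nearly r u b k = (fst (nskip k), fst (snd (nskip k)), 1)"
  | (tardy) "b < u" "job_entry nskip ntardy nearly r u b k = (fst (ntardy k), fst (snd (ntardy k)) + weight P (ord r), 2)"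
  | (early) i where "b < u" "i < m" "ending (p (ord r)) k i \<le> due P (ord r)"
      "job_entry nskip ntardy nearly r u b k =
        (fst (nearly (k + p (ord r) * total_proc P ^ i)) + ending (p (ord r)) k i - real (p (ord r)) * coef P (u - 1),
         fst (snd (nearly (k + p (ord r) * total_proc P ^ i))), i + 3)"
proof -
  define c1 where "c1 = (if u \<le> b + r then offer (fst (nskip k)) (fst (snd (nskip k))) 1 (0, 0, 0) else (0, 0, 0))"
  define c2 where "c2 = (if b < u then offer (fst (ntardy k)) (fst (snd (ntardy k)) + weight P (ord r)) 2 c1 else c1)"
  have k: "k < states" using assms by (cases "k < states") (simp_all add: job_entry_def)
  have j: "job_entry nskip ntardy nearly r u b k
      = (if b < u then try_machines nearly (p (ord r)) u (\<lambda>c. c \<le> due P (ord r)) k c2 m else c2)"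
    using k by (simp add: job_entry_def Let_def c1_def c2_def)
  have c1: "c1 = (0, 0, 0) \<or> u \<le> b + r \<and> c1 = (fst (nskip k), fst (snd (nskip k)), 1)"
    by (simp add: c1_def offer_def)
  have c2: "c2 = c1 \<or> b < u \<and> c2 = (fst (ntardy k), fst (snd (ntardy k)) + weight P (ord r), 2)"
    by (auto simp: c2_def offer_def)
  consider "job_entry nskip ntardy nearly r u b k = c2"
    | i where "b < u" "i < m" "ending (p (ord r)) k i \<le> due P (ord r)"
      "job_entry nskip ntardy nearly r u b k =
        (fst (nearly (k + p (ord r) * total_proc P ^ i)) + ending (p (ord r)) k i - real (p (ord r)) * coef P (u - 1),
         fst (snd (nearly (k + p (ord r) * total_proc P ^ i))), i + 3)"
    using try_machines_cases[of nearly "p (ord r)" u "\<lambda>c. c \<le> due P (ord r)" k c2 m] j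
    by (cases "b < u") auto
  then show ?thesis
  proof cases
    case 1
    then have "c2 \<noteq> (0, 0, 0)" using assms by auto
    then show ?thesis using 1 c1 c2 skip tardy by metis
  qed (rule early)
qed

text \<open>
  The load of a machine is read off the index as a digit, as the program does it.
\<close>

definition append :: "nat \<Rightarrow> nat \<Rightarrow> nat \<Rightarrow> schedule \<Rightarrow> schedule" where
  "append k j i s = s\<lparr>machine_of := (machine_of s)(j := i), start_of := (start_of s)(j := real (digit k i) / V i)\<rparr>"

lemma append_simps[simp]:
  "machine_of (append k j i s) = (machine_of s)(j := i)"
  "start_of (append k j i s) = (start_of s)(j := real (digit k i) / V i)"
  by (simp_all add: append_def)

text \<open>
  The last condition says that the loads bound the completion times, so that a job appended at the
  load of its machine does not overlap with any other.
\<close>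

definition packed :: "nat set \<Rightarrow> schedule \<Rightarrow> bool" where
  "packed X s \<longleftrightarrow> X \<subseteq> {..<N} \<and> s \<in> schedules P X \<and>
     (\<forall>j\<in>X. completion P s j \<le> real (load (machine_of s) X (machine_of s j)) / V (machine_of s j))"

lemma
  assumes X: "packed X s" and j: "j < N" "j \<notin> X" and i: "i < m"
  defines "k \<equiv> key (machine_of s) X"
  defines "s' \<equiv> append k j i s"
  shows packed_append: "packed (insert j X) s'"
    and total_append: "total_completion P (insert j X) s' = total_completion P X s + ending (p j) k i"
    and weighted_append: "weighted_tardy P (insert j X) s'
        = weighted_tardy P X s + weight P j * (if due P j < ending (p j) k i then 1 else 0)"
    and key_append: "key (machine_of s') (insert j X) = k + p j * total_proc P ^ i"
    and ending_append: "ending (p j) k i = (real (load (machine_of s) X i) + real (p j)) / V i"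
    and key_append_less: "k < states"
    and key_append_le: "k + p j * total_proc P ^ i \<le> states"
proof -
  have XN: "X \<subseteq> {..<N}" and s: "s \<in> schedules P X" using X by (auto simp: packed_def)
  note fin = finite_jobs[OF XN]
  have \<mu>X: "\<forall>l\<in>X. machine_of s l < m" using s by (auto simp: schedules_def)
  have dig: "digit k i = load (machine_of s) X i" unfolding k_def by (rule digit_key[OF XN j \<mu>X i])
  show "ending (p j) k i = (real (load (machine_of s) X i) + real (p j)) / V i"
    by (simp add: ending_def dig)
  show "k < states" unfolding k_def by (rule key_less[OF XN j \<mu>X])
  have ld: "load (machine_of s') X = load (machine_of s) X"
    by (rule load_cong) (use j in \<open>auto simp: s'_def\<close>)
  show key': "key (machine_of s') (insert j X) = k + p j * total_proc P ^ i"
    using key_insert[OF fin j(2), of "machine_of s'"] i ld by (simp add: s'_def k_def)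
  have "k + p j * total_proc P ^ (machine_of s') j \<le> states"
    unfolding k_def ld[symmetric]
    by (rule key_place[OF XN j]) (use \<mu>X i in \<open>auto simp: s'_def\<close>)
  then show "k + p j * total_proc P ^ i \<le> states" by (simp add: s'_def)
  have cX: "completion P s' l = completion P s l" if "l \<in> X" for l
    using that j by (auto simp: completion_def s'_def)
  have cj: "completion P s' j = ending (p j) k i"
    by (simp add: completion_def s'_def ending_def add_divide_distrib)
  have "(\<Sum>l\<in>X. completion P s' l) = (\<Sum>l\<in>X. completion P s l)" by (rule sum.cong) (auto simp: cX)
  then show "total_completion P (insert j X) s' = total_completion P X s + ending (p j) k i"
    using fin j by (simp add: total_completion_def cj)
  have "(\<Sum>l\<in>X. weight P l * tardy P s' l) = (\<Sum>l\<in>X. weight P l * tardy P s l)"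
    by (rule sum.cong) (auto simp: cX tardy_def)
  then show "weighted_tardy P (insert j X) s'
        = weighted_tardy P X s + weight P j * (if due P j < ending (p j) k i then 1 else 0)"
    using fin j by (simp add: weighted_tardy_def tardy_def cj)
  have lb: "completion P s l \<le> real (load (machine_of s) X (machine_of s l)) / V (machine_of s l)" if "l \<in> X" for l
    using X that by (auto simp: packed_def)
  have load': "load (machine_of s') (insert j X) = (load (machine_of s) X)(i := load (machine_of s) X i + p j)"
    using load_insert[OF fin j(2), of "machine_of s'"] ld by (simp add: s'_def)
  show "packed (insert j X) s'"
    unfolding packed_def
  proof (intro conjI ballI)
    show "insert j X \<subseteq> {..<N}" using XN j by auto
    show "s' \<in> schedules P (insert j X)"
    proof -
      have A: "machine_of s' l < m \<and> 0 \<le> start_of s' l" if "l \<in> insert j X" for l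
        using that s i by (auto simp: schedules_def s'_def)
      have B: "completion P s' l \<le> start_of s' l' \<or> completion P s' l' \<le> start_of s' l"
        if l: "l \<in> insert j X" "l' \<in> insert j X" "l \<noteq> l'" "machine_of s' l = machine_of s' l'" for l l'
      proof -
        have C: "completion P s' x \<le> start_of s' j" if "x \<in> X" "machine_of s' x = machine_of s' j" for x
        proof -
          have "x \<noteq> j" using that(1) j by auto
          then show ?thesis using lb[OF that(1)] that(2) cX[OF that(1)] by (simp add: s'_def dig)
        qed
        consider "l = j" "l' \<in> X" | "l' = j" "l \<in> X" | "l \<in> X" "l' \<in> X" using l by auto
        then show ?thesis
        proof cases
          case 3
          then have ne: "l \<noteq> j" "l' \<noteq> j" using j by auto
          then have eq: "machine_of s l = machine_of s l'" using l(4) by (simp add: s'_def)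
          have "completion P s l \<le> start_of s l' \<or> completion P s l' \<le> start_of s l"
            using s 3 l(3) eq unfolding schedules_def by blast
          then show ?thesis using cX[OF 3(1)] cX[OF 3(2)] ne by (simp add: s'_def)
        qed (use C l in auto)
      qed
      show ?thesis using A B unfolding schedules_def by blast
    qed
    fix l assume l: "l \<in> insert j X"
    show "completion P s' l \<le> real (load (machine_of s') (insert j X) (machine_of s' l)) / V (machine_of s' l)"
    proof (cases "l = j")
      case True
      then show ?thesis by (simp add: cj load' ending_def dig) (simp add: s'_def)
    next
      case False
      then have lX: "l \<in> X" using l by simp
      have "completion P s' l \<le> real (load (machine_of s) X (machine_of s l)) / V (machine_of s l)"
        using lb[OF lX] cX[OF lX] by simp
      also have "\<dots> \<le> real (load (machine_of s') (insert j X) (machine_of s l)) / V (machine_of s l)"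
        by (intro divide_right_mono) (auto simp: load')
      finally show ?thesis using False by (simp add: s'_def)
    qed
  qed
qed

lemma spt_schedule:
  assumes I: "I \<subseteq> {..<N}" and \<mu>: "\<forall>j\<in>I. \<mu> j < m"
  shows "\<exists>s. packed I s \<and> (\<forall>j\<in>I. machine_of s j = \<mu> j) \<and> total_completion P I s = spt_total P \<mu> I"
  using I \<mu>
proof (induction "card I" arbitrary: I)
  case 0
  then have "I = {}" using finite_jobs by auto
  then show ?case by (auto simp: packed_def schedules_def total_completion_def spt_total_def)
next
  case (Suc c)
  have fin: "finite I" using Suc.prems(1) by (rule finite_jobs)
  have "I \<noteq> {}" using Suc.hyps(2) by auto
  then have "Max (p ` I) \<in> p ` I" using fin by (intro Max_in) auto
  then obtain q where q: "q \<in> I" "p q = Max (p ` I)" by auto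
  define J where "J = I - {q}"
  have IJ: "I = insert q J" and qJ: "q \<notin> J" and J: "J \<subseteq> {..<N}" and finJ: "finite J"
    using q Suc.prems fin by (auto simp: J_def)
  have le: "\<forall>k\<in>J. p k \<le> p q" using q(2) fin by (auto simp: J_def)
  have qN: "q < N" and \<mu>q: "\<mu> q < m" using q Suc.prems by auto
  have "c = card J" using Suc.hyps(2) IJ qJ finJ by simp
  then obtain s where s: "packed J s" "\<forall>j\<in>J. machine_of s j = \<mu> j" "total_completion P J s = spt_total P \<mu> J"
    using Suc.hyps(1)[of J] J Suc.prems(2) IJ by auto
  have ld: "load (machine_of s) J = load \<mu> J" using s(2) by (intro load_cong) auto
  let ?s = "append (key (machine_of s) J) q (\<mu> q) s"
  have "total_completion P I ?s = spt_total P \<mu> I"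
    using total_append[OF s(1) qN qJ \<mu>q] ending_append[OF s(1) qN qJ \<mu>q] spt_total_insert_last[OF finJ qJ le, of \<mu>]
    by (simp only: IJ ld s(3))
  moreover have "packed I ?s" unfolding IJ by (rule packed_append[OF s(1) qN qJ \<mu>q])
  moreover have "\<forall>j\<in>I. machine_of ?s j = \<mu> j" using s(2) by (auto simp: IJ)
  ultimately show ?case by blast
qed

text \<open>
  In an optimal schedule of the follower the jobs of equal length that precede one on-time job may
  be rearranged: whichever of them comes last in the schedule finishes after the rearranged
  block and is due no later than that job.
\<close>

lemma early_block:
  assumes s: "s \<in> schedules P I" and I: "I \<subseteq> {..<N}" and opt: "total_completion P I s = follower_opt P I"
    and T: "T = {j\<in>I. due P j < completion P s j}" and j: "j \<in> I - T"
  shows "real (\<Sum>k\<in>{k\<in>I. machine_of s k = machine_of s j \<and>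
      (p k < p j \<or> p k = p j \<and> k \<notin> T \<and> (k = j \<or> precedes j k))}. p k) / V (machine_of s j) \<le> due P j"
proof -
  let ?\<mu> = "machine_of s"
  define A where "A = {k\<in>I. ?\<mu> k = ?\<mu> j \<and> (p k < p j \<or> p k = p j \<and> k \<notin> T \<and> (k = j \<or> precedes j k))}"
  define E where "E = {k\<in>A. p k = p j}"
  have AI: "A \<subseteq> I" by (auto simp: A_def)
  have finE: "finite E" using finite_subset[OF AI finite_jobs[OF I]] by (simp add: E_def)
  have "j \<in> E" using j by (auto simp: E_def A_def)
  then have "Max (start_of s ` E) \<in> start_of s ` E" using finE by (intro Max_in) auto
  then obtain l where l: "l \<in> E" "start_of s l = Max (start_of s ` E)" by auto
  have lmax: "start_of s k \<le> start_of s l" if "k \<in> E" for k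
    unfolding l(2) using finE that by simp
  have lI: "l \<in> I" and lT: "l \<notin> T" and lp: "p l = p j" and l\<mu>: "?\<mu> l = ?\<mu> j" and lj: "l = j \<or> precedes j l"
    using l(1) by (auto simp: E_def A_def)
  have lN: "l < N" using lI I by auto
  have "completion P s k \<le> completion P s l" if k: "k \<in> A" for k
  proof (cases "k = l")
    case False
    have kI: "k \<in> I" using k AI by auto
    have "?\<mu> k = ?\<mu> l" using k l\<mu> by (simp add: A_def)
    then have "before s l k \<or> before s k l" using before_total[OF s lI kI] False by blast
    moreover have "\<not> before s l k"
    proof (cases "p k < p j")
      case True
      then show ?thesis using follower_optimal_spt(2)[OF s I opt kI lI] lp by auto
    next
      case False
      then have "k \<in> E" using k by (auto simp: E_def A_def)
      then show ?thesis using lmax[of k] completion_gt[OF lN, of s] by (auto simp: before_def)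
    qed
    ultimately show ?thesis using completion_gt[OF lN, of s] by (auto simp: before_def)
  qed simp
  moreover have "0 \<le> completion P s l"
    using completion_gt[OF lN, of s] s lI by (force simp: schedules_def)
  ultimately have "(\<Sum>k\<in>A. real (p k)) / V (?\<mu> j) \<le> completion P s l"
    by (intro machine_capacity[OF s I AI]) (auto simp: A_def)
  also have "\<dots> \<le> due P l" using lT lI T by auto
  also have "\<dots> \<le> due P j" using lj lp by (auto simp: precedes_def)
  finally show ?thesis by (simp add: A_def)
qed

abbreviation entry_at :: "nat \<Rightarrow> nat set \<Rightarrow> nat set \<Rightarrow> schedule \<Rightarrow> entry" where
  "entry_at r X B s \<equiv> dp r (n - card X) (card B) (key (machine_of s) X)"

text \<open>
  The invariant of following the stored decisions: the jobs of \<open>X\<close> have been appended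
  and those of \<open>B\<close> are pending. The excess so far and the excess stored for the rest
  add up to \<open>e\<close>, exactly; for the weights only an inequality holds, since a job
  declared late pays even if it turns out to be on time.
\<close>

definition tracing :: "nat \<Rightarrow> nat set \<Rightarrow> nat set \<Rightarrow> schedule \<Rightarrow> real \<Rightarrow> real \<Rightarrow> bool" where
  "tracing r X B s e g \<longleftrightarrow> r \<le> N \<and> X \<union> B \<subseteq> later r \<and> X \<inter> B = {} \<and> (\<forall>j\<in>B. p j = p (ord r)) \<and>
     card X + card B \<le> n \<and> n \<le> card X + card B + r \<and> packed X s \<and>
     total_completion P X s - partial_opt X + fst (entry_at r X B s) = e \<and>
     weighted_tardy P X s + (\<Sum>j\<in>B. weight P j) + fst (snd (entry_at r X B s)) \<le> g"

lemma tracing_start: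
  "tracing N {} {} s (fst (dp N n 0 0)) (fst (snd (dp N n 0 0)))"
proof -
  have "key (machine_of s) {} = 0" by (simp add: load_index_def load_def)
  moreover have "packed {} s" by (auto simp: packed_def schedules_def)
  moreover have "n \<le> N" using valid by (simp add: valid_instance_def)
  ultimately show ?thesis
    by (simp add: tracing_def total_completion_def weighted_tardy_def partial_opt_empty)
qed

text \<open>
  Pending jobs are interchangeable: the decision names a machine only, and any of them may be
  appended there.
\<close>

lemma dp_flush_step:
  assumes tr: "tracing r X B s e g" and B: "B \<noteq> {}" "\<not> same_group r"
  shows "\<exists>i<m. snd (snd (entry_at r X B s)) = i + 3 \<and>
    (\<forall>j\<in>B. tracing r (insert j X) (B - {j}) (append (key (machine_of s) X) j i s) e g)"
proof -
  let ?k = "key (machine_of s) X"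
  have rN: "r \<le> N" and XB: "X \<union> B \<subseteq> later r" "X \<inter> B = {}" and Bp: "\<forall>j\<in>B. p j = p (ord r)"
    and c: "card X + card B \<le> n" "n \<le> card X + card B + r" and X: "packed X s"
    and e: "total_completion P X s - partial_opt X + fst (entry_at r X B s) = e"
    and g: "weighted_tardy P X s + (\<Sum>j\<in>B. weight P j) + fst (snd (entry_at r X B s)) \<le> g"
    using tr by (auto simp: tracing_def)
  have lt: "r < N" using XB B rN by (cases "r = N") auto
  have finB: "finite B" and finX: "finite X" using XB finite_later[of r] finite_subset by blast+
  have cB: "0 < card B" using finB B by (simp add: card_gt_0_iff)
  have XN: "X \<subseteq> {..<N}" using X by (simp add: packed_def)
  have m0: "0 < m" using machines c cB by auto
  let ?q = "p (ord r)" and ?d = "dp r (n - card X - 1) (card B - 1)"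
  obtain j0 where j0: "j0 \<in> B" using B by auto
  have jN: "j < N" "j \<notin> X" if "j \<in> B" for j using that XB later_subset[of r] by auto
  note kl = key_append_less[OF X jN[OF j0] m0]
  have ent: "entry_at r X B s = try_machines ?d ?q (n - card X) (\<lambda>_. True) ?k (0, 0, 0) m"
    using dp_flush[of "card B" r "n - card X"] cB B kl by (simp add: flush_entry_def)
  have "?k + ?q * total_proc P ^ 0 \<le> states"
    using key_append_le[OF X jN[OF j0] m0] Bp j0 by simp
  then have "at_most (entry_at r X B s) (fst (?d (?k + ?q * total_proc P ^ 0)) + ending ?q ?k 0 - real ?q * coef P (n - card X - 1))
      (fst (snd (?d (?k + ?q * total_proc P ^ 0))))"
    unfolding ent by (rule try_machines_at_most[OF m0]) simp
  then have "entry_at r X B s \<noteq> (0, 0, 0)" by (auto simp: at_most_def)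
  then obtain i where i: "i < m" "entry_at r X B s = (fst (?d (?k + ?q * total_proc P ^ i)) + ending ?q ?k i - real ?q * coef P (n - card X - 1),
      fst (snd (?d (?k + ?q * total_proc P ^ i))), i + 3)"
    using try_machines_cases[of ?d ?q "n - card X" "\<lambda>_. True" ?k "(0, 0, 0)" m] unfolding ent by metis
  show ?thesis
  proof (intro exI conjI ballI)
    show "i < m" by fact
    show "snd (snd (entry_at r X B s)) = i + 3" using i by simp
    fix j assume j: "j \<in> B"
    note jN = jN[OF j]
    have q: "p j = ?q" using Bp j by simp
    let ?s = "append ?k j i s"
    have cX: "card (insert j X) = card X + 1" using finX jN by simp
    have cB': "card (B - {j}) = card B - 1" using j finB by simp
    have le: "\<forall>l\<in>X. p l \<le> p j" unfolding q using XB later_le[of _ r] lt by auto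
    have entry': "entry_at r (insert j X) (B - {j}) ?s = ?d (?k + ?q * total_proc P ^ i)"
      unfolding key_append[OF X jN i(1)] cX cB' q by simp
    have opt: "partial_opt (insert j X) = partial_opt X + real (p j) * coef P (n - card X - 1)"
      by (rule partial_opt_insert[OF XN _ jN le]) (use c cB in linarith)
    have wB: "(\<Sum>j\<in>B. weight P j) = weight P j + (\<Sum>j\<in>B - {j}. weight P j)"
      using finB j by (simp add: sum.remove)
    have wj: "weight P j * (if due P j < ending (p j) ?k i then 1 else 0) \<le> weight P j"
      using weight_nonneg[OF jN(1)] by simp
    show "tracing r (insert j X) (B - {j}) ?s e g"
      unfolding tracing_def
    proof (intro conjI)
      show "packed (insert j X) ?s" by (rule packed_append[OF X jN i(1)])
      show "total_completion P (insert j X) ?s - partial_opt (insert j X)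
          + fst (entry_at r (insert j X) (B - {j}) ?s) = e"
        unfolding entry' total_append[OF X jN i(1)] opt using e i(2) q by simp
      show "weighted_tardy P (insert j X) ?s + (\<Sum>j\<in>B - {j}. weight P j)
          + fst (snd (entry_at r (insert j X) (B - {j}) ?s)) \<le> g"
        unfolding entry' weighted_append[OF X jN i(1)] using g wB wj i(2) by simp
    qed (use rN XB Bp c j cX cB' cB in auto)
  qed
qed

lemma dp_job_step:
  assumes tr: "tracing (Suc r) X B s e g" and B: "B = {} \<or> same_group (Suc r)"
  shows "snd (snd (entry_at (Suc r) X B s)) = 1 \<and> tracing r X B s e g
    \<or> snd (snd (entry_at (Suc r) X B s)) = 2 \<and> tracing r X (insert (ord r) B) s e g
    \<or> (\<exists>i<m. snd (snd (entry_at (Suc r) X B s)) = i + 3 \<and>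
        tracing r (insert (ord r) X) B (append (key (machine_of s) X) (ord r) i s) e g)"
proof -
  let ?k = "key (machine_of s) X" and ?j = "ord r"
  have rN: "r < N" and XB: "X \<union> B \<subseteq> later (Suc r)" "X \<inter> B = {}" and Bp: "\<forall>j\<in>B. p j = p (ord (Suc r))"
    and c: "card X + card B \<le> n" "n \<le> card X + card B + Suc r" and X: "packed X s"
    and e: "total_completion P X s - partial_opt X + fst (entry_at (Suc r) X B s) = e"
    and g: "weighted_tardy P X s + (\<Sum>j\<in>B. weight P j) + fst (snd (entry_at (Suc r) X B s)) \<le> g"
    using tr by (auto simp: tracing_def)
  have finB: "finite B" and finX: "finite X" using XB finite_later[of "Suc r"] finite_subset by blast+
  have XN: "X \<subseteq> {..<N}" using X by (simp add: packed_def)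
  have jN: "?j < N" using ord_less[OF rN] .
  have jl: "?j \<notin> later (Suc r)" using ord_notin_later[OF rN] .
  have jX: "?j \<notin> X" and jB: "?j \<notin> B" using jl XB by auto
  have lat: "later r = insert ?j (later (Suc r))" by (rule later_Suc[OF rN])
  have Bp': "\<forall>l\<in>B. p l = p ?j" using B Bp by (auto simp: same_group_def)
  have kl: "?k < states"
    by (rule key_less[OF XN jN jX]) (use X in \<open>auto simp: packed_def schedules_def\<close>)
  have ent: "entry_at (Suc r) X B s = job_entry (dp r (n - card X) (card B))
      (dp r (n - card X) (card B + 1)) (dp r (n - card X - 1) (card B)) r (n - card X) (card B) ?k"
    by (subst dp_job) (use B finB in auto)
  have "snd (snd (entry_at (Suc r) X B s)) \<noteq> 0"
  proof (cases "n - card X \<le> card B + r")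
    case True
    then show ?thesis unfolding ent using job_entry_skip[OF kl True] by (simp add: at_most_def)
  next
    case False
    then have "card B < n - card X" by simp
    then show ?thesis unfolding ent using job_entry_tardy[OF kl] by (simp add: at_most_def)
  qed
  from this[unfolded ent] show ?thesis
  proof (cases rule: job_entry_cases)
    case skip
    then have "tracing r X B s e g"
      using rN XB Bp' c X e g lat unfolding tracing_def ent by auto
    then show ?thesis using skip ent by simp
  next
    case tardy
    have cB: "card (insert ?j B) = card B + 1" using finB jB by simp
    have wB: "(\<Sum>j\<in>insert ?j B. weight P j) = weight P ?j + (\<Sum>j\<in>B. weight P j)"
      using finB jB by simp
    have "tracing r X (insert ?j B) s e g"
      using rN XB Bp' c X e g lat jX tardy unfolding tracing_def ent cB wB by auto
    then show ?thesis using tardy ent by simp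
  next
    case (early i)
    let ?s = "append ?k ?j i s"
    have cX: "card (insert ?j X) = card X + 1" using finX jX by simp
    have entry': "entry_at r (insert ?j X) B ?s
        = dp r (n - card X - 1) (card B) (?k + p ?j * total_proc P ^ i)"
      unfolding key_append[OF X jN jX early(2)] cX by simp
    have le: "\<forall>l\<in>X. p l \<le> p ?j" using XB lat later_le[OF _ rN] by auto
    have opt: "partial_opt (insert ?j X) = partial_opt X + real (p ?j) * coef P (n - card X - 1)"
      by (rule partial_opt_insert[OF XN _ jN jX le]) (use early in linarith)
    have "tracing r (insert ?j X) B ?s e g"
      unfolding tracing_def
    proof (intro conjI)
      show "packed (insert ?j X) ?s" by (rule packed_append[OF X jN jX early(2)])
      show "total_completion P (insert ?j X) ?s - partial_opt (insert ?j X)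
          + fst (entry_at r (insert ?j X) B ?s) = e"
        unfolding entry' total_append[OF X jN jX early(2)] opt using e early(4) unfolding ent by simp
      show "weighted_tardy P (insert ?j X) ?s + (\<Sum>j\<in>B. weight P j)
          + fst (snd (entry_at r (insert ?j X) B ?s)) \<le> g"
        unfolding entry' weighted_append[OF X jN jX early(2)] using g early(3,4) unfolding ent by simp
    qed (use rN XB Bp' c jX jB cX lat early in auto)
    then show ?thesis using early ent by auto
  qed
qed

text \<open>
  A plan of excess zero exists, hence \<open>e \<le> 0\<close>, and \<open>e\<close> is the excess
  of the traced schedule, hence non-negative. The weight of any follower-optimal schedule of any
  selection is the cost of a plan and thus at least \<open>g\<close>; the traced schedule costs at
  most \<open>g\<close>, so that it is optimal on both levels.
\<close>

lemma tracing_optimal: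
  assumes tr: "tracing 0 X {} s (fst (dp N n 0 0)) (fst (snd (dp N n 0 0)))"
  shows "bilevel_optimal P X s" and "weighted_tardy P X s = fst (snd (dp N n 0 0))"
proof -
  define e g where "e = fst (dp N n 0 0)" and "g = fst (snd (dp N n 0 0))"
  have X: "packed X s" "card X = n" using tr by (auto simp: tracing_def)
  have XN: "X \<subseteq> {..<N}" and sX: "s \<in> schedules P X" using X by (auto simp: packed_def)
  have e: "e = total_completion P X s - follower_opt P X"
    using tr partial_opt_full[OF XN X(2)] by (simp add: tracing_def dp_done e_def)
  have wg: "weighted_tardy P X s \<le> g" using tr by (simp add: tracing_def dp_done g_def)
  have key0: "key \<mu> {} = 0" for \<mu> by (simp add: load_index_def load_def)
  have bound: "lex_le e g (spt_total P \<mu> I - follower_opt P I) (\<Sum>j\<in>T. weight P j)"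
    if "I \<subseteq> {..<N}" "card I = n" "\<forall>j\<in>I. \<mu> j < m" "T \<subseteq> I"
      "\<forall>j\<in>I - T. real (\<Sum>k\<in>{k\<in>I. \<mu> k = \<mu> j \<and>
        (p k < p j \<or> p k = p j \<and> k \<notin> T \<and> (k = j \<or> precedes j k))}. p k) / V (\<mu> j) \<le> due P j" for I \<mu> T
    using dp_le[of I \<mu> T N "{}" "{}"] that partial_opt_full[OF that(1,2)]
    by (simp add: key0 e_def g_def partial_opt_empty spt_total_def)
  have attained: "\<exists>\<mu>. (\<forall>j\<in>I. \<mu> j < m) \<and> spt_total P \<mu> I = follower_opt P I"
    if "I \<subseteq> {..<N}" "card I = n" for I
  proof (cases "0 < m")
    case True
    then show ?thesis using follower_opt_attained that by simp
  next
    case False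
    then have "I = {}" using machines that finite_jobs[OF that(1)] by simp
    then show ?thesis by (simp add: spt_total_def follower_opt_def coef_sum_def)
  qed
  obtain \<mu> where "\<forall>j\<in>X. \<mu> j < m" "spt_total P \<mu> X = follower_opt P X" using attained[OF XN X(2)] by auto
  then have "lex_le e g 0 (\<Sum>j\<in>X. weight P j)" using bound[of X \<mu> X] XN X(2) by simp
  then have e0: "e = 0" using e follower_opt_le[OF sX XN] by (auto simp: lex_le_def)
  have g_le: "g \<le> weighted_tardy P I s'"
    if I: "I \<subseteq> {..<N}" "card I = n" and s': "s' \<in> schedules P I" and opt: "total_completion P I s' = follower_opt P I"
    for I s'
  proof -
    define T where "T = {j\<in>I. due P j < completion P s' j}"
    have "lex_le e g (spt_total P (machine_of s') I - follower_opt P I) (\<Sum>j\<in>T. weight P j)"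
      by (rule bound[OF I]) (use s' early_block[OF s' I(1) opt T_def] in \<open>auto simp: T_def schedules_def\<close>)
    then have "g \<le> (\<Sum>j\<in>T. weight P j)"
      unfolding follower_optimal_spt(1)[OF s' I(1) opt] by (simp add: e0 lex_le_def)
    also have "\<dots> = weighted_tardy P I s'"
      unfolding weighted_tardy_def T_def tardy_def
      by (subst sum.inter_filter[OF finite_jobs[OF I(1)]]) (rule sum.cong, auto)
    finally show ?thesis .
  qed
  have argmin: "is_arg_min (total_completion P I) (\<lambda>s. s \<in> schedules P I) s'
      \<longleftrightarrow> s' \<in> schedules P I \<and> total_completion P I s' = follower_opt P I"
    if I: "I \<subseteq> {..<N}" "card I = n" for I s'
  proof -
    obtain \<mu> where \<mu>: "\<forall>j\<in>I. \<mu> j < m" "spt_total P \<mu> I = follower_opt P I" using attained[OF I] by auto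
    obtain s0 where s0: "s0 \<in> schedules P I" "total_completion P I s0 = follower_opt P I"
      using spt_schedule[OF I(1) \<mu>(1)] \<mu>(2) by (auto simp: packed_def)
    have "\<not> total_completion P I y < follower_opt P I" if "y \<in> schedules P I" for y
      using follower_opt_le[OF that I(1)] by linarith
    moreover have "total_completion P I s' \<le> follower_opt P I"
      if "is_arg_min (total_completion P I) (\<lambda>s. s \<in> schedules P I) s'"
      using that s0 unfolding is_arg_min_def by (metis not_less)
    moreover have "follower_opt P I \<le> total_completion P I s'" if "s' \<in> schedules P I"
      using follower_opt_le[OF that I(1)] .
    ultimately show ?thesis unfolding is_arg_min_def by (metis antisym)
  qed
  have total: "total_completion P X s = follower_opt P X" using e e0 by simp
  have eq: "weighted_tardy P X s = g" using wg g_le[OF XN X(2) sX total] by simp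
  then show "weighted_tardy P X s = fst (snd (dp N n 0 0))" by (simp add: g_def)
  have "s \<in> lex_argmin (total_completion P X) (weighted_tardy P X) (schedules P X)"
    unfolding lex_argmin_def mem_Collect_eq is_arg_min_def[of "weighted_tardy P X"] argmin[OF XN X(2)]
    using sX total eq g_le[OF XN X(2)] by (auto simp: not_less)
  then have feas: "bilevel_feasible P (X, s)" using XN X(2) by (simp add: bilevel_feasible_def)
  have "g \<le> weighted_tardy P I s'" if "bilevel_feasible P (I, s')" for I s'
  proof -
    have I: "I \<subseteq> {..<N}" "card I = n"
      and s': "is_arg_min (weighted_tardy P I) (is_arg_min (total_completion P I) (\<lambda>s. s \<in> schedules P I)) s'"
      using that by (auto simp: bilevel_feasible_def lex_argmin_def)
    then have "is_arg_min (total_completion P I) (\<lambda>s. s \<in> schedules P I) s'" by (simp add: is_arg_min_def)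
    then show ?thesis using argmin[OF I] g_le[OF I] by blast
  qed
  then show "bilevel_optimal P X s"
    using feas eq unfolding bilevel_optimal_def is_arg_min_def by (auto simp: not_less)
qed

end

section \<open>Total correctness with running times\<close>

definition run :: "nat \<Rightarrow> com \<Rightarrow> nat \<Rightarrow> (state \<Rightarrow> bool) \<Rightarrow> state \<Rightarrow> bool" where
  "run M c T Q s \<longleftrightarrow> (\<exists>t s'. exec M c s t s' \<and> t \<le> T \<and> Q s')"

abbreviation set_reg :: "state \<Rightarrow> nat \<Rightarrow> real \<Rightarrow> state" where
  "set_reg s x v \<equiv> s\<lparr>regs := (regs s)(x := v)\<rparr>"

abbreviation set_heap :: "state \<Rightarrow> nat \<Rightarrow> real \<Rightarrow> state" where
  "set_heap s a v \<equiv> s\<lparr>heap := (heap s)(a := v)\<rparr>"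

lemma run_mono: "run M c T Q s \<Longrightarrow> T \<le> T' \<Longrightarrow> (\<And>s'. Q s' \<Longrightarrow> Q' s') \<Longrightarrow> run M c T' Q' s"
  unfolding run_def by (meson le_trans)

lemma run_Seq: "run M c T (\<lambda>s'. run M d T' Q s') s \<Longrightarrow> run M (Seq c d) (T + T') Q s"
  unfolding run_def by (meson add_mono exec.Seq)

lemma run_then:
  "run M c T Q' s \<Longrightarrow> (\<And>s'. Q' s' \<Longrightarrow> run M d T' Q s') \<Longrightarrow> run M (Seq c d) (T + T') Q s"
  by (rule run_Seq) (rule run_mono[OF _ order_refl])

fun block :: "com list \<Rightarrow> com" where
  "block [] = Skip"
| "block [c] = c"
| "block (c # cs) = Seq c (block cs)"

text \<open>
  For programs without loops the time is bounded by charging both branches of every conditional,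
  and the effect is a weakest precondition that can be unfolded by rewriting.
\<close>

primrec line_cost :: "com \<Rightarrow> nat" where
  "line_cost Skip = 1"
| "line_cost (Assign x e) = expr_cost e + 1"
| "line_cost (Store e f) = expr_cost e + expr_cost f + 1"
| "line_cost (Seq c d) = line_cost c + line_cost d"
| "line_cost (If b c d) = cond_cost b + line_cost c + line_cost d"
| "line_cost (While b c) = 0"

primrec line :: "nat \<Rightarrow> com \<Rightarrow> (state \<Rightarrow> bool) \<Rightarrow> state \<Rightarrow> bool" where
  "line M Skip Q s \<longleftrightarrow> Q s"
| "line M (Assign x e) Q s \<longleftrightarrow> expr_ok M e s \<and> Q (set_reg s x (expr_val e s))"
| "line M (Store e f) Q s \<longleftrightarrow> expr_ok M e s \<and> is_address M (expr_val e s) \<and> expr_ok M f s \<and>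
     Q (set_heap s (address (expr_val e s)) (expr_val f s))"
| "line M (Seq c d) Q s \<longleftrightarrow> line M c (line M d Q) s"
| "line M (If b c d) Q s \<longleftrightarrow> cond_ok M b s \<and> (if cond_val b s then line M c Q s else line M d Q s)"
| "line M (While b c) Q s \<longleftrightarrow> False"

lemma line_mono: "line M c Q s \<Longrightarrow> (\<And>s'. Q s' \<Longrightarrow> Q' s') \<Longrightarrow> line M c Q' s"
proof (induction c arbitrary: Q Q' s)
  case (Seq c d)
  have "line M c (line M d Q) s" using Seq.prems(1) by simp
  then have "line M c (line M d Q') s"
    by (rule Seq.IH(1)) (rule Seq.IH(2)[OF _ Seq.prems(2)])
  then show ?case by simp
next
  case (If b c d)
  show ?case
  proof (cases "cond_val b s")
    case True
    have "line M c Q' s" by (rule If.IH(1)[of Q s Q']) (use If.prems True in auto)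
    then show ?thesis using If.prems(1) True by simp
  next
    case False
    have "line M d Q' s" by (rule If.IH(2)[of Q s Q']) (use If.prems False in auto)
    then show ?thesis using If.prems(1) False by simp
  qed
qed auto

lemma run_line: "line M c Q s \<Longrightarrow> run M c (line_cost c) Q s"
proof (induction c arbitrary: s Q)
  case Skip
  then show ?case unfolding run_def using exec.Skip[of M s] by (intro exI[of _ "1::nat"] exI[of _ s]) simp
next
  case (Assign x e)
  then show ?case unfolding run_def using exec.Assign[of M e s x]
    by (intro exI[of _ "expr_cost e + 1"] exI) auto
next
  case (Store e f)
  then show ?case unfolding run_def using exec.Store[of M e s f]
    by (intro exI[of _ "expr_cost e + expr_cost f + 1"] exI) auto
next
  case (Seq c d)
  then have "run M c (line_cost c) (\<lambda>s'. run M d (line_cost d) Q s') s"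
    by (intro run_mono[OF Seq.IH(1)[of "line M d Q"]] Seq.IH(2)) auto
  then show ?case by (simp add: run_Seq)
next
  case (If b c d)
  show ?case
  proof (cases "cond_val b s")
    case True
    then obtain t s' where "exec M c s t s'" "t \<le> line_cost c" "Q s'"
      using If.IH(1)[of Q s] If.prems unfolding run_def by auto
    then show ?thesis using True If.prems unfolding run_def
      by (intro exI[of _ "cond_cost b + t"] exI[of _ s']) (auto intro: exec.IfTrue)
  next
    case False
    then obtain t s' where "exec M d s t s'" "t \<le> line_cost d" "Q s'"
      using If.IH(2)[of Q s] If.prems unfolding run_def by auto
    then show ?thesis using False If.prems unfolding run_def
      by (intro exI[of _ "cond_cost b + t"] exI[of _ s']) (auto intro: exec.IfFalse)
  qed
next
  case (While b c)
  then show ?case by simp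
qed

lemma run_line_le: "line M c Q s \<Longrightarrow> line_cost c \<le> T \<Longrightarrow> run M c T Q s"
  using run_mono[OF run_line] by blast

lemma run_If:
  assumes "cond_ok M b s" "cond_val b s \<Longrightarrow> run M c T Q s" "\<not> cond_val b s \<Longrightarrow> run M d T Q s"
  shows "run M (If b c d) (cond_cost b + T) Q s"
  using assms unfolding run_def
  by (cases "cond_val b s") (meson add_le_mono le_refl exec.IfTrue exec.IfFalse)+

lemma run_While:
  assumes step: "\<And>k s. I k s \<Longrightarrow> cond_ok M b s \<and> (cond_val b s \<longrightarrow> run M c T (\<lambda>s'. \<exists>k'<k. I k' s') s)"
  shows "I k s \<Longrightarrow> run M (While b c) (k * (T + cond_cost b) + cond_cost b) (\<lambda>s'. (\<exists>k'. I k' s') \<and> \<not> cond_val b s') s"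
proof (induction k arbitrary: s rule: less_induct)
  case (less k)
  show ?case
  proof (cases "cond_val b s")
    case False
    then show ?thesis
      unfolding run_def using step[OF less.prems] less.prems
      by (intro exI[of _ "cond_cost b"] exI[of _ s]) (auto intro: exec.WhileFalse)
  next
    case True
    then obtain t s' k' where 1: "exec M c s t s'" "t \<le> T" "k' < k" "I k' s'"
      using step[OF less.prems] unfolding run_def by auto
    obtain t' s'' where 2: "exec M (While b c) s' t' s''" "t' \<le> k' * (T + cond_cost b) + cond_cost b"
      "(\<exists>k'. I k' s'') \<and> \<not> cond_val b s''"
      using less.IH[OF 1(3,4)] unfolding run_def by auto
    have "(k' + 1) * (T + cond_cost b) \<le> k * (T + cond_cost b)" using 1(3) by (intro mult_right_mono) auto
    then have "cond_cost b + t + t' \<le> k * (T + cond_cost b) + cond_cost b" using 1(2) 2(2) by simp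
    then show ?thesis
      unfolding run_def using step[OF less.prems] True exec.WhileTrue[OF _ True 1(1) 2(1)] 2(3) by blast
  qed
qed

definition For :: "nat \<Rightarrow> expr \<Rightarrow> com \<Rightarrow> com" where
  "For x e c = Seq (Assign x (Lit 0)) (While (Less (Reg x) e) (Seq c (Assign x (Add (Reg x) (Lit 1)))))"

lemma run_For:
  assumes init: "I 0 (set_reg s x 0)"
    and bound: "\<And>k s. k \<le> n \<Longrightarrow> I k s \<Longrightarrow> regs s x = real k \<Longrightarrow> expr_ok M e s \<and> expr_val e s = real n"
    and body: "\<And>k s. k < n \<Longrightarrow> I k s \<Longrightarrow> regs s x = real k \<Longrightarrow>
      run M c T (\<lambda>s'. regs s' x = real k \<and> I (Suc k) (set_reg s' x (real (Suc k)))) s"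
    and post: "\<And>s. I n s \<Longrightarrow> Q s"
    and time: "n * (T + expr_cost e + 6) + expr_cost e + 4 \<le> T'"
  shows "run M (For x e c) T' Q s"
proof -
  let ?b = "Less (Reg x) e" and ?d = "Seq c (Assign x (Add (Reg x) (Lit 1)))"
  let ?J = "\<lambda>l s. \<exists>k\<le>n. l = n - k \<and> I k s \<and> regs s x = real k"
  have "run M (While ?b ?d) (n * (T + 4 + cond_cost ?b) + cond_cost ?b)
      (\<lambda>s'. (\<exists>l. ?J l s') \<and> \<not> cond_val ?b s') (set_reg s x 0)"
  proof (rule run_While)
    show "?J n (set_reg s x 0)" using init by (intro exI[of _ 0]) auto
    fix l s assume "?J l s"
    then obtain k where k: "k \<le> n" "l = n - k" "I k s" "regs s x = real k" by blast
    have e: "expr_ok M e s" "expr_val e s = real n" using bound k by auto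
    have "run M ?d (T + 4) (\<lambda>s'. \<exists>l'<l. ?J l' s') s" if "cond_val ?b s"
    proof (rule run_Seq)
      have kn: "k < n" using that e k by simp
      show "run M c T (\<lambda>s'. run M (Assign x (Add (Reg x) (Lit 1))) 4 (\<lambda>s'. \<exists>l'<l. ?J l' s') s') s"
      proof (rule run_mono[OF body[OF kn k(3,4)] order_refl])
        fix s' assume s': "regs s' x = real k \<and> I (Suc k) (set_reg s' x (real (Suc k)))"
        have "\<exists>l'<l. ?J l' (set_reg s' x (real k + 1))"
          using s' kn k(2) by (intro exI[of _ "n - Suc k"] conjI exI[of _ "Suc k"]) (auto simp: add.commute)
        then show "run M (Assign x (Add (Reg x) (Lit 1))) 4 (\<lambda>s'. \<exists>l'<l. ?J l' s') s'"
          using s' by (intro run_line_le) auto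
      qed
    qed
    then show "cond_ok M ?b s \<and> (cond_val ?b s \<longrightarrow> run M ?d (T + 4) (\<lambda>s'. \<exists>l'<l. ?J l' s') s)"
      using e by simp
  qed
  then have "run M (While ?b ?d) (n * (T + 4 + cond_cost ?b) + cond_cost ?b) Q (set_reg s x 0)"
  proof (rule run_mono)
    fix s' assume s': "(\<exists>l. ?J l s') \<and> \<not> cond_val ?b s'"
    then obtain k where k: "k \<le> n" "I k s'" "regs s' x = real k" by blast
    then have "k = n" using s' bound[of k s'] by auto
    then show "Q s'" using post k by simp
  qed simp
  then have "run M (For x e c) (2 + (n * (T + 4 + cond_cost ?b) + cond_cost ?b)) Q s"
    unfolding For_def by (intro run_Seq run_line_le) auto
  then show ?thesis by (rule run_mono) (use time in \<open>auto simp: algebra_simps\<close>)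
qed

text \<open>
  As conditional rewrite rules these lemmas evaluate addresses that are given by real expressions.
\<close>

lemma address_of_nat[simp]: "address (real a) = a" by (simp add: address_def)

lemma is_address_iff: "is_address M r \<longleftrightarrow> r \<in> \<nat> \<and> address r < M"
  unfolding is_address_def Nats_def by auto

lemma address_numeral[simp]: "address (numeral k) = numeral k"
  by (simp add: address_def)

lemma address_0_1[simp]: "address 0 = 0" "address 1 = 1" by (simp_all add: address_def)

lemma address_add[simp]: "x \<in> \<nat> \<Longrightarrow> y \<in> \<nat> \<Longrightarrow> address (x + y) = address x + address y"
  by (auto elim!: Nats_cases simp flip: of_nat_add)

lemma address_mult[simp]: "x \<in> \<nat> \<Longrightarrow> y \<in> \<nat> \<Longrightarrow> address (x * y) = address x * address y"
  by (auto elim!: Nats_cases simp flip: of_nat_mult)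

lemma Nats_power[simp]: "x \<in> \<nat> \<Longrightarrow> (x :: real) ^ i \<in> \<nat>" by (induction i) auto

lemma address_power[simp]: "x \<in> \<nat> \<Longrightarrow> address (x ^ i) = address x ^ i" by (induction i) auto

section \<open>The program\<close>

text \<open>
  Registers 0 to 6 hold the input parameters and the number of machines, 7 and 8 the sum
  \<open>T\<close> of the processing times and \<open>T ^ m\<close>, and 9 to 19 the base
  addresses of the arrays: the order of the jobs, and by this order their lengths, weights and due
  dates; by machines the speeds, the powers of \<open>T\<close> and the counts of the greedy rule;
  the coefficients; the stack of pending jobs; the digits of all indices; and the table. Registers
  from 20 on are temporary: in the last two phases 20 to 23 hold the state \<open>r\<close>,
  \<open>u\<close>, \<open>b\<close>, \<open>k\<close>, and 25 to 27 the best entry found so far.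
\<close>

abbreviation "xM0 \<equiv> Reg 0" abbreviation "xM1 \<equiv> Reg 1"
abbreviation "xV0 \<equiv> Reg 2" abbreviation "xV1 \<equiv> Reg 3"
abbreviation "xN \<equiv> Reg 4" abbreviation "xn \<equiv> Reg 5" abbreviation "xm \<equiv> Reg 6"
abbreviation "xT \<equiv> Reg 7" abbreviation "xS \<equiv> Reg 8"
abbreviation "xORD \<equiv> Reg 9" abbreviation "xSP \<equiv> Reg 10" abbreviation "xSW \<equiv> Reg 11"
abbreviation "xSD \<equiv> Reg 12" abbreviation "xSPD \<equiv> Reg 13" abbreviation "xPW \<equiv> Reg 14"
abbreviation "xCNT \<equiv> Reg 15" abbreviation "xCC \<equiv> Reg 16" abbreviation "xPND \<equiv> Reg 17"
abbreviation "xDG \<equiv> Reg 18" abbreviation "xTB \<equiv> Reg 19"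

abbreviation At :: "expr \<Rightarrow> expr \<Rightarrow> expr" where "At e f \<equiv> Mem (Add e f)"
abbreviation Or :: "cond \<Rightarrow> cond \<Rightarrow> cond" where "Or b c \<equiv> Not (And (Not b) (Not c))"
abbreviation Leq :: "expr \<Rightarrow> expr \<Rightarrow> cond" where "Leq e f \<equiv> Not (Less f e)"
abbreviation Eq :: "expr \<Rightarrow> expr \<Rightarrow> cond" where "Eq e f \<equiv> And (Leq e f) (Leq f e)"

definition read_parameters :: com where
  "read_parameters = block [Assign 0 (Mem (Lit 0)), Assign 1 (Mem (Lit 1)), Assign 2 (Mem (Lit 2)),
     Assign 3 (Mem (Lit 3)), Assign 4 (Mem (Lit 4)), Assign 5 (Mem (Lit 5)), Assign 6 (Add xM0 xM1)]"

definition sum_processing :: com where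
  "sum_processing = Seq (Assign 7 (Lit 0)) (For 20 xN (Assign 7 (Add xT (At (Lit 6) (Reg 20)))))"

definition layout_arrays :: com where
  "layout_arrays = block [Assign 9 (Add (Lit 6) (Mul (Lit 3) xN)), Assign 10 (Add xORD xN),
     Assign 11 (Add xSP xN), Assign 12 (Add xSW xN), Assign 13 (Add xSD xN), Assign 14 (Add xSPD xm),
     Assign 15 (Add xPW xm), Assign 16 (Add xCNT xm), Assign 17 (Add xCC xn), Assign 18 (Add xPND xn),
     Assign 8 (Lit 1)]"

definition machine_step :: com where
  "machine_step = block [
     If (Less (Reg 20) xM0) (Store (Add xSPD (Reg 20)) xV0) (Store (Add xSPD (Reg 20)) xV1),
     Store (Add xPW (Reg 20)) xS, Store (Add xCNT (Reg 20)) (Lit 0), Assign 8 (Mul xS xT)]"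

definition machine_arrays :: com where
  "machine_arrays = Seq (For 20 xm machine_step) (Assign 19 (Add xDG (Mul xS xm)))"

text \<open>
  Sorting by counting, for each job, the jobs that precede it.
\<close>

definition rank_step :: com where
  "rank_step = (let pi = At (Lit 6) (Reg 21); pj = At (Lit 6) (Reg 20);
      di = Mem (Add (Add (Lit 6) (Mul (Lit 2) xN)) (Reg 21));
      dj = Mem (Add (Add (Lit 6) (Mul (Lit 2) xN)) (Reg 20)) in
    If (Or (Less pj pi) (And (Eq pi pj) (Or (Less dj di) (And (Eq di dj) (Less (Reg 21) (Reg 20))))))
      (Assign 22 (Add (Reg 22) (Lit 1))) Skip)"

definition copy_job :: com where
  "copy_job = block [Store (Add xORD (Reg 22)) (Reg 20),
     Store (Add xSP (Reg 22)) (At (Lit 6) (Reg 20)),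
     Store (Add xSW (Reg 22)) (Mem (Add (Add (Lit 6) xN) (Reg 20))),
     Store (Add xSD (Reg 22)) (Mem (Add (Add (Lit 6) (Mul (Lit 2) xN)) (Reg 20)))]"

definition sort_jobs :: com where
  "sort_jobs = For 20 xN (block [Assign 22 (Lit 0), For 21 xN rank_step, copy_job])"

definition pick_step :: com where
  "pick_step = If (Less (Div (Add (At xCNT (Reg 21)) (Lit 1)) (At xSPD (Reg 21)))
      (Div (Add (At xCNT (Reg 22)) (Lit 1)) (At xSPD (Reg 22)))) (Assign 22 (Reg 21)) Skip"

definition coef_store :: com where
  "coef_store = block [
     Store (Add xCC (Reg 20)) (Div (Add (At xCNT (Reg 22)) (Lit 1)) (At xSPD (Reg 22))),
     Store (Add xCNT (Reg 22)) (Add (At xCNT (Reg 22)) (Lit 1))]"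

definition coefficients :: com where
  "coefficients = For 20 xn (block [Assign 22 (Lit 0), For 21 xm pick_step, coef_store])"


text \<open>
  The machine has no division with remainder. The digits of \<open>k\<close> are its last digit,
  followed by those of \<open>k div T\<close>, which are already in the table when they are needed
  since \<open>k div T \<le> k\<close>; quotient and remainder are kept in registers 22 and 23 as
  \<open>k\<close> advances.
\<close>

definition digit_step :: com where
  "digit_step = If (Less (Reg 21) (Lit 1))
     (Store (Add (Add xDG (Mul (Reg 20) xm)) (Reg 21)) (Reg 23))
     (Store (Add (Add xDG (Mul (Reg 20) xm)) (Reg 21))
       (Mem (Add (Add xDG (Mul (Reg 22) xm)) (Sub (Reg 21) (Lit 1)))))"

definition digit_next :: com where
  "digit_next = Seq (Assign 23 (Add (Reg 23) (Lit 1)))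
     (If (Eq (Reg 23) xT) (Seq (Assign 23 (Lit 0)) (Assign 22 (Add (Reg 22) (Lit 1)))) Skip)"

definition digit_table :: com where
  "digit_table = block [Assign 22 (Lit 0), Assign 23 (Lit 0),
     For 20 xS (Seq (For 21 xm digit_step) digit_next)]"

definition cell_expr :: "expr \<Rightarrow> expr \<Rightarrow> expr \<Rightarrow> expr \<Rightarrow> expr" where
  "cell_expr r u b k = Add xTB (Mul (Lit 3) (Add (Mul (Add (Mul (Add (Mul r (Add xn (Lit 1))) u)
     (Add xn (Lit 1))) b) (Add xS (Lit 1))) k))"

text \<open>
  Conditionals are nested because a conjunction evaluates both of its parts, and the array of
  lengths has no entry before the first.
\<close>

definition group_end_test :: com where
  "group_end_test = Seq (Assign 30 (Lit 0))
     (If (Less (Lit 0) (Reg 22))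
       (If (Less (Lit 0) (Reg 20))
         (If (Eq (At xSP (Sub (Reg 20) (Lit 1))) (At xSP (Reg 20))) Skip (Assign 30 (Lit 1)))
         (Assign 30 (Lit 1)))
       Skip)"

text \<open>
  Registers 38, 39 and 41 hold the excess, weight and decision of the candidate.
\<close>

definition offer_candidate :: com where
  "offer_candidate = If (Or (Less (Reg 27) (Lit 1)) (Or (Less (Reg 38) (Reg 25))
       (And (Leq (Reg 38) (Reg 25)) (Less (Reg 39) (Reg 26)))))
     (block [Assign 25 (Reg 38), Assign 26 (Reg 39), Assign 27 (Reg 41)]) Skip"

definition prepare_flush :: com where
  "prepare_flush = block [Assign 28 (At xSP (Reg 20)), Assign 36 (Sub (Reg 21) (Lit 1)),
     Assign 29 (cell_expr (Reg 20) (Reg 36) (Sub (Reg 22) (Lit 1)) (Lit 0)),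
     Assign 30 (Lit 1), Assign 32 (Lit 0)]"

definition offer_skip :: com where
  "offer_skip = If (Leq (Reg 21) (Add (Reg 22) (Reg 40)))
     (block [Assign 33 (cell_expr (Reg 40) (Reg 21) (Reg 22) (Reg 23)),
        Assign 38 (Mem (Reg 33)), Assign 39 (At (Reg 33) (Lit 1)), Assign 41 (Lit 1), offer_candidate]) Skip"

definition offer_tardy :: com where
  "offer_tardy = block [Assign 33 (cell_expr (Reg 40) (Reg 21) (Add (Reg 22) (Lit 1)) (Reg 23)),
     Assign 38 (Mem (Reg 33)), Assign 39 (Add (At (Reg 33) (Lit 1)) (At xSW (Reg 40))),
     Assign 41 (Lit 2), offer_candidate]"

definition prepare_early :: com where
  "prepare_early = block [Assign 28 (At xSP (Reg 40)), Assign 31 (At xSD (Reg 40)), Assign 32 (Lit 1),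
     Assign 36 (Sub (Reg 21) (Lit 1)),
     Assign 29 (cell_expr (Reg 40) (Reg 36) (Reg 22) (Lit 0)), Assign 30 (Lit 1)]"

definition prepare_job :: com where
  "prepare_job = block [Assign 40 (Sub (Reg 20) (Lit 1)), offer_skip,
     If (Less (Reg 22) (Reg 21)) (Seq offer_tardy prepare_early) Skip]"

text \<open>
  Leaves register 30 at 1 if machines are to be tried, for a job of length register 28 that leads
  to the table row starting at register 29; register 32 tells whether the due date in register 31
  must be met. The index \<open>T ^ m\<close> occurs in final states only, whose entries are zero;
  all other states excluded by the outer test are unreachable.
\<close>

definition prepare_entry :: com where
  "prepare_entry = block [Assign 37 (cell_expr (Reg 20) (Reg 21) (Reg 22) (Reg 23)),
     Assign 25 (Lit 0), Assign 26 (Lit 0), Assign 27 (Lit 0), Assign 30 (Lit 0),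
     If (And (And (Less (Reg 23) xS) (Leq (Reg 22) (Reg 21))) (Or (Less (Reg 20) xN) (Less (Reg 22) (Lit 1))))
       (Seq group_end_test
         (If (Less (Lit 0) (Reg 30)) prepare_flush
           (If (Less (Lit 0) (Reg 20)) prepare_job Skip))) Skip]"

definition try_machine :: com where
  "try_machine = Seq (Assign 35 (Add (Reg 23) (Mul (Reg 28) (At xPW (Reg 24)))))
     (If (Leq (Reg 35) xS)
       (Seq (Assign 34 (Div (Add (Mem (Add (Add xDG (Mul (Reg 23) xm)) (Reg 24))) (Reg 28)) (At xSPD (Reg 24))))
         (If (Or (Less (Reg 32) (Lit 1)) (Leq (Reg 34) (Reg 31)))
           (block [Assign 33 (Add (Reg 29) (Mul (Lit 3) (Reg 35))),
              Assign 38 (Sub (Add (Mem (Reg 33)) (Reg 34)) (Mul (Reg 28) (At xCC (Reg 36)))),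
              Assign 39 (At (Reg 33) (Lit 1)), Assign 41 (Add (Reg 24) (Lit 3)),
              offer_candidate]) Skip)) Skip)"

definition store_entry :: com where
  "store_entry = block [Store (Reg 37) (Reg 25), Store (Add (Reg 37) (Lit 1)) (Reg 26),
     Store (Add (Reg 37) (Lit 2)) (Reg 27)]"

definition table_entry :: com where
  "table_entry = block [prepare_entry, If (Less (Lit 0) (Reg 30)) (For 24 xm try_machine) Skip, store_entry]"

definition table :: com where
  "table = For 20 (Add xN (Lit 1)) (For 21 (Add xn (Lit 1)) (For 22 (Add xn (Lit 1))
     (For 23 (Add xS (Lit 1)) table_entry)))"

text \<open>
  Expects the decision in register 27, the job in 29 and its length in 28.
\<close>

definition place_job :: com where
  "place_job = block [Assign 24 (Sub (Reg 27) (Lit 3)),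
     Store (Add (Lit 2) (Reg 29)) (Add (Reg 24) (Lit 1)),
     Store (Add (Add (Lit 2) xN) (Reg 29))
       (Div (Mem (Add (Add xDG (Mul (Reg 23) xm)) (Reg 24))) (At xSPD (Reg 24))),
     Assign 23 (Add (Reg 23) (Mul (Reg 28) (At xPW (Reg 24)))),
     Assign 21 (Sub (Reg 21) (Lit 1))]"

text \<open>
  The result overwrites the input, all of which has been copied into the arrays before.
\<close>

definition output_step :: com where
  "output_step = block [group_end_test,
     Assign 27 (At (cell_expr (Reg 20) (Reg 21) (Reg 22) (Reg 23)) (Lit 2)),
     If (Less (Lit 0) (Reg 30))
       (block [Assign 28 (At xSP (Reg 20)), Assign 22 (Sub (Reg 22) (Lit 1)),
          Assign 29 (At xPND (Reg 22)), place_job])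
       (block [Assign 20 (Sub (Reg 20) (Lit 1)), Assign 29 (At xORD (Reg 20)),
          Assign 28 (At xSP (Reg 20)),
          If (Less (Reg 27) (Lit 2))
            (Seq (Store (Add (Lit 2) (Reg 29)) (Lit 0)) (Store (Add (Add (Lit 2) xN) (Reg 29)) (Lit 0)))
            (If (Less (Reg 27) (Lit 3))
              (Seq (Store (Add xPND (Reg 22)) (Reg 29)) (Assign 22 (Add (Reg 22) (Lit 1))))
              place_job)])]"

definition output_start :: com where
  "output_start = block [Store (Lit 0) (Lit 1),
     Store (Lit 1) (At (cell_expr xN xn (Lit 0) (Lit 0)) (Lit 1)),
     Assign 20 xN, Assign 21 xn, Assign 22 (Lit 0), Assign 23 (Lit 0)]"

definition write_output :: com where
  "write_output = Seq output_start (While (Less (Lit 0) (Add (Reg 20) (Reg 22))) output_step)"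

definition program :: com where
  "program = Seq read_parameters
     (If (And (Less xm (Lit 1)) (Less (Lit 0) xn)) (Store (Lit 0) (Lit 0))
       (block [sum_processing, layout_arrays, machine_arrays, sort_jobs, coefficients, digit_table,
          table, write_output]))"

context machines begin

section \<open>Memory layout\<close>

abbreviation "T \<equiv> total_proc P"

text \<open>
  The arrays follow the input without gaps, in the order in which their addresses are listed here.
\<close>

definition "aORD = 6 + 3 * N"
definition "aSP = aORD + N"
definition "aSW = aSP + N"
definition "aSD = aSW + N"
definition "aSPD = aSD + N"
definition "aPW = aSPD + m"
definition "aCNT = aPW + m"
definition "aCC = aCNT + m"
definition "aPND = aCC + n"
definition "aDG = aPND + n"
definition "aTB = aDG + states * m"
definition "aEND = aTB + 3 * ((N + 1) * (n + 1) * (n + 1) * (states + 1))"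

lemmas layout = aORD_def aSP_def aSW_def aSD_def aSPD_def aPW_def aCNT_def aCC_def aPND_def aDG_def

lemma bounds[simp]:
  "j < N \<Longrightarrow> aORD + j < aEND" "j < N \<Longrightarrow> aSP + j < aEND" "j < N \<Longrightarrow> aSW + j < aEND"
  "j < N \<Longrightarrow> aSD + j < aEND" "i < m \<Longrightarrow> aSPD + i < aEND" "i < m \<Longrightarrow> aPW + i < aEND"
  "i < m \<Longrightarrow> aCNT + i < aEND" "u < n \<Longrightarrow> aCC + u < aEND" "u < n \<Longrightarrow> aPND + u < aEND"
  "a < aORD \<Longrightarrow> a < aEND" "a < aTB \<Longrightarrow> a < aEND"
  by (simp_all add: aEND_def aTB_def layout)

lemma low_bounds[simp]: "j < N \<Longrightarrow> 6 + j < aORD" "j < N \<Longrightarrow> 6 + N + j < aORD"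
  "j < N \<Longrightarrow> 6 + 2 * N + j < aORD" "j < N \<Longrightarrow> 2 + j < aORD" "j < N \<Longrightarrow> 2 + N + j < aORD"
  "0 < aORD" "1 < aORD" "2 < aORD" "3 < aORD" "4 < aORD" "5 < aORD" "Suc 0 < aORD"
  by (simp_all add: aORD_def)

definition params :: "(nat \<Rightarrow> real) \<Rightarrow> bool" where
  "params f \<longleftrightarrow> f 0 = real (low_machines P) \<and> f 1 = real (high_machines P) \<and> f 2 = low_speed P \<and>
     f 3 = high_speed P \<and> f 4 = real N \<and> f 5 = real n \<and> f 6 = real m"

definition base_regs :: "(nat \<Rightarrow> real) \<Rightarrow> bool" where
  "base_regs f \<longleftrightarrow> params f \<and> f 7 = real T \<and> f 9 = real aORD \<and> f 10 = real aSP \<and> f 11 = real aSW \<and>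
     f 12 = real aSD \<and> f 13 = real aSPD \<and> f 14 = real aPW \<and> f 15 = real aCNT \<and> f 16 = real aCC \<and>
     f 17 = real aPND \<and> f 18 = real aDG"

definition all_regs :: "(nat \<Rightarrow> real) \<Rightarrow> bool" where
  "all_regs f \<longleftrightarrow> base_regs f \<and> f 8 = real states \<and> f 19 = real aTB"

lemma params_upd[simp]: "7 \<le> x \<Longrightarrow> params (f(x := v)) = params f" by (simp add: params_def)
lemma base_regs_upd[simp]: "20 \<le> x \<or> x = 8 \<or> x = 19 \<Longrightarrow> base_regs (f(x := v)) = base_regs f"
  by (auto simp: base_regs_def)
lemma all_regs_upd[simp]: "20 \<le> x \<Longrightarrow> all_regs (f(x := v)) = all_regs f" by (simp add: all_regs_def)

lemmas base_regsD = base_regs_def[THEN iffD1, unfolded params_def]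
lemmas all_regsD = all_regs_def[THEN iffD1, unfolded base_regs_def params_def]

definition input :: "(nat \<Rightarrow> real) \<Rightarrow> bool" where
  "input h \<longleftrightarrow> (\<forall>j<N. h (6 + j) = real (p j) \<and> h (6 + N + j) = weight P j \<and> h (6 + 2 * N + j) = due P j)"

lemma input_upd[simp]: "aORD \<le> x \<Longrightarrow> input (h(x := v)) = input h"
  unfolding input_def aORD_def by (intro all_cong1 imp_cong refl) simp

definition machine_data :: "(nat \<Rightarrow> real) \<Rightarrow> nat \<Rightarrow> bool" where
  "machine_data h k \<longleftrightarrow> (\<forall>i<k. h (aSPD + i) = V i \<and> h (aPW + i) = real T ^ i)"

definition counts :: "(nat \<Rightarrow> real) \<Rightarrow> (nat \<Rightarrow> nat) \<Rightarrow> nat \<Rightarrow> bool" where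
  "counts h c k \<longleftrightarrow> (\<forall>i<k. h (aCNT + i) = real (c i))"

definition sorted_jobs :: "(nat \<Rightarrow> real) \<Rightarrow> nat \<Rightarrow> bool" where
  "sorted_jobs h c \<longleftrightarrow> (\<forall>j<c. h (aORD + rank j) = real j \<and> h (aSP + rank j) = real (p j) \<and>
     h (aSW + rank j) = weight P j \<and> h (aSD + rank j) = due P j)"

definition coefs :: "(nat \<Rightarrow> real) \<Rightarrow> nat \<Rightarrow> bool" where
  "coefs h c \<longleftrightarrow> (\<forall>u<c. h (aCC + u) = coef P u)"

definition digits :: "(nat \<Rightarrow> real) \<Rightarrow> nat \<Rightarrow> bool" where
  "digits h c \<longleftrightarrow> (\<forall>k i. k < states \<and> i < m \<and> k * m + i < c \<longrightarrow> h (aDG + k * m + i) = real (digit k i))"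

lemma machine_data_upd[simp]: "k \<le> m \<Longrightarrow> x < aSPD \<or> aCNT \<le> x \<Longrightarrow> machine_data (h(x := v)) k = machine_data h k"
  unfolding machine_data_def aCNT_def aPW_def by (intro all_cong1 imp_cong refl) auto

lemma counts_upd[simp]: "k \<le> m \<Longrightarrow> x < aCNT \<or> aCC \<le> x \<Longrightarrow> counts (h(x := v)) c k = counts h c k"
  unfolding counts_def aCC_def by (intro all_cong1 imp_cong refl) auto

lemma sorted_jobs_upd[simp]: "c \<le> N \<Longrightarrow> x < aORD \<or> aSPD \<le> x \<Longrightarrow> sorted_jobs (h(x := v)) c = sorted_jobs h c"
  unfolding sorted_jobs_def
proof (intro all_cong1 imp_cong refl)
  fix j assume "c \<le> N" "x < aORD \<or> aSPD \<le> x" "j < c"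
  then show "((h(x := v)) (aORD + rank j) = real j \<and> (h(x := v)) (aSP + rank j) = real (p j) \<and>
     (h(x := v)) (aSW + rank j) = weight P j \<and> (h(x := v)) (aSD + rank j) = due P j)
    \<longleftrightarrow> (h (aORD + rank j) = real j \<and> h (aSP + rank j) = real (p j) \<and>
     h (aSW + rank j) = weight P j \<and> h (aSD + rank j) = due P j)"
    using rank_less[of j] by (auto simp: aSPD_def aSD_def aSW_def aSP_def)
qed

lemma coefs_upd[simp]: "c \<le> n \<Longrightarrow> x < aCC \<or> aPND \<le> x \<Longrightarrow> coefs (h(x := v)) c = coefs h c"
  unfolding coefs_def aPND_def by (intro all_cong1 imp_cong refl) auto

lemma digits_upd[simp]: "x < aDG \<or> aTB \<le> x \<Longrightarrow> digits (h(x := v)) c = digits h c"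
  unfolding digits_def
proof (intro all_cong1 imp_cong refl)
  fix k i assume "x < aDG \<or> aTB \<le> x" "k < states \<and> i < m \<and> k * m + i < c"
  then show "((h(x := v)) (aDG + k * m + i) = real (digit k i)) = (h (aDG + k * m + i) = real (digit k i))"
    using mat_less[of k states i m] by (auto simp: aTB_def)
qed

lemma layout_order[simp]:
  "aORD \<le> aSP + i" "aORD \<le> aSW + i" "aORD \<le> aSD + i" "aORD \<le> aORD + i" "aORD \<le> aSPD + i" "aORD \<le> aPW + i" "aORD \<le> aCNT + i" "aORD \<le> aCC + i"
  "aORD \<le> aPND + i" "aORD \<le> aDG + i" "aSPD \<le> aCC + i" "aSPD \<le> aCNT + i" "aSPD \<le> aPND + i" "aSPD \<le> aDG + i"
  "aCNT \<le> aCC + i" "aCNT \<le> aPND + i" "aCNT \<le> aDG + i" "aCC \<le> aPND + i" "aCC \<le> aDG + i" "aPND \<le> aDG + i"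
  "aPND \<le> aPND + i" "aCNT \<le> aCNT + i"
  by (simp_all add: layout)

lemma layout_less[simp]:
  "j < N \<Longrightarrow> aORD + j < aSPD" "j < N \<Longrightarrow> aSP + j < aSPD" "j < N \<Longrightarrow> aSW + j < aSPD" "j < N \<Longrightarrow> aSD + j < aSPD"
  "j < N \<Longrightarrow> aORD + j < aCNT" "j < N \<Longrightarrow> aSP + j < aCNT" "j < N \<Longrightarrow> aSW + j < aCNT" "j < N \<Longrightarrow> aSD + j < aCNT"
  "i < m \<Longrightarrow> aCNT + i < aCC" "u < n \<Longrightarrow> aCC + u < aDG" "u < n \<Longrightarrow> aPND + u < aDG" "i < m \<Longrightarrow> aCNT + i < aDG"
  by (simp_all add: layout)

section \<open>Verification of the program\<close>

abbreviation "h0 \<equiv> heap (initial_state (encode_instance P))"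

lemma initial_heap: "h0 0 = real (low_machines P)" "h0 1 = real (high_machines P)" "h0 2 = low_speed P"
  "h0 3 = high_speed P" "h0 4 = real N" "h0 5 = real n" "input h0"
  by (auto simp: initial_state_def encode_instance_def input_def nth_append)

lemma read_parameters:
  "line aEND read_parameters (\<lambda>s. params (regs s) \<and> heap s = h0) (initial_state (encode_instance P))"
  using initial_heap by (simp add: read_parameters_def is_address_iff params_def num_machines_def)

lemma sum_processing:
  assumes "params (regs s)" "input (heap s)"
  shows "run aEND sum_processing (2 + (N * 14 + 5))
    (\<lambda>s'. params (regs s') \<and> heap s' = heap s \<and> regs s' 7 = real T) s"
  unfolding sum_processing_def
proof (rule run_Seq, rule run_line_le, unfold line.simps, intro conjI, simp,
    rule run_For[where n = N and T = 7 and
      I = "\<lambda>k s'. params (regs s') \<and> heap s' = heap s \<and> regs s' 7 = real (\<Sum>j<k. p j)"], goal_cases)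
  case (3 k s')
  then have "heap s (6 + k) = real (p k)" using assms by (auto simp: input_def)
  then show ?case using 3 by (intro run_line_le) (simp_all add: is_address_iff)
qed (use assms in \<open>auto simp: params_def total_proc_def\<close>)

lemma layout_arrays:
  assumes "params (regs s)" "regs s 7 = real T"
  shows "line aEND layout_arrays (\<lambda>s'. base_regs (regs s') \<and> regs s' 8 = 1 \<and> heap s' = heap s) s"
  using assms by (simp add: layout_arrays_def base_regs_def params_def layout)

lemma machine_arrays:
  assumes "base_regs (regs s)" "regs s 8 = 1" "input (heap s)"
  shows "run aEND machine_arrays (m * (line_cost machine_step + 7) + 5 + 6)
    (\<lambda>s'. all_regs (regs s') \<and> input (heap s') \<and> machine_data (heap s') m \<and> counts (heap s') (\<lambda>_. 0) m) s"
  unfolding machine_arrays_def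
proof (rule run_Seq, rule run_For[where n = m and T = "line_cost machine_step" and
      I = "\<lambda>k s'. base_regs (regs s') \<and> regs s' 8 = real T ^ k \<and> input (heap s') \<and>
        machine_data (heap s') k \<and> counts (heap s') (\<lambda>_. 0) k"], goal_cases)
  case (2 k s')
  then show ?case using base_regsD[of "regs s'"] by simp
next
  case (3 k s')
  then have R: "base_regs (regs s')" and k: "k < m" by auto
  note R = base_regsD[OF R]
  let ?h = "(heap s')(aSPD + k := V k, aPW + k := real T ^ k, aCNT + k := 0)"
  have "machine_data ?h (Suc k)" "counts ?h (\<lambda>_. 0) (Suc k)"
    using 3 k by (auto simp: machine_data_def counts_def less_Suc_eq aPW_def aCNT_def)
  then show ?case
    using 3 R by (intro run_line) (auto simp: machine_step_def is_address_iff speed_def)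
next
  case (4 s')
  then have R: "base_regs (regs s')" by auto
  note R = base_regsD[OF R]
  show ?case using 4 R by (intro run_line_le) (simp_all add: all_regs_def states_def aTB_def)
qed (use assms in \<open>auto simp: machine_data_def counts_def\<close>)


abbreviation "sort_time \<equiv> N * (2 + (N * (line_cost rank_step + 7) + 5 + line_cost copy_job) + 7) + 5"

lemma sort_jobs:
  assumes "all_regs (regs s)" "input (heap s)" "machine_data (heap s) m" "counts (heap s) (\<lambda>_. 0) m"
  shows "run aEND sort_jobs sort_time (\<lambda>s'. all_regs (regs s') \<and> machine_data (heap s') m \<and>
     counts (heap s') (\<lambda>_. 0) m \<and> sorted_jobs (heap s') N) s"
  unfolding sort_jobs_def
proof (rule run_For[where n = N and I = "\<lambda>k s'. all_regs (regs s') \<and> input (heap s') \<and>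
      machine_data (heap s') m \<and> counts (heap s') (\<lambda>_. 0) m \<and> sorted_jobs (heap s') k"
      and T = "2 + (N * (line_cost rank_step + 7) + 5 + line_cost copy_job)"], goal_cases)
  case (2 k s')
  then show ?case using all_regsD[of "regs s'"] by simp
next
  case (3 k s')
  then have k: "k < N" and I: "all_regs (regs s')" "input (heap s')" "machine_data (heap s') m"
    "counts (heap s') (\<lambda>_. 0) m" "sorted_jobs (heap s') k" and r: "regs s' 20 = real k" by auto
  have inp: "heap s' (6 + j) = real (p j)" "heap s' (6 + N + j) = weight P j" "heap s' (6 + 2 * N + j) = due P j"
    if "j < N" for j using I(2) that by (auto simp: input_def)
  let ?c = "\<lambda>i. card {l. l < i \<and> precedes l k}"
  show ?case
    unfolding block.simps
  proof (rule run_Seq, rule run_line_le, unfold line.simps, intro conjI, simp, rule run_Seq,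
      rule run_For[where n = N and T = "line_cost rank_step" and
        I = "\<lambda>i s''. all_regs (regs s'') \<and> heap s'' = heap s' \<and> regs s'' 20 = real k \<and> regs s'' 22 = real (?c i)"],
      goal_cases)
    case 1
    then show ?case using I r by simp
  next
    case (2 i s'')
    then show ?case using all_regsD[of "regs s''"] by simp
  next
    case (3 i s'')
    then have i: "i < N" and J: "all_regs (regs s'')" "heap s'' = heap s'" "regs s'' 20 = real k"
      "regs s'' 22 = real (?c i)" "regs s'' 21 = real i" by auto
    note R = all_regsD[OF J(1)]
    have "{l. l < Suc i \<and> precedes l k} = (if precedes i k then insert i {l. l < i \<and> precedes l k}
        else {l. l < i \<and> precedes l k})" by (auto simp: less_Suc_eq)
    then have c: "?c (Suc i) = (if precedes i k then ?c i + 1 else ?c i)" by simp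
    show ?case
      unfolding c using i k J R inp[OF i] inp[OF k]
      by (intro run_line) (auto simp: rank_step_def Let_def is_address_iff precedes_def)
  next
    case (4 s'')
    then have J: "all_regs (regs s'')" "heap s'' = heap s'" "regs s'' 20 = real k" "regs s'' 22 = real (rank k)"
      by (auto simp: rank_def)
    note R = all_regsD[OF J(1)]
    have rk: "rank k < N" using rank_less k by simp
    let ?h = "(heap s')(aORD + rank k := real k, aSP + rank k := real (p k),
      aSW + rank k := weight P k, aSD + rank k := due P k)"
    have "sorted_jobs ?h (Suc k)"
      unfolding sorted_jobs_def
    proof (intro allI impI)
      fix j assume j: "j < Suc k"
      show "?h (aORD + rank j) = real j \<and> ?h (aSP + rank j) = real (p j) \<and>
         ?h (aSW + rank j) = weight P j \<and> ?h (aSD + rank j) = due P j"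
      proof (cases "j = k")
        case True
        then show ?thesis using rk by (simp add: aSP_def aSW_def aSD_def)
      next
        case False
        then have jk: "j < k" using j by simp
        have "rank j < N" using rank_less k jk by simp
        moreover have "rank j \<noteq> rank k" using rank_inj k jk unfolding inj_on_def by fastforce
        ultimately show ?thesis using rk I(5) jk by (simp add: sorted_jobs_def aSP_def aSW_def aSD_def)
      qed
    qed
    moreover have "6 + k \<noteq> aORD + rank k" "6 + N + k \<noteq> aORD + rank k" "6 + 2 * N + k \<noteq> aORD + rank k"
      "6 + N + k \<noteq> aSP + rank k" "6 + 2 * N + k \<noteq> aSP + rank k" "6 + 2 * N + k \<noteq> aSW + rank k"
      using k by (simp_all add: layout)
    ultimately show ?case
      using k J R inp[OF k] I rk
      by (intro run_line) (simp add: copy_job_def is_address_iff)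
  qed simp_all
qed (use assms in \<open>auto simp: sorted_jobs_def\<close>)

abbreviation "coef_time \<equiv> n * (2 + (m * (line_cost pick_step + 7) + 5 + line_cost coef_store) + 7) + 5"

lemma coefficients:
  assumes "all_regs (regs s)" "machine_data (heap s) m" "counts (heap s) (\<lambda>_. 0) m" "sorted_jobs (heap s) N"
  shows "run aEND coefficients coef_time (\<lambda>s'. all_regs (regs s') \<and> machine_data (heap s') m \<and>
     sorted_jobs (heap s') N \<and> coefs (heap s') n) s"
  unfolding coefficients_def
proof (rule run_For[where n = n and I = "\<lambda>u s'. all_regs (regs s') \<and>
      machine_data (heap s') m \<and> sorted_jobs (heap s') N \<and> counts (heap s') (greedy P u) m \<and> coefs (heap s') u"
      and T = "2 + (m * (line_cost pick_step + 7) + 5 + line_cost coef_store)"], goal_cases)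
  case (2 k s')
  then show ?case using all_regsD[of "regs s'"] by simp
next
  case (3 u s')
  then have u: "u < n" and I: "all_regs (regs s')" "machine_data (heap s') m" "sorted_jobs (heap s') N"
    "counts (heap s') (greedy P u) m" "coefs (heap s') u" and r: "regs s' 20 = real u" by auto
  have m: "0 < m" using machines u by auto
  let ?f = "position_cost P (greedy P u)"
  have mem: "heap s' (aCNT + i) = real (greedy P u i)" "heap s' (aSPD + i) = V i" if "i < m" for i
    using I that by (auto simp: counts_def machine_data_def)
  show ?case
    unfolding block.simps
  proof (rule run_Seq, rule run_line_le, unfold line.simps, intro conjI, simp, rule run_Seq,
      rule run_For[where n = m and T = "line_cost pick_step" and
        I = "\<lambda>i s''. all_regs (regs s'') \<and> heap s'' = heap s' \<and> regs s'' 20 = real u \<and> regs s'' 22 = real (first_min ?f i)"],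
      goal_cases)
    case 1
    then show ?case using I r by simp
  next
    case (2 i s'')
    then show ?case using all_regsD[of "regs s''"] by simp
  next
    case (3 i s'')
    then have i: "i < m" and J: "all_regs (regs s'')" "heap s'' = heap s'" "regs s'' 20 = real u"
      "regs s'' 22 = real (first_min ?f i)" "regs s'' 21 = real i" by auto
    note R = all_regsD[OF J(1)]
    have b: "first_min ?f i < m" using first_min_less[of i ?f] i m by (cases i) auto
    show ?case
      using i J R mem[OF i] mem[OF b] b
      by (intro run_line) (auto simp: pick_step_def is_address_iff position_cost_def)
  next
    case (4 s'')
    then have J: "all_regs (regs s'')" "heap s'' = heap s'" "regs s'' 20 = real u" "regs s'' 22 = real (pick P u)"
      by (auto simp: pick_def)
    note R = all_regsD[OF J(1)]
    have b: "pick P u < m" using pick_less m by simp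
    let ?h = "(heap s')(aCC + u := coef P u, aCNT + pick P u := real (greedy P u (pick P u)) + 1)"
    have "counts ?h (greedy P (Suc u)) m" "coefs ?h (Suc u)"
      using I u b by (auto simp: counts_def coefs_def greedy_Suc less_Suc_eq aCC_def)
    moreover have "aCNT + pick P u \<noteq> aCC + u" using b by (simp add: aCC_def)
    ultimately show ?case
      using u J R mem[OF b] I b
      by (intro run_line) (simp add: coef_store_def is_address_iff coef_def position_cost_def)
  qed simp_all
qed (use assms in \<open>auto simp: coefs_def\<close>)

lemma digit_Suc: "digit k (Suc i) = digit (k div T) i"
  by (simp add: digit_def div_mult2_eq)

lemma digit_store:
  assumes "digits h (k * m + i)" "k < states" "i < m"
  shows "digits (h(aDG + k * m + i := real (digit k i))) (k * m + Suc i)"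
  unfolding digits_def
proof (intro allI impI)
  fix k' i' assume a: "k' < states \<and> i' < m \<and> k' * m + i' < k * m + Suc i"
  show "(h(aDG + k * m + i := real (digit k i))) (aDG + k' * m + i') = real (digit k' i')"
  proof (cases "k' * m + i' = k * m + i")
    case True
    then show ?thesis using mat_inj[OF True] assms a by simp
  next
    case False
    then show ?thesis using a assms(1) by (simp add: digits_def)
  qed
qed

definition static :: "(nat \<Rightarrow> real) \<Rightarrow> bool" where
  "static h \<longleftrightarrow> machine_data h m \<and> sorted_jobs h N \<and> coefs h n \<and> digits h (states * m)"

abbreviation "digit_time \<equiv> 2 + (2 + (states * (m * (line_cost digit_step + 7) + 5 + line_cost digit_next + 7) + 5))"

lemma digit_table:
  assumes "all_regs (regs s)" "machine_data (heap s) m" "sorted_jobs (heap s) N" "coefs (heap s) n"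
  shows "run aEND digit_table digit_time (\<lambda>s'. all_regs (regs s') \<and> static (heap s')) s"
  unfolding digit_table_def block.simps
proof (rule run_Seq, rule run_line_le, unfold line.simps, intro conjI, simp, rule run_Seq, rule run_line_le,
    unfold line.simps, intro conjI, simp,
    rule run_For[where n = states and I = "\<lambda>k s'. all_regs (regs s') \<and>
      machine_data (heap s') m \<and> sorted_jobs (heap s') N \<and> coefs (heap s') n \<and> digits (heap s') (k * m) \<and>
      regs s' 22 = real (k div T) \<and> regs s' 23 = real (k mod T)"
      and T = "m * (line_cost digit_step + 7) + 5 + line_cost digit_next"], goal_cases)
  case (2 k s')
  then show ?case using all_regsD[of "regs s'"] by simp
next
  case (3 k s')
  then have k: "k < states" and I: "all_regs (regs s')" "machine_data (heap s') m" "sorted_jobs (heap s') N"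
    "coefs (heap s') n" "digits (heap s') (k * m)" "regs s' 22 = real (k div T)" "regs s' 23 = real (k mod T)"
    and r: "regs s' 20 = real k" by auto
  show ?case
  proof (rule run_Seq,
      rule run_For[where n = m and T = "line_cost digit_step" and
        I = "\<lambda>i s''. all_regs (regs s'') \<and> machine_data (heap s'') m \<and> sorted_jobs (heap s'') N \<and> coefs (heap s'') n \<and>
          digits (heap s'') (k * m + i) \<and> regs s'' 22 = real (k div T) \<and> regs s'' 23 = real (k mod T) \<and>
          regs s'' 20 = real k"], goal_cases)
    case 1
    then show ?case using I r by simp
  next
    case (2 i s'')
    then show ?case using all_regsD[of "regs s''"] by simp
  next
    case (3 i s'')
    then have i: "i < m" and J: "all_regs (regs s'')" "machine_data (heap s'') m" "sorted_jobs (heap s'') N"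
      "coefs (heap s'') n" "digits (heap s'') (k * m + i)" "regs s'' 22 = real (k div T)"
      "regs s'' 23 = real (k mod T)" "regs s'' 20 = real k" "regs s'' 21 = real i" by auto
    note R = all_regsD[OF J(1)]
    have lt: "k * m + i < states * m" using mat_less[OF k i] .
    then have lt': "aDG + k * m + i < aTB" by (simp add: aTB_def)
    have ge: "aORD \<le> aDG + k * m + i" "aSPD \<le> aDG + k * m + i" "aCNT \<le> aDG + k * m + i" "aPND \<le> aDG + k * m + i"
      by (simp_all add: layout)
    note st = digit_store[OF J(5) k i]
    show ?case
    proof (cases i)
      case 0
      have "digit k 0 = k mod T" by (simp add: digit_def)
      then show ?thesis
        using J R st lt' ge 0
        by (intro run_line) (simp add: digit_step_def is_address_iff)
    next
      case (Suc i')
      have q: "k div T \<le> k" by simp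
      then have "(k div T) * m \<le> k * m" by (rule mult_right_mono) simp
      then have lt2: "(k div T) * m + i' < k * m + i" using Suc by linarith
      then have "heap s'' (aDG + (k div T) * m + i') = real (digit k i)"
        using J(5)[unfolded digits_def, rule_format, of "k div T" i'] i Suc le_less_trans[OF q k] lt2
        by (simp add: digit_Suc)
      moreover have "aDG + (k div T) * m + i' < aTB" using lt2 lt by (simp add: aTB_def)
      ultimately show ?thesis
        using J R st lt' ge Suc
        by (intro run_line) (simp add: digit_step_def is_address_iff)
    qed
  next
    case (4 s'')
    then have J: "all_regs (regs s'')" "machine_data (heap s'') m" "sorted_jobs (heap s'') N"
      "coefs (heap s'') n" "digits (heap s'') (k * m + m)" "regs s'' 22 = real (k div T)"
      "regs s'' 23 = real (k mod T)" "regs s'' 20 = real k" by auto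
    note R = all_regsD[OF J(1)]
    have dm: "digits (heap s'') (Suc k * m)" using J(5) by (simp add: add.commute)
    have "Suc k div T = (if Suc (k mod T) = T then Suc (k div T) else k div T)"
      "Suc k mod T = (if Suc (k mod T) = T then 0 else Suc (k mod T))"
      by (auto simp: div_Suc mod_Suc)
    then show ?case
      using J R dm by (intro run_line) (auto simp: digit_next_def)
  qed simp_all
qed (use assms in \<open>auto simp: digits_def static_def\<close>)

lemma static_upd[simp]: "x < aORD \<or> aPND \<le> x \<and> x < aDG \<or> aTB \<le> x \<Longrightarrow> static (h(x := v)) = static h"
proof -
  assume x: "x < aORD \<or> aPND \<le> x \<and> x < aDG \<or> aTB \<le> x"
  have o: "aORD \<le> aSPD" "aSPD \<le> aCNT" "aCNT \<le> aCC" "aCC \<le> aPND" "aPND \<le> aDG" "aDG \<le> aTB"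
    by (simp_all add: layout aTB_def)
  show ?thesis unfolding static_def using x o by auto
qed


section \<open>Filling the table\<close>

lemma sorted_at: "sorted_jobs h N \<Longrightarrow> a < N \<Longrightarrow> h (aORD + a) = real (ord a) \<and> h (aSP + a) = real (p (ord a)) \<and>
    h (aSW + a) = weight P (ord a) \<and> h (aSD + a) = due P (ord a)"
  using ord_less[of a] rank_ord[of a] unfolding sorted_jobs_def by metis

lemma static_at:
  assumes "static h"
  shows "a < N \<Longrightarrow> h (aORD + a) = real (ord a)" "a < N \<Longrightarrow> h (aSP + a) = real (p (ord a))"
    "a < N \<Longrightarrow> h (aSW + a) = weight P (ord a)" "a < N \<Longrightarrow> h (aSD + a) = due P (ord a)"
    "i < m \<Longrightarrow> h (aSPD + i) = V i" "i < m \<Longrightarrow> h (aPW + i) = real T ^ i" "u < n \<Longrightarrow> h (aCC + u) = coef P u"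
    "k < states \<Longrightarrow> i < m \<Longrightarrow> h (aDG + k * m + i) = real (digit k i)"
  using assms sorted_at[of h a] mat_less[of k states i m]
  by (auto simp: static_def machine_data_def coefs_def digits_def)

text \<open>
  The linear index of an entry. At the end of a group an entry depends on entries with fewer jobs
  to append, and otherwise on entries with fewer remaining jobs, hence always on entries of
  smaller linear index (\<open>lin_group\<close>, \<open>lin_job\<close>). The four nested loops
  visit the entries in the order of this index.
\<close>

definition lin :: "nat \<Rightarrow> nat \<Rightarrow> nat \<Rightarrow> nat \<Rightarrow> nat" where
  "lin r u b k = ((r * (n + 1) + u) * (n + 1) + b) * (states + 1) + k"

definition cell :: "nat \<Rightarrow> nat \<Rightarrow> nat \<Rightarrow> nat \<Rightarrow> nat" where
  "cell r u b k = aTB + 3 * lin r u b k"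

lemma lin_inj:
  assumes "lin r u b k = lin r' u' b' k'" "u \<le> n" "u' \<le> n" "b \<le> n" "b' \<le> n" "k \<le> states" "k' \<le> states"
  shows "r = r' \<and> u = u' \<and> b = b' \<and> k = k'"
proof -
  have 1: "(r * (n + 1) + u) * (n + 1) + b = (r' * (n + 1) + u') * (n + 1) + b' \<and> k = k'"
    by (rule mat_inj[where b = "states + 1"]) (use assms in \<open>auto simp: lin_def\<close>)
  then have 2: "r * (n + 1) + u = r' * (n + 1) + u' \<and> b = b'"
    by (intro mat_inj[where b = "n + 1"]) (use assms in auto)
  then have "r = r' \<and> u = u'" by (intro mat_inj[where b = "n + 1"]) (use assms in auto)
  then show ?thesis using 1 2 by simp
qed

lemma lin_less: "\<lbrakk>r \<le> N; u \<le> n; b \<le> n; k \<le> states\<rbrakk> \<Longrightarrow> lin r u b k < (N + 1) * (n + 1) * (n + 1) * (states + 1)"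
  unfolding lin_def by (intro mat_less) auto

lemma cell_bounds:
  assumes "r \<le> N" "u \<le> n" "b \<le> n" "k \<le> states"
  shows "cell r u b k < aEND" "cell r u b k + 1 < aEND" "cell r u b k + 2 < aEND"
  using lin_less[OF assms] by (simp_all add: cell_def aEND_def)

lemma lin_next: "lin r u b (Suc states) = lin r u (Suc b) 0" "lin r u (Suc n) 0 = lin r (Suc u) 0 0"
  "lin r (Suc n) 0 0 = lin (Suc r) 0 0 0"
  by (simp_all add: lin_def algebra_simps)

lemma lin_group: "b' < b \<Longrightarrow> b \<le> n \<Longrightarrow> k' \<le> states \<Longrightarrow> u' < u \<Longrightarrow> lin r u' b' k' < lin r u b k"
proof -
  assume a: "b' < b" "b \<le> n" "k' \<le> states" "u' < u"
  have "r * (n + 1) + u' \<le> r * (n + 1) + u" using a by simp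
  then have "(r * (n + 1) + u') * (n + 1) \<le> (r * (n + 1) + u) * (n + 1)" by (rule mult_right_mono) simp
  then have "(r * (n + 1) + u') * (n + 1) + b' < (r * (n + 1) + u) * (n + 1) + b" using a by linarith
  then have "lin r u' b' k' < ((r * (n + 1) + u) * (n + 1) + b) * (states + 1)"
    unfolding lin_def using a by (intro mat_less) auto
  then show ?thesis by (simp add: lin_def)
qed

lemma lin_job: "u' \<le> n \<Longrightarrow> b' \<le> n \<Longrightarrow> k' \<le> states \<Longrightarrow> lin r u' b' k' < lin (Suc r) u b k"
proof -
  assume a: "u' \<le> n" "b' \<le> n" "k' \<le> states"
  have "lin r u' b' k' < (r + 1) * (n + 1) * (n + 1) * (states + 1)"
    unfolding lin_def using a by (intro mat_less) auto
  also have "\<dots> = lin (Suc r) 0 0 0" by (simp add: lin_def)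
  also have "\<dots> \<le> lin (Suc r) u b k" unfolding lin_def by (intro add_mono mult_right_mono) auto
  finally show ?thesis .
qed

text \<open>
  The states for which the table is claimed to be correct. With all jobs remaining there is no
  last considered job, and thus no length of pending ones.
\<close>

definition valid_state :: "nat \<Rightarrow> nat \<Rightarrow> nat \<Rightarrow> bool" where
  "valid_state r u b \<longleftrightarrow> r \<le> N \<and> u \<le> n \<and> b \<le> u \<and> (r < N \<or> b = 0)"

definition table_ok :: "(nat \<Rightarrow> real) \<Rightarrow> nat \<Rightarrow> bool" where
  "table_ok h c \<longleftrightarrow> (\<forall>r u b k. valid_state r u b \<and> k \<le> states \<and> lin r u b k < c \<longrightarrow>
     h (cell r u b k) = fst (dp r u b k) \<and> h (cell r u b k + 1) = fst (snd (dp r u b k)) \<and>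
     h (cell r u b k + 2) = real (snd (snd (dp r u b k))))"

definition cell_val :: "(nat \<Rightarrow> real) \<Rightarrow> real \<Rightarrow> real \<Rightarrow> real \<Rightarrow> real \<Rightarrow> real" where
  "cell_val f r u b k = f 19 + 3 * (((r * (f 5 + 1) + u) * (f 5 + 1) + b) * (f 8 + 1) + k)"

lemma expr_cell[simp]:
  "expr_val (cell_expr r u b k) s = cell_val (regs s) (expr_val r s) (expr_val u s) (expr_val b s) (expr_val k s)"
  "expr_ok M (cell_expr r u b k) s \<longleftrightarrow> expr_ok M r s \<and> expr_ok M u s \<and> expr_ok M b s \<and> expr_ok M k s"
  by (simp_all add: cell_expr_def cell_val_def)

lemma cell_val:
  assumes "all_regs f"
  shows "cell_val f (real r) (real u) (real b) (real k) = real (cell r u b k)"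
  using all_regsD[OF assms] by (simp add: cell_val_def cell_def lin_def algebra_simps)

lemma cell_val_simps[simp]:
  assumes "all_regs f"
  shows "cell_val f (real r) (real u) (real b) (real k) = real (cell r u b k)"
    "cell_val f (real r) (real u) (real b) 0 = real (cell r u b 0)"
    "cell_val f (real r) (real u) (real b + 1) (real k) = real (cell r u (Suc b) k)"
    "cell_val f (real r) (real u) 0 0 = real (cell r u 0 0)"
  using cell_val[OF assms, of r u b k] cell_val[OF assms, of r u b 0] cell_val[OF assms, of r u "Suc b" k]
    cell_val[OF assms, of r u 0 0]
  by (simp_all add: add.commute)

definition at_state :: "(nat \<Rightarrow> real) \<Rightarrow> nat \<Rightarrow> nat \<Rightarrow> nat \<Rightarrow> nat \<Rightarrow> bool" where
  "at_state f r u b k \<longleftrightarrow> all_regs f \<and> f 20 = real r \<and> f 21 = real u \<and> f 22 = real b \<and> f 23 = real k"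

lemma at_state_upd[simp]: "24 \<le> x \<Longrightarrow> at_state (f(x := v)) r u b k = at_state f r u b k"
  by (simp add: at_state_def)

definition entry_regs :: "(nat \<Rightarrow> real) \<Rightarrow> entry \<Rightarrow> bool" where
  "entry_regs f c \<longleftrightarrow> f 25 = fst c \<and> f 26 = fst (snd c) \<and> f 27 = real (snd (snd c))"

lemma entry_regs_upd[simp]: "x < 25 \<or> 27 < x \<Longrightarrow> entry_regs (f(x := v)) c = entry_regs f c"
  by (auto simp: entry_regs_def)

text \<open>
  The registers that \<open>offer_candidate\<close> and \<open>try_machine\<close> do not change.
\<close>

definition agree :: "(nat \<Rightarrow> real) \<Rightarrow> (nat \<Rightarrow> real) \<Rightarrow> bool" where
  "agree f g \<longleftrightarrow> (\<forall>x. x < 25 \<or> 27 < x \<and> x \<le> 32 \<or> 36 \<le> x \<and> x \<le> 37 \<or> x = 40 \<longrightarrow> f x = g x)"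

lemma agreeD: "agree f g \<Longrightarrow> x < 25 \<or> 27 < x \<and> x \<le> 32 \<or> 36 \<le> x \<and> x \<le> 37 \<or> x = 40 \<Longrightarrow> f x = g x"
  by (auto simp: agree_def)

lemma agree_refl[simp]: "agree f f" by (simp add: agree_def)

lemma agree_trans: "agree f g \<Longrightarrow> agree g h \<Longrightarrow> agree f h" by (simp add: agree_def)

lemma agree_at_state: "agree f g \<Longrightarrow> at_state f r u b k = at_state g r u b k"
  by (simp add: agree_def at_state_def all_regs_def base_regs_def params_def)

lemma line_offer:
  assumes "entry_regs (regs s) cur" "regs s 41 = real d"
    and "\<And>f. entry_regs f (offer (regs s 38) (regs s 39) d cur) \<Longrightarrow> agree f (regs s) \<Longrightarrow> Q (s\<lparr>regs := f\<rparr>)"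
  shows "line M offer_candidate Q s"
proof (cases "snd (snd cur) = 0 \<or> regs s 38 < fst cur \<or> regs s 38 = fst cur \<and> regs s 39 < fst (snd cur)")
  case True
  have "Q (s\<lparr>regs := (regs s)(25 := regs s 38, 26 := regs s 39, 27 := regs s 41)\<rparr>)"
    by (rule assms(3)) (use True assms(2) in \<open>auto simp: offer_def entry_regs_def agree_def\<close>)
  then show ?thesis
    using True assms(1) by (auto simp: offer_candidate_def entry_regs_def)
next
  case False
  have "Q (s\<lparr>regs := regs s\<rparr>)"
    by (rule assms(3)) (use False assms(1) in \<open>auto simp: offer_def\<close>)
  then show ?thesis
    using False assms(1) by (auto simp: offer_candidate_def entry_regs_def not_less)
qed

lemma group_end_test:
  assumes "at_state (regs s) r u b k" "static (heap s)" "r < N \<or> b = 0"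
    and Q: "Q (set_reg s 30 (if 0 < b \<and> \<not> same_group r then 1 else 0))"
  shows "line aEND group_end_test Q s"
proof -
  have R: "all_regs (regs s)" "regs s 20 = real r" "regs s 22 = real b" using assms by (auto simp: at_state_def)
  note R' = all_regsD[OF R(1)]
  show ?thesis
  proof (cases "0 < b")
    case False
    then show ?thesis using Q R by (simp add: group_end_test_def)
  next
    case True
    then have rN: "r < N" using assms(3) by simp
    show ?thesis
    proof (cases r)
      case 0
      then show ?thesis using Q R True by (simp add: group_end_test_def same_group_def)
    next
      case (Suc r')
      have "heap s (aSP + r') = real (p (ord r'))" "heap s (aSP + Suc r') = real (p (ord (Suc r')))"
        using static_at(2)[OF assms(2), of r'] static_at(2)[OF assms(2), of "Suc r'"] rN Suc by auto
      then show ?thesis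
        using Q R R' True Suc rN bounds(2)[of r'] bounds(2)[of "Suc r'"]
        by (auto simp: group_end_test_def same_group_def is_address_iff)
    qed
  qed
qed

definition next_ok :: "(nat \<Rightarrow> real) \<Rightarrow> nat \<Rightarrow> (nat \<Rightarrow> entry) \<Rightarrow> bool" where
  "next_ok h a nxt \<longleftrightarrow> (\<forall>k\<le>states. a + 3 * k + 1 < aEND \<and> h (a + 3 * k) = fst (nxt k) \<and> h (a + 3 * k + 1) = fst (snd (nxt k)))"

lemma next_okI:
  assumes "table_ok h c" "valid_state r u b" "\<And>k. k \<le> states \<Longrightarrow> lin r u b k < c"
  shows "next_ok h (cell r u b 0) (dp r u b)"
  unfolding next_ok_def
proof (intro allI impI)
  fix k assume k: "k \<le> states"
  have e: "cell r u b k = cell r u b 0 + 3 * k" by (simp add: cell_def lin_def)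
  have "b \<le> n" "u \<le> n" "r \<le> N" using assms(2) by (auto simp: valid_state_def)
  then have "cell r u b k + 1 < aEND" using cell_bounds k by simp
  then show "cell r u b 0 + 3 * k + 1 < aEND \<and> h (cell r u b 0 + 3 * k) = fst (dp r u b k) \<and>
      h (cell r u b 0 + 3 * k + 1) = fst (snd (dp r u b k))"
    using assms k unfolding table_ok_def e[symmetric] by blast
qed

definition loop_regs :: "(nat \<Rightarrow> real) \<Rightarrow> (nat \<Rightarrow> real) \<Rightarrow> (nat \<Rightarrow> entry) \<Rightarrow> nat \<Rightarrow> nat \<Rightarrow> (real \<Rightarrow> bool) \<Rightarrow> bool" where
  "loop_regs h f nxt q u ok \<longleftrightarrow> (\<exists>a. f 29 = real a \<and> next_ok h a nxt) \<and> f 28 = real q \<and>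
     0 < u \<and> u \<le> n \<and> f 36 = real (u - 1) \<and> (\<forall>c. ok c \<longleftrightarrow> f 32 < 1 \<or> c \<le> f 31)"

lemma loop_regs_upd[simp]:
  assumes "x < 28 \<or> x = 30 \<or> 32 < x \<and> x < 36 \<or> 36 < x"
  shows "loop_regs h (f(x := v)) nxt q u ok = loop_regs h f nxt q u ok"
proof -
  have "x \<noteq> 28" "x \<noteq> 29" "x \<noteq> 31" "x \<noteq> 32" "x \<noteq> 36" using assms by auto
  then show ?thesis by (simp add: loop_regs_def)
qed

lemma agree_loop_regs:
  assumes "agree f g"
  shows "loop_regs h f nxt q u ok = loop_regs h g nxt q u ok"
proof -
  have "f 28 = g 28" "f 29 = g 29" "f 31 = g 31" "f 32 = g 32" "f 36 = g 36"
    using agreeD[OF assms] by simp_all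
  then show ?thesis by (simp add: loop_regs_def)
qed

text \<open>
  Either the entry is complete, or it remains to run the loop over the machines from the best
  entry \<open>c\<close> found so far.
\<close>

definition prepared :: "(nat \<Rightarrow> real) \<Rightarrow> (nat \<Rightarrow> real) \<Rightarrow> nat \<Rightarrow> nat \<Rightarrow> nat \<Rightarrow> nat \<Rightarrow> bool" where
  "prepared h f r u b k \<longleftrightarrow> at_state f r u b k \<and> f 37 = real (cell r u b k) \<and>
    (f 30 = 0 \<and> (\<exists>c. entry_regs f c \<and> (valid_state r u b \<longrightarrow> c = dp r u b k)) \<or>
     f 30 = 1 \<and> k < states \<and> (\<exists>c nxt q ok. entry_regs f c \<and> loop_regs h f nxt q u ok \<and>
       dp r u b k = try_machines nxt q u ok k c m))"

lemma prepared_loopI: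
  "\<lbrakk>at_state f r u b k; f 37 = real (cell r u b k); f 30 = 1; k < states; entry_regs f c;
    loop_regs h f nxt q u ok; dp r u b k = try_machines nxt q u ok k c m\<rbrakk> \<Longrightarrow> prepared h f r u b k"
  unfolding prepared_def by blast

lemma prepare_flush:
  assumes st: "at_state (regs s) r u b k" "static (heap s)" "table_ok (heap s) (lin r u b k)"
    and v: "valid_state r u b" "k < states" and fl: "0 < b" "\<not> same_group r"
    and c: "regs s 37 = real (cell r u b k)" "entry_regs (regs s) (0, 0, 0)"
  shows "line aEND prepare_flush (\<lambda>s'. heap s' = heap s \<and> prepared (heap s) (regs s') r u b k) s"
proof -
  obtain b' u' where bu: "b = Suc b'" "u = Suc u'"
    using fl v by (cases b; cases u) (auto simp: valid_state_def)
  have rN: "r < N" using v fl by (auto simp: valid_state_def)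
  have R: "all_regs (regs s)" "regs s 20 = real r" "regs s 21 = real u" "regs s 22 = real b" "regs s 23 = real k"
    using st by (auto simp: at_state_def)
  have nx: "next_ok (heap s) (cell r u' b' 0) (dp r u' b')"
    by (rule next_okI[OF st(3)]) (use v bu in \<open>auto simp: valid_state_def intro: lin_group\<close>)
  have d: "dp r u b k = try_machines (dp r u' b') (p (ord r)) u (\<lambda>_. True) k (0, 0, 0) m"
    using dp_flush[OF fl, of u] v bu by (simp add: flush_entry_def)
  have "prepared (heap s) ((regs s)(28 := real (p (ord r)), 36 := real u', 29 := real (cell r u' b' 0),
      30 := 1, 32 := 0)) r u b k"
    by (rule prepared_loopI[where c = "(0, 0, 0)" and nxt = "dp r u' b'" and q = "p (ord r)" and ok = "\<lambda>_. True"])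
      (use st c nx v bu d in \<open>auto simp: loop_regs_def valid_state_def\<close>)
  then show ?thesis
    using R all_regsD[OF R(1)] static_at(2)[OF st(2) rN] rN bu
    by (simp add: prepare_flush_def is_address_iff)
qed

lemma offer_skip:
  assumes st: "at_state (regs s) (Suc r) u b k" "table_ok (heap s) (lin (Suc r) u b k)"
    and v: "valid_state (Suc r) u b" "k < states" "regs s 40 = real r"
    and e: "entry_regs (regs s) (0, 0, 0)"
  shows "line aEND offer_skip (\<lambda>s'. heap s' = heap s \<and> agree (regs s') (regs s) \<and> entry_regs (regs s')
    (if u \<le> b + r then offer (fst (dp r u b k)) (fst (snd (dp r u b k))) 1 (0, 0, 0) else (0, 0, 0))) s"
proof (cases "u \<le> b + r")
  case False
  then show ?thesis using st v e by (simp add: offer_skip_def at_state_def)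
next
  case True
  have v': "valid_state r u b" using v by (auto simp: valid_state_def)
  then have un: "u \<le> n" "b \<le> n" "r \<le> N" by (auto simp: valid_state_def)
  have "heap s (cell r u b k) = fst (dp r u b k)" "heap s (cell r u b k + 1) = fst (snd (dp r u b k))"
    using st(2) v' v lin_job[of u b k r u b k] un by (auto simp: table_ok_def)
  moreover have "cell r u b k < aEND" "cell r u b k + 1 < aEND" using cell_bounds un v by auto
  moreover have "all_regs (regs s)" "regs s 21 = real u" "regs s 22 = real b" "regs s 23 = real k"
    using st by (auto simp: at_state_def)
  ultimately show ?thesis
    using True v e unfolding offer_skip_def
    by (simp add: is_address_iff) (rule line_offer[where cur = "(0, 0, 0)" and d = 1]; simp add: agree_def)
qed

lemma offer_tardy:
  assumes st: "at_state (regs s) (Suc r) u b k" "static (heap s)" "table_ok (heap s) (lin (Suc r) u b k)"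
    and v: "valid_state (Suc r) u b" "k < states" "regs s 40 = real r" and bu: "b < u"
    and e: "entry_regs (regs s) c1"
  shows "line aEND offer_tardy (\<lambda>s'. heap s' = heap s \<and> agree (regs s') (regs s) \<and> entry_regs (regs s')
    (offer (fst (dp r u (b + 1) k)) (fst (snd (dp r u (b + 1) k)) + weight P (ord r)) 2 c1)) s"
proof -
  have v': "valid_state r u (Suc b)" using v bu by (auto simp: valid_state_def)
  then have un: "u \<le> n" "Suc b \<le> n" "r < N" by (auto simp: valid_state_def)
  have "heap s (cell r u (Suc b) k) = fst (dp r u (Suc b) k)" "heap s (cell r u (Suc b) k + 1) = fst (snd (dp r u (Suc b) k))"
    using st(3) v' v lin_job[of u "Suc b" k r u b k] un by (auto simp: table_ok_def)
  moreover have "cell r u (Suc b) k < aEND" "cell r u (Suc b) k + 1 < aEND" using cell_bounds un v by auto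
  moreover have R: "all_regs (regs s)" "regs s 21 = real u" "regs s 22 = real b" "regs s 23 = real k"
    using st by (auto simp: at_state_def)
  ultimately show ?thesis
    using v e un static_at(3)[OF st(2) un(3)] all_regsD[OF R(1)] unfolding offer_tardy_def
    by (simp add: is_address_iff) (rule line_offer[where cur = c1 and d = 2]; simp add: agree_def)
qed


lemma prepared_idleI:
  "\<lbrakk>at_state f r u b k; f 37 = real (cell r u b k); f 30 = 0; entry_regs f c; valid_state r u b \<Longrightarrow> c = dp r u b k\<rbrakk>
    \<Longrightarrow> prepared h f r u b k"
  unfolding prepared_def by blast

lemma prepare_early:
  assumes st: "at_state (regs s) (Suc r) u b k" "static (heap s)" "table_ok (heap s) (lin (Suc r) u b k)"
    and v: "valid_state (Suc r) u b" "k < states" "regs s 40 = real r" "b < u"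
    and c: "regs s 37 = real (cell (Suc r) u b k)" "entry_regs (regs s) c"
    and d: "dp (Suc r) u b k = try_machines (dp r (u - 1) b) (p (ord r)) u (\<lambda>c. c \<le> due P (ord r)) k c m"
  shows "line aEND prepare_early (\<lambda>s'. heap s' = heap s \<and> prepared (heap s) (regs s') (Suc r) u b k) s"
proof -
  obtain u' where u: "u = Suc u'" using v by (cases u) auto
  have rN: "r < N" using v by (auto simp: valid_state_def)
  have R: "all_regs (regs s)" "regs s 21 = real u" "regs s 22 = real b"
    using st by (auto simp: at_state_def)
  have v': "valid_state r u' b" using v u by (auto simp: valid_state_def)
  have nx: "next_ok (heap s) (cell r u' b 0) (dp r u' b)"
    by (rule next_okI[OF st(3) v']) (use v' in \<open>auto simp: valid_state_def intro!: lin_job\<close>)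
  have "prepared (heap s) ((regs s)(28 := real (p (ord r)), 31 := due P (ord r), 32 := 1, 36 := real u',
      29 := real (cell r u' b 0), 30 := 1)) (Suc r) u b k"
    by (rule prepared_loopI[where c = c and nxt = "dp r u' b" and q = "p (ord r)" and ok = "\<lambda>c. c \<le> due P (ord r)"])
      (use st c nx v u d in \<open>auto simp: loop_regs_def valid_state_def\<close>)
  then show ?thesis
    using R all_regsD[OF R(1)] static_at(2,4)[OF st(2) rN] rN u v(3)
    by (simp add: prepare_early_def is_address_iff)
qed

lemma prepare_job:
  assumes st: "at_state (regs s) (Suc r) u b k" "static (heap s)" "table_ok (heap s) (lin (Suc r) u b k)"
    and v: "valid_state (Suc r) u b" "k < states" and nf: "b = 0 \<or> same_group (Suc r)"
    and c: "regs s 37 = real (cell (Suc r) u b k)" "entry_regs (regs s) (0, 0, 0)" "regs s 30 = 0"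
  shows "line aEND prepare_job (\<lambda>s'. heap s' = heap s \<and> prepared (heap s) (regs s') (Suc r) u b k) s"
proof -
  define c1 where "c1 = (if u \<le> b + r then offer (fst (dp r u b k)) (fst (snd (dp r u b k))) 1 (0, 0, 0) else (0, 0, 0))"
  define c2 where "c2 = offer (fst (dp r u (b + 1) k)) (fst (snd (dp r u (b + 1) k)) + weight P (ord r)) 2 c1"
  have d: "dp (Suc r) u b k = (if b < u then try_machines (dp r (u - 1) b) (p (ord r)) u (\<lambda>c. c \<le> due P (ord r)) k c2 m else c1)"
    unfolding dp_job[OF nf] using v(2) by (simp add: job_entry_def Let_def c1_def c2_def)
  let ?s = "set_reg s 40 (real r)"
  have 1: "line aEND offer_skip (\<lambda>s'. heap s' = heap ?s \<and> agree (regs s') (regs ?s) \<and> entry_regs (regs s') c1) ?s"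
    unfolding c1_def by (rule offer_skip) (use st v c in auto)
  have "line aEND offer_skip (line aEND (If (Less (Reg 22) (Reg 21)) (Seq offer_tardy prepare_early) Skip)
      (\<lambda>s'. heap s' = heap s \<and> prepared (heap s) (regs s') (Suc r) u b k)) ?s"
  proof (rule line_mono[OF 1])
    fix s1 :: state assume s1: "heap s1 = heap ?s \<and> agree (regs s1) (regs ?s) \<and> entry_regs (regs s1) c1"
    then have h1: "heap s1 = heap s" and e1: "entry_regs (regs s1) c1" and ag: "agree (regs s1) (regs ?s)" by auto
    have a1: "at_state (regs s1) (Suc r) u b k" using agree_at_state[OF ag] st(1) by simp
    have r1: "regs s1 37 = real (cell (Suc r) u b k)" "regs s1 30 = 0" "regs s1 40 = real r"
      using agreeD[OF ag, of 37] agreeD[OF ag, of 30] agreeD[OF ag, of 40] c by simp_all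
    have ub: "regs s1 21 = real u" "regs s1 22 = real b" using a1 by (auto simp: at_state_def)
    show "line aEND (If (Less (Reg 22) (Reg 21)) (Seq offer_tardy prepare_early) Skip)
      (\<lambda>s'. heap s' = heap s \<and> prepared (heap s) (regs s') (Suc r) u b k) s1"
    proof (cases "b < u")
      case False
      then have "c1 = dp (Suc r) u b k" using d by simp
      then have "prepared (heap s) (regs s1) (Suc r) u b k" using prepared_idleI[OF a1 r1(1,2) e1] by simp
      then show ?thesis using False ub h1 by simp
    next
      case True
      have 2: "line aEND offer_tardy (\<lambda>s'. heap s' = heap s1 \<and> agree (regs s') (regs s1) \<and> entry_regs (regs s') c2) s1"
        unfolding c2_def by (rule offer_tardy) (use a1 h1 st v r1 True e1 in auto)
      have "line aEND offer_tardy (line aEND prepare_early (\<lambda>s'. heap s' = heap s \<and> prepared (heap s) (regs s') (Suc r) u b k)) s1"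
      proof (rule line_mono[OF 2])
        fix s2 :: state assume s2: "heap s2 = heap s1 \<and> agree (regs s2) (regs s1) \<and> entry_regs (regs s2) c2"
        then have h2: "heap s2 = heap s" and e2: "entry_regs (regs s2) c2" and ag2: "agree (regs s2) (regs s1)"
          using h1 by auto
        have a2: "at_state (regs s2) (Suc r) u b k" using agree_at_state[OF ag2] a1 by simp
        have r2: "regs s2 37 = real (cell (Suc r) u b k)" "regs s2 40 = real r"
          using agreeD[OF ag2, of 37] agreeD[OF ag2, of 40] r1 by simp_all
        show "line aEND prepare_early (\<lambda>s'. heap s' = heap s \<and> prepared (heap s) (regs s') (Suc r) u b k) s2"
          using prepare_early[OF a2 _ _ v r2(2) True r2(1) e2] st h2 d True by simp
      qed
      then show ?thesis using True ub by simp
    qed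
  qed
  then show ?thesis
    using st(1) by (simp add: prepare_job_def at_state_def)
qed

lemma dp_full: "\<not> k < states \<Longrightarrow> dp r u b k = (0, 0, 0)"
  by (subst dp.simps) (simp add: flush_entry_def job_entry_def)

lemma prepare_entry:
  assumes st: "at_state (regs s) r u b k" "static (heap s)" "table_ok (heap s) (lin r u b k)"
    and le: "r \<le> N" "u \<le> n"
  shows "line aEND prepare_entry (\<lambda>s'. heap s' = heap s \<and> prepared (heap s) (regs s') r u b k) s"
proof -
  have R: "all_regs (regs s)" "regs s 20 = real r" "regs s 21 = real u" "regs s 22 = real b" "regs s 23 = real k"
    using st by (auto simp: at_state_def)
  note R' = all_regsD[OF R(1)]
  let ?f = "(regs s)(37 := real (cell r u b k), 25 := 0, 26 := 0, 27 := 0, 30 := 0)"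
  let ?s = "s\<lparr>regs := ?f\<rparr>"
  have a: "at_state ?f r u b k" using st by simp
  have e: "entry_regs ?f (0, 0, 0)" by (simp add: entry_regs_def)
  let ?Q = "\<lambda>s'. heap s' = heap s \<and> prepared (heap s) (regs s') r u b k"
  have "line aEND (If (And (And (Less (Reg 23) xS) (Leq (Reg 22) (Reg 21))) (Or (Less (Reg 20) xN) (Less (Reg 22) (Lit 1))))
       (Seq group_end_test
         (If (Less (Lit 0) (Reg 30)) prepare_flush
           (If (Less (Lit 0) (Reg 20)) prepare_job Skip))) Skip) ?Q ?s"
  proof (cases "k < states \<and> valid_state r u b")
    case False
    have "prepared (heap s) ?f r u b k"
      by (rule prepared_idleI[OF a _ _ e]) (use False dp_full[of k r u b] in auto)
    moreover have "\<not> (k < states \<and> b \<le> u \<and> (r < N \<or> b < 1))" using False le by (auto simp: valid_state_def)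
    ultimately show ?thesis using R R' by (auto simp: not_less)
  next
    case True
    then have k: "k < states" and v: "valid_state r u b" by auto
    then have c: "b \<le> u" "r < N \<or> b = 0" by (auto simp: valid_state_def)
    have "line aEND group_end_test (line aEND (If (Less (Lit 0) (Reg 30)) prepare_flush
           (If (Less (Lit 0) (Reg 20)) prepare_job Skip)) ?Q) ?s"
    proof (rule group_end_test[where r = r and u = u and b = b and k = k])
      let ?g = "(regs s)(37 := real (cell r u b k), 25 := 0, 26 := 0, 27 := 0, 30 := if 0 < b \<and> \<not> same_group r then 1 else 0)"
      let ?t = "s\<lparr>regs := ?g\<rparr>"
      have t: "set_reg ?s 30 (if 0 < b \<and> \<not> same_group r then 1 else 0) = ?t" by simp
      show "line aEND (If (Less (Lit 0) (Reg 30)) prepare_flush (If (Less (Lit 0) (Reg 20)) prepare_job Skip)) ?Q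
          (set_reg ?s 30 (if 0 < b \<and> \<not> same_group r then 1 else 0))"
        unfolding t
      proof (cases "0 < b \<and> \<not> same_group r")
        case True
        have "line aEND prepare_flush (\<lambda>s'. heap s' = heap ?t \<and> prepared (heap ?t) (regs s') r u b k) ?t"
          by (rule prepare_flush) (use st k v True in \<open>auto simp: entry_regs_def\<close>)
        then show "line aEND (If (Less (Lit 0) (Reg 30)) prepare_flush (If (Less (Lit 0) (Reg 20)) prepare_job Skip)) ?Q ?t"
          using True by simp
      next
        case False
        show "line aEND (If (Less (Lit 0) (Reg 30)) prepare_flush (If (Less (Lit 0) (Reg 20)) prepare_job Skip)) ?Q ?t"
        proof (cases r)
          case 0
          then have b0: "b = 0" using False by (simp add: same_group_def)
          have "dp r u b k = (0, 0, 0)" using 0 b0 by (simp add: dp_done)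
          then have "prepared (heap s) ?g r u b k"
            by (intro prepared_idleI[where c = "(0, 0, 0)"]) (use False st(1) in \<open>auto simp: entry_regs_def\<close>)
          then show ?thesis using b0 R 0 by simp
        next
          case (Suc r')
          have "line aEND prepare_job (\<lambda>s'. heap s' = heap ?t \<and> prepared (heap ?t) (regs s') (Suc r') u b k) ?t"
            by (rule prepare_job) (use st k v False Suc in \<open>auto simp: entry_regs_def\<close>)
          then show ?thesis using False R Suc by auto
        qed
      qed
    qed (use a st c in auto)
    then show ?thesis using R R' k c by (auto simp: not_less)
  qed
  then show ?thesis
    using R by (simp add: prepare_entry_def)
qed

lemma try_machine:
  assumes st: "at_state (regs s) r u b k" "static (heap s)" "k < states"
    and l: "loop_regs (heap s) (regs s) nxt q u ok" "regs s 24 = real i" "i < m"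
    and e: "entry_regs (regs s) (try_machines nxt q u ok k c i)"
  shows "line aEND try_machine (\<lambda>s'. heap s' = heap s \<and> agree (regs s') (regs s) \<and>
     entry_regs (regs s') (try_machines nxt q u ok k c (Suc i))) s"
proof -
  obtain a where a: "regs s 29 = real a" "next_ok (heap s) a nxt" and q: "regs s 28 = real q"
    and u: "0 < u" "u \<le> n" "regs s 36 = real (u - 1)" and ok: "\<And>c. ok c \<longleftrightarrow> regs s 32 < 1 \<or> c \<le> regs s 31"
    using l(1) by (auto simp: loop_regs_def)
  have R: "all_regs (regs s)" "regs s 23 = real k" using st by (auto simp: at_state_def)
  note R' = all_regsD[OF R(1)]
  have mem: "heap s (aSPD + i) = V i" "heap s (aPW + i) = real T ^ i" "heap s (aDG + k * m + i) = real (digit k i)"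
    "heap s (aCC + (u - 1)) = coef P (u - 1)"
    using static_at(5,6,8)[OF st(2)] static_at(7)[OF st(2), of "u - 1"] st(3) l(3) u by simp_all
  obtain u' where u': "u = Suc u'" using u(1) by (cases u) auto
  have bd: "aDG + k * m + i < aEND"
    using mat_less[OF st(3) l(3)] bounds(11)[of "aDG + k * m + i"] by (simp add: aTB_def)
  have un: "u - 1 < n" using u by simp
  define k' where "k' = k + q * T ^ i"
  define f1 where "f1 = (regs s)(35 := real k')"
  have f1: "line aEND (Assign 35 (Add (Reg 23) (Mul (Reg 28) (At xPW (Reg 24))))) Q s = Q (s\<lparr>regs := f1\<rparr>)" for Q
    using R R' mem l q by (simp add: f1_def k'_def is_address_iff)
  show ?thesis
    unfolding try_machine_def line.simps(4) f1
  proof (cases "k' \<le> states")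
    case False
    then have "try_machines nxt q u ok k c (Suc i) = try_machines nxt q u ok k c i"
      by (simp add: k'_def)
    then show "line aEND (If (Leq (Reg 35) xS)
       (Seq (Assign 34 (Div (Add (Mem (Add (Add xDG (Mul (Reg 23) xm)) (Reg 24))) (Reg 28)) (At xSPD (Reg 24))))
         (If (Or (Less (Reg 32) (Lit 1)) (Leq (Reg 34) (Reg 31)))
           (block [Assign 33 (Add (Reg 29) (Mul (Lit 3) (Reg 35))),
              Assign 38 (Sub (Add (Mem (Reg 33)) (Reg 34)) (Mul (Reg 28) (At xCC (Reg 36)))),
              Assign 39 (At (Reg 33) (Lit 1)), Assign 41 (Add (Reg 24) (Lit 3)),
              offer_candidate]) Skip)) Skip) (\<lambda>s'. heap s' = heap s \<and> agree (regs s') (regs s) \<and>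
       entry_regs (regs s') (try_machines nxt q u ok k c (Suc i))) (s\<lparr>regs := f1\<rparr>)"
      using False R' e by (simp add: f1_def agree_def)
  next
    case True
    let ?c = "ending q k i"
    have nx: "a + 3 * k' + 1 < aEND" "heap s (a + 3 * k') = fst (nxt k')" "heap s (a + 3 * k' + 1) = fst (snd (nxt k'))"
      using a(2) True by (auto simp: next_ok_def)
    define f2 where "f2 = f1(34 := ?c)"
    have f2: "line aEND (Assign 34 (Div (Add (Mem (Add (Add xDG (Mul (Reg 23) xm)) (Reg 24))) (Reg 28)) (At xSPD (Reg 24)))) Q
       (s\<lparr>regs := f1\<rparr>) = Q (s\<lparr>regs := f2\<rparr>)" for Q
      using R R' mem l q bd by (simp add: f1_def f2_def is_address_iff ending_def)
    have in2: "(if cond_val (Leq (Reg 35) xS) (s\<lparr>regs := f1\<rparr>) then A else B) = A" for A B :: bool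
      using True R' by (simp add: f1_def)
    have ok2: "cond_val (Or (Less (Reg 32) (Lit 1)) (Leq (Reg 34) (Reg 31))) (s\<lparr>regs := f2\<rparr>) = ok ?c"
      by (auto simp: f2_def f1_def ok not_less)
    let ?Q = "\<lambda>s'. heap s' = heap s \<and> agree (regs s') (regs s) \<and>
       entry_regs (regs s') (try_machines nxt q u ok k c (Suc i))"
    let ?B = "block [Assign 33 (Add (Reg 29) (Mul (Lit 3) (Reg 35))),
              Assign 38 (Sub (Add (Mem (Reg 33)) (Reg 34)) (Mul (Reg 28) (At xCC (Reg 36)))),
              Assign 39 (At (Reg 33) (Lit 1)), Assign 41 (Add (Reg 24) (Lit 3)),
              offer_candidate]"
    have "if ok ?c then line aEND ?B ?Q (s\<lparr>regs := f2\<rparr>) else ?Q (s\<lparr>regs := f2\<rparr>)"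
    proof (cases "ok ?c")
      case False
      then have "try_machines nxt q u ok k c (Suc i) = try_machines nxt q u ok k c i" by (simp add: Let_def)
      then show ?thesis using False e by (simp add: f2_def f1_def agree_def)
    next
      case True
      let ?e = "fst (nxt k') + ?c - real q * coef P (u - 1)"
      let ?f = "f2(33 := real (a + 3 * k'), 38 := ?e, 39 := fst (snd (nxt k')), 41 := real (i + 3))"
      have off: "try_machines nxt q u ok k c (Suc i) = offer ?e (fst (snd (nxt k'))) (i + 3) (try_machines nxt q u ok k c i)"
        using True \<open>k' \<le> states\<close> by (simp add: k'_def Let_def)
      have "line aEND offer_candidate ?Q (s\<lparr>regs := ?f\<rparr>)"
      proof (rule line_offer[where cur = "try_machines nxt q u ok k c i" and d = "i + 3"])
        fix f assume "entry_regs f (offer (regs (s\<lparr>regs := ?f\<rparr>) 38) (regs (s\<lparr>regs := ?f\<rparr>) 39) (i + 3) (try_machines nxt q u ok k c i))"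
          "agree f (regs (s\<lparr>regs := ?f\<rparr>))"
        moreover have "agree ?f (regs s)" by (simp add: agree_def f2_def f1_def)
        ultimately show "?Q (s\<lparr>regs := ?f\<rparr>\<lparr>regs := f\<rparr>)"
          unfolding off using agree_trans by fastforce
      qed (use e in \<open>simp_all add: f2_def f1_def\<close>)
      moreover have "line aEND ?B ?Q (s\<lparr>regs := f2\<rparr>) = line aEND offer_candidate ?Q (s\<lparr>regs := ?f\<rparr>)"
        using R R' a(1) q u(3) l(2) nx mem bounds(8)[OF un] u' by (simp add: f2_def f1_def is_address_iff)
      ultimately show ?thesis using True by simp
    qed
    then show "line aEND (If (Leq (Reg 35) xS)
       (Seq (Assign 34 (Div (Add (Mem (Add (Add xDG (Mul (Reg 23) xm)) (Reg 24))) (Reg 28)) (At xSPD (Reg 24))))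
         (If (Or (Less (Reg 32) (Lit 1)) (Leq (Reg 34) (Reg 31))) ?B Skip)) Skip) ?Q (s\<lparr>regs := f1\<rparr>)"
      unfolding line.simps(5) in2 line.simps(4) f2 ok2 line.simps(1) by simp
  qed
qed

abbreviation "entry_time \<equiv> line_cost prepare_entry + (3 + (m * (line_cost try_machine + 7) + 5) + line_cost store_entry)"

lemma store_entry_ok:
  assumes "table_ok h (lin r u b k)" "u \<le> n" "b \<le> n" "k \<le> states" "valid_state r u b \<longrightarrow> c = dp r u b k"
  shows "table_ok (h(cell r u b k := fst c, cell r u b k + 1 := fst (snd c), cell r u b k + 2 := real (snd (snd c))))
    (lin r u b (Suc k))"
  unfolding table_ok_def
proof (intro allI impI)
  fix r' u' b' k'
  assume a: "valid_state r' u' b' \<and> k' \<le> states \<and> lin r' u' b' k' < lin r u b (Suc k)"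
  let ?h = "h(cell r u b k := fst c, cell r u b k + 1 := fst (snd c), cell r u b k + 2 := real (snd (snd c)))"
  have "u' \<le> n" "b' \<le> n" using a by (auto simp: valid_state_def)
  have "lin r u b (Suc k) = lin r u b k + 1" by (simp add: lin_def)
  then consider "lin r' u' b' k' < lin r u b k" | "lin r' u' b' k' = lin r u b k" using a by linarith
  then show "?h (cell r' u' b' k') = fst (dp r' u' b' k') \<and> ?h (cell r' u' b' k' + 1) = fst (snd (dp r' u' b' k')) \<and>
     ?h (cell r' u' b' k' + 2) = real (snd (snd (dp r' u' b' k')))"
  proof cases
    case 1
    then have "cell r' u' b' k' + 2 < cell r u b k" by (simp add: cell_def)
    then show ?thesis using assms(1) a 1 by (simp add: table_ok_def)
  next
    case 2
    then have "r' = r" "u' = u" "b' = b" "k' = k"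
      using lin_inj[OF 2] \<open>u' \<le> n\<close> \<open>b' \<le> n\<close> assms a by auto
    then show ?thesis using assms(5) a by simp
  qed
qed

lemma table_entry:
  assumes st: "at_state (regs s) r u b k" "static (heap s)" "table_ok (heap s) (lin r u b k)"
    and le: "r \<le> N" "u \<le> n" "b \<le> n" "k \<le> states"
  shows "run aEND table_entry entry_time (\<lambda>s'. at_state (regs s') r u b k \<and> static (heap s') \<and>
    table_ok (heap s') (lin r u b (Suc k))) s"
proof -
  define Q1 :: "state \<Rightarrow> bool" where "Q1 s' \<longleftrightarrow> heap s' = heap s \<and> at_state (regs s') r u b k \<and> regs s' 37 = real (cell r u b k) \<and>
     (\<exists>c. entry_regs (regs s') c \<and> (valid_state r u b \<longrightarrow> c = dp r u b k))" for s'
  let ?Q = "\<lambda>s'. at_state (regs s') r u b k \<and> static (heap s') \<and> table_ok (heap s') (lin r u b (Suc k))"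
  show ?thesis
    unfolding table_entry_def block.simps
  proof (rule run_Seq, rule run_mono[OF run_line[OF prepare_entry[OF st le(1,2)]] order_refl])
    fix s1 :: state assume s1: "heap s1 = heap s \<and> prepared (heap s) (regs s1) r u b k"
    show "run aEND (Seq (If (Less (Lit 0) (Reg 30)) (For 24 xm try_machine) Skip) store_entry)
      (3 + (m * (line_cost try_machine + 7) + 5) + line_cost store_entry) ?Q s1"
    proof (rule run_Seq, rule run_mono[where Q = Q1])
      have "run aEND (If (Less (Lit 0) (Reg 30)) (For 24 xm try_machine) Skip)
         (cond_cost (Less (Lit 0) (Reg 30)) + (m * (line_cost try_machine + 7) + 5)) Q1 s1"
      proof (rule run_If)
        assume "\<not> cond_val (Less (Lit 0) (Reg 30)) s1"
        then have "Q1 s1" using s1 by (auto simp: Q1_def prepared_def)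
        then show "run aEND Skip (m * (line_cost try_machine + 7) + 5) Q1 s1"
          by (intro run_line_le) auto
      next
        assume "cond_val (Less (Lit 0) (Reg 30)) s1"
        then obtain c nxt q ok where k: "k < states" and c: "entry_regs (regs s1) c"
          "loop_regs (heap s) (regs s1) nxt q u ok" "dp r u b k = try_machines nxt q u ok k c m"
          using s1 by (auto simp: prepared_def)
        have s1': "heap s1 = heap s" "at_state (regs s1) r u b k" "regs s1 37 = real (cell r u b k)"
          using s1 by (auto simp: prepared_def)
        show "run aEND (For 24 xm try_machine) (m * (line_cost try_machine + 7) + 5) Q1 s1"
        proof (rule run_For[where n = m and T = "line_cost try_machine" and
          I = "\<lambda>i s'. heap s' = heap s \<and> at_state (regs s') r u b k \<and> regs s' 37 = real (cell r u b k) \<and>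
            loop_regs (heap s) (regs s') nxt q u ok \<and> entry_regs (regs s') (try_machines nxt q u ok k c i)"], goal_cases)
          case 1
          then show ?case using s1' c by simp
        next
          case (2 i s')
          then show ?case using all_regsD[of "regs s'"] by (simp add: at_state_def)
        next
          case (3 i s')
          then have h: "heap s' = heap s" "at_state (regs s') r u b k" "regs s' 37 = real (cell r u b k)"
            "loop_regs (heap s) (regs s') nxt q u ok" "entry_regs (regs s') (try_machines nxt q u ok k c i)"
            and i: "i < m" "regs s' 24 = real i" by auto
          have *: "line aEND try_machine (\<lambda>s''. heap s'' = heap s' \<and> agree (regs s'') (regs s') \<and>
             entry_regs (regs s'') (try_machines nxt q u ok k c (Suc i))) s'"
            by (rule try_machine) (use h i k st in auto)
          show ?case
          proof (rule run_mono[OF run_line[OF *] order_refl])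
            fix s'' :: state assume s'': "heap s'' = heap s' \<and> agree (regs s'') (regs s') \<and>
               entry_regs (regs s'') (try_machines nxt q u ok k c (Suc i))"
            then have ag: "agree (regs s'') (regs s')" by simp
            show "regs s'' 24 = real i \<and> heap (set_reg s'' 24 (real (Suc i))) = heap s \<and>
              at_state (regs (set_reg s'' 24 (real (Suc i)))) r u b k \<and>
              regs (set_reg s'' 24 (real (Suc i))) 37 = real (cell r u b k) \<and>
              loop_regs (heap s) (regs (set_reg s'' 24 (real (Suc i)))) nxt q u ok \<and>
              entry_regs (regs (set_reg s'' 24 (real (Suc i)))) (try_machines nxt q u ok k c (Suc i))"
              using s'' h i agree_at_state[OF ag] agree_loop_regs[OF ag] agreeD[OF ag, of 24] agreeD[OF ag, of 37]
              by (simp del: try_machines.simps)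
          qed
        next
          case (4 s')
          then show ?case using c(3) unfolding Q1_def by metis
        qed simp
      qed simp
      then show "run aEND (If (Less (Lit 0) (Reg 30)) (For 24 xm try_machine) Skip)
         (3 + (m * (line_cost try_machine + 7) + 5)) Q1 s1" by (simp add: eval_nat_numeral)
      fix s2 :: state assume "Q1 s2"
      then obtain c where s2: "heap s2 = heap s" "at_state (regs s2) r u b k" "regs s2 37 = real (cell r u b k)"
        "entry_regs (regs s2) c" "valid_state r u b \<longrightarrow> c = dp r u b k" by (auto simp: Q1_def)
      have tb: "aTB \<le> cell r u b k" by (simp add: cell_def)
      let ?h = "(heap s)(cell r u b k := fst c, cell r u b k + 1 := fst (snd c), cell r u b k + 2 := real (snd (snd c)))"
      have "table_ok ?h (lin r u b (Suc k))" using store_entry_ok[OF st(3) le(2,3,4) s2(5)] .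
      moreover have "static ?h" using st(2) tb by simp
      ultimately show "run aEND store_entry (line_cost store_entry) ?Q s2"
        using s2 cell_bounds[OF le]
        by (intro run_line) (simp add: store_entry_def is_address_iff entry_regs_def)
    qed simp
  qed
qed

abbreviation "table_time \<equiv>
  (N + 1) * ((n + 1) * ((n + 1) * ((states + 1) * (entry_time + 9) + 7 + 9) + 7 + 9) + 7 + 9) + 7"

lemma table:
  assumes "all_regs (regs s)" "static (heap s)"
  shows "run aEND table table_time (\<lambda>s'. all_regs (regs s') \<and> static (heap s') \<and> table_ok (heap s') (lin (N + 1) 0 0 0)) s"
  unfolding table_def
proof (rule run_For[where n = "N + 1" and
    I = "\<lambda>r s'. all_regs (regs s') \<and> static (heap s') \<and> table_ok (heap s') (lin r 0 0 0)" and
    T = "(n + 1) * ((n + 1) * ((states + 1) * (entry_time + 9) + 7 + 9) + 7 + 9) + 7"], goal_cases)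
  case 1
  then show ?case using assms by (simp add: table_ok_def lin_def)
next
  case (2 r s')
  then show ?case using all_regsD[of "regs s'"] by simp
next
  case (3 r s1)
  then have r: "r \<le> N" by simp
  show ?case
  proof (rule run_For[where n = "n + 1" and
    I = "\<lambda>u s'. all_regs (regs s') \<and> static (heap s') \<and> table_ok (heap s') (lin r u 0 0) \<and> regs s' 20 = real r" and
    T = "(n + 1) * ((states + 1) * (entry_time + 9) + 7 + 9) + 7"], goal_cases)
    case 1
    then show ?case using 3 by simp
  next
    case (2 u s')
    then show ?case using all_regsD[of "regs s'"] by simp
  next
    case (3 u s2)
    then have u: "u \<le> n" by simp
    show ?case
    proof (rule run_For[where n = "n + 1" and
      I = "\<lambda>b s'. all_regs (regs s') \<and> static (heap s') \<and> table_ok (heap s') (lin r u b 0) \<and> regs s' 20 = real r \<and> regs s' 21 = real u" and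
      T = "(states + 1) * (entry_time + 9) + 7"], goal_cases)
      case 1
      then show ?case using 3 by simp
    next
      case (2 b s')
      then show ?case using all_regsD[of "regs s'"] by simp
    next
      case (3 b s3)
      then have b: "b \<le> n" by simp
      show ?case
      proof (rule run_For[where n = "states + 1" and
        I = "\<lambda>k s'. all_regs (regs s') \<and> static (heap s') \<and> table_ok (heap s') (lin r u b k) \<and> regs s' 20 = real r \<and>
          regs s' 21 = real u \<and> regs s' 22 = real b" and T = "entry_time"], goal_cases)
        case 1
        then show ?case using 3 by simp
      next
        case (2 k s')
        then show ?case using all_regsD[of "regs s'"] by simp
      next
        case (3 k s4)
        then have "k \<le> states" by simp
        then show ?case
          using 3 by (intro run_mono[OF table_entry[OF _ _ _ r u b \<open>k \<le> states\<close>] order_refl]) (auto simp: at_state_def)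
      next
        case (4 s4)
        then show ?case by (simp add: lin_next)
      qed simp
    next
      case (4 s3)
      then show ?case by (simp add: lin_next)
    qed simp
  next
    case (4 s2)
    then show ?case by (simp add: lin_next)
  qed simp
qed (use assms in simp_all)


section \<open>Reading off the schedule\<close>

lemma state_swap: "s\<lparr>regs := f, heap := h\<rparr> = (s\<lparr>heap := h, regs := f\<rparr> :: state)"
  by (cases s) simp

lemma place_job:
  assumes st: "at_state (regs s) r u b k" "static (heap s)" "k < states"
    and i: "i < m" "regs s 27 = real (i + 3)" and j: "j < N" "regs s 29 = real j" and q: "regs s 28 = real q"
    and u: "0 < u"
    and Q: "\<And>f. at_state f r (u - 1) b (k + q * T ^ i) \<Longrightarrow>
      Q (s\<lparr>regs := f, heap := (heap s)(2 + j := real (i + 1), 2 + N + j := real (digit k i) / V i)\<rparr>)"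
  shows "line aEND place_job Q s"
proof -
  have R: "all_regs (regs s)" "regs s 20 = real r" "regs s 21 = real u" "regs s 22 = real b" "regs s 23 = real k"
    using st by (auto simp: at_state_def)
  note R' = all_regsD[OF R(1)]
  obtain u' where u': "u = Suc u'" using u by (cases u) auto
  have bd: "aDG + k * m + i < aEND"
    using mat_less[OF st(3) i(1)] bounds(11)[of "aDG + k * m + i"] by (simp add: aTB_def)
  have big: "aORD \<le> aDG + k * m + i" "aORD \<le> aSPD + i" "aORD \<le> aPW + i" by (simp_all add: layout)
  have small: "2 + j < aORD" "2 + N + j < aORD" using j by (simp_all add: aORD_def)
  have mem: "heap s (aSPD + i) = V i" "heap s (aPW + i) = real T ^ i" "heap s (aDG + k * m + i) = real (digit k i)"
    using static_at(5,6,8)[OF st(2)] st(3) i by simp_all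
  have ne: "2 + j \<noteq> aDG + k * m + i" "2 + j \<noteq> aSPD + i" "2 + j \<noteq> aPW + i" "2 + N + j \<noteq> aPW + i"
    using big small by linarith+
  let ?f = "(regs s)(24 := real i, 23 := real k + real q * real T ^ i, 21 := real u')"
  have "at_state ?f r (u - 1) b (k + q * T ^ i)"
    using R u' by (simp add: at_state_def all_regs_def base_regs_def params_def)
  note Q = Q[OF this]
  have Q: "Q (s\<lparr>heap := (heap s)(2 + j := real i + 1, 2 + N + j := real (digit k i) / V i), regs := ?f\<rparr>)"
    using Q[unfolded state_swap] by (simp add: add.commute)
  have "2 + j < aEND" "2 + N + j < aEND" using small bounds(10) by auto
  then show ?thesis
    using Q R' R mem ne bd i j q u' by (simp add: place_job_def is_address_iff add.commute[of _ 2])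
qed

text \<open>
  Pending jobs are on the stack; neither their machine nor their start time has been written yet.
\<close>

definition outputs :: "(nat \<Rightarrow> real) \<Rightarrow> nat \<Rightarrow> nat set \<Rightarrow> nat list \<Rightarrow> schedule \<Rightarrow> real \<Rightarrow> bool" where
  "outputs h r X Bs s g \<longleftrightarrow> h 0 = 1 \<and> h 1 = g \<and> (\<forall>t<length Bs. h (aPND + t) = real (Bs ! t)) \<and>
     (\<forall>j\<in>X. h (2 + j) = real (machine_of s j + 1) \<and> h (2 + N + j) = start_of s j) \<and>
     (\<forall>j\<in>later r - X - set Bs. h (2 + j) = 0 \<and> h (2 + N + j) = 0)"

lemma outputs_write:
  fixes x y :: real
  assumes "outputs h r X Bs s g" "X \<subseteq> {..<N}" "j < N" "length Bs \<le> n" "j \<notin> X"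
  defines "h' \<equiv> h(2 + j := x, 2 + N + j := y)"
  shows "h' 0 = 1" "h' 1 = g" "\<forall>t<length Bs. h' (aPND + t) = real (Bs ! t)"
    "\<forall>l\<in>X. h' (2 + l) = real (machine_of s l + 1) \<and> h' (2 + N + l) = start_of s l"
    "\<forall>l\<in>later r - X - set Bs - {j}. h' (2 + l) = 0 \<and> h' (2 + N + l) = 0"
    "h' (2 + j) = x" "h' (2 + N + j) = y"
proof -
  have ne: "2 + j \<noteq> 2 + N + l" if "l < N" for l using assms(3) by simp
  have ne2: "2 + N + j \<noteq> 2 + l" if "l < N" for l using that by simp
  have "aPND + t \<noteq> 2 + j" "aPND + t \<noteq> 2 + N + j" for t
    using assms(3) by (simp_all add: layout)
  then show "\<forall>t<length Bs. h' (aPND + t) = real (Bs ! t)"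
    using assms(1) by (simp add: outputs_def h'_def)
  show "\<forall>l\<in>X. h' (2 + l) = real (machine_of s l + 1) \<and> h' (2 + N + l) = start_of s l"
  proof
    fix l assume l: "l \<in> X"
    then have "l < N" "l \<noteq> j" using assms(2,5) by auto
    then show "h' (2 + l) = real (machine_of s l + 1) \<and> h' (2 + N + l) = start_of s l"
      using assms(1) l assms(3) by (simp add: outputs_def h'_def)
  qed
  show "\<forall>l\<in>later r - X - set Bs - {j}. h' (2 + l) = 0 \<and> h' (2 + N + l) = 0"
  proof
    fix l assume l: "l \<in> later r - X - set Bs - {j}"
    then have "l < N" "l \<noteq> j" using later_subset[of r] by auto
    then show "h' (2 + l) = 0 \<and> h' (2 + N + l) = 0"
      using assms(1) l assms(3) by (simp add: outputs_def h'_def)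
  qed
  show "h' 0 = 1" "h' 1 = g" using assms(1) by (simp_all add: outputs_def h'_def)
  show "h' (2 + j) = x" "h' (2 + N + j) = y" using assms(3) by (simp_all add: h'_def)
qed

lemma outputs_place:
  assumes "outputs h r X Bs s g" "X \<subseteq> {..<N}" "j < N" "length Bs \<le> n" "j \<notin> X"
    and r': "later r' \<subseteq> insert j (later r)" "set Bs \<subseteq> insert j (set Bs')"
    and Bs': "length Bs' \<le> length Bs" "\<And>t. t < length Bs' \<Longrightarrow> Bs' ! t = Bs ! t"
  shows "outputs (h(2 + j := real (i + 1), 2 + N + j := real (digit k i) / V i)) r' (insert j X) Bs' (append k j i s) g"
proof -
  define h' where "h' = h(2 + j := real (i + 1), 2 + N + j := real (digit k i) / V i)"
  note w = outputs_write[OF assms(1-5), of "real (i + 1)" "real (digit k i) / V i", folded h'_def]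
  have "outputs h' r' (insert j X) Bs' (append k j i s) g"
    unfolding outputs_def
  proof (intro conjI allI impI)
    fix t assume "t < length Bs'"
    then show "h' (aPND + t) = real (Bs' ! t)" using w(3) Bs' by simp
  next
    show "\<forall>l\<in>insert j X. h' (2 + l) = real (machine_of (append k j i s) l + 1) \<and>
        h' (2 + N + l) = start_of (append k j i s) l"
    proof
      fix l assume l: "l \<in> insert j X"
      show "h' (2 + l) = real (machine_of (append k j i s) l + 1) \<and> h' (2 + N + l) = start_of (append k j i s) l"
      proof (cases "l = j")
        case True
        then show ?thesis using w(6,7) by simp
      next
        case False
        then show ?thesis using w(4) l by simp
      qed
    qed
  next
    show "\<forall>l\<in>later r' - insert j X - set Bs'. h' (2 + l) = 0 \<and> h' (2 + N + l) = 0"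
      using w(5) r' by blast
  qed (use w(1,2) in auto)
  then show ?thesis by (simp only: h'_def)
qed

lemma outputs_skip:
  assumes "outputs h (Suc r) X Bs s g" "X \<subseteq> {..<N}" "length Bs \<le> n" "r < N" "ord r \<notin> X" "ord r \<notin> set Bs"
  shows "outputs (h(2 + ord r := 0, 2 + N + ord r := 0)) r X Bs s g"
proof -
  define h' where "h' = h(2 + ord r := 0, 2 + N + ord r := 0)"
  note w = outputs_write[OF assms(1,2) ord_less[OF assms(4)] assms(3,5), of 0 0, folded h'_def]
  have "\<forall>l\<in>later r - X - set Bs. h' (2 + l) = 0 \<and> h' (2 + N + l) = 0"
  proof
    fix l assume "l \<in> later r - X - set Bs"
    then show "h' (2 + l) = 0 \<and> h' (2 + N + l) = 0"
      using w(5,6,7) later_Suc[OF assms(4)] by (cases "l = ord r") auto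
  qed
  then have "outputs h' r X Bs s g" unfolding outputs_def using w(1-4) by blast
  then show ?thesis by (simp only: h'_def)
qed

lemma outputs_tardy:
  assumes out: "outputs h (Suc r) X Bs s g" and XN: "X \<subseteq> {..<N}" and r: "r < N"
  shows "outputs (h(aPND + length Bs := real (ord r))) r X (Bs @ [ord r]) s g"
proof -
  define h' where "h' = h(aPND + length Bs := real (ord r))"
  have low: "h' a = h a" if "a < aORD" for a
  proof -
    have "aORD \<le> aPND + length Bs" by simp
    then have "a \<noteq> aPND + length Bs" using that by linarith
    then show ?thesis by (simp add: h'_def)
  qed
  have low': "h' (2 + l) = h (2 + l)" "h' (2 + N + l) = h (2 + N + l)" if "l < N" for l
    using that by (simp_all only: low low_bounds)
  have "outputs h' r X (Bs @ [ord r]) s g"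
    unfolding outputs_def
  proof (intro conjI allI impI ballI)
    show "h' 0 = 1" "h' 1 = g" using out low[of 0] low[of 1] by (auto simp: outputs_def)
  next
    fix t assume "t < length (Bs @ [ord r])"
    then show "h' (aPND + t) = real ((Bs @ [ord r]) ! t)"
      using out by (auto simp: h'_def outputs_def nth_append less_Suc_eq)
  next
    fix l assume "l \<in> X"
    then show "h' (2 + l) = real (machine_of s l + 1)" "h' (2 + N + l) = start_of s l"
      using out XN low'[of l] unfolding outputs_def by auto
  next
    fix l assume "l \<in> later r - X - set (Bs @ [ord r])"
    then have "l < N" "l \<in> later (Suc r) - X - set Bs"
      using later_subset[of r] later_Suc[OF r] by auto
    then show "h' (2 + l) = 0" "h' (2 + N + l) = 0"
      using out low'[of l] unfolding outputs_def by auto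
  qed
  then show ?thesis by (simp only: h'_def)
qed

abbreviation "first_entry \<equiv> dp N n 0 0"

text \<open>
  Each step considers a job or appends a pending one, and considering a job adds at most one
  pending job; hence the variant \<open>2 * r + length Bs\<close> decreases.
\<close>

definition trace_inv :: "nat \<Rightarrow> state \<Rightarrow> bool" where
  "trace_inv l t \<longleftrightarrow> (\<exists>r X Bs s. l = 2 * r + length Bs \<and> distinct Bs \<and>
     tracing r X (set Bs) s (fst first_entry) (fst (snd first_entry)) \<and>
     at_state (regs t) r (n - card X) (length Bs) (key (machine_of s) X) \<and>
     static (heap t) \<and> table_ok (heap t) (lin (N + 1) 0 0 0) \<and>
     outputs (heap t) r X Bs s (fst (snd first_entry)))"

lemma trace_invI:
  "\<lbrakk>distinct Bs; tracing r X (set Bs) s (fst first_entry) (fst (snd first_entry));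
    at_state (regs t) r (n - card X) (length Bs) (key (machine_of s) X);
    static (heap t); table_ok (heap t) (lin (N + 1) 0 0 0);
    outputs (heap t) r X Bs s (fst (snd first_entry)); 2 * r + length Bs < l\<rbrakk> \<Longrightarrow> \<exists>l'<l. trace_inv l' t"
  unfolding trace_inv_def by blast

lemma table_ok_upd: "x < aTB \<Longrightarrow> table_ok (h(x := v)) c = table_ok h c"
  unfolding table_ok_def by (simp add: cell_def)

lemma lt_aTB[simp]: "a < aORD \<Longrightarrow> a < aTB" "u < n \<Longrightarrow> aPND + u < aTB"
  by (simp_all add: aTB_def layout)

lemma output_upd:
  assumes "j < N"
  shows "static (h(2 + j := x, 2 + N + j := y)) = static h"
    "table_ok (h(2 + j := x, 2 + N + j := y)) c = table_ok h c"
proof -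
  have a: "2 + j < aORD" "2 + N + j < aORD" using assms by (simp_all add: aORD_def)
  then have "2 + j < aTB" "2 + N + j < aTB" by (simp_all only: lt_aTB)
  then show "static (h(2 + j := x, 2 + N + j := y)) = static h"
    "table_ok (h(2 + j := x, 2 + N + j := y)) c = table_ok h c"
    using a by (simp_all add: table_ok_upd)
qed

lemma output_step:
  assumes inv: "trace_inv l t" and go: "cond_val (Less (Lit 0) (Add (Reg 20) (Reg 22))) t"
  shows "line aEND output_step (\<lambda>t'. \<exists>l'<l. trace_inv l' t') t"
proof -
  let ?e = "fst first_entry" and ?g = "fst (snd first_entry)"
  obtain r X Bs s where l: "l = 2 * r + length Bs" and dist: "distinct Bs"
    and tr: "tracing r X (set Bs) s ?e ?g"
    and at: "at_state (regs t) r (n - card X) (length Bs) (key (machine_of s) X)"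
    and static: "static (heap t)" and tab: "table_ok (heap t) (lin (N + 1) 0 0 0)"
    and out: "outputs (heap t) r X Bs s ?g"
    using inv unfolding trace_inv_def by blast
  define u b k where "u = n - card X" and "b = length Bs" and "k = key (machine_of s) X"
  have at: "at_state (regs t) r u b k" using at by (simp add: u_def b_def k_def)
  have rN: "r \<le> N" and XB: "X \<union> set Bs \<subseteq> later r" "X \<inter> set Bs = {}" and Bp: "\<forall>j\<in>set Bs. p j = p (ord r)"
    and c: "card X + card (set Bs) \<le> n" "n \<le> card X + card (set Bs) + r" and X: "packed X s"
    using tr by (auto simp: tracing_def)
  have XN: "X \<subseteq> {..<N}" using X by (simp add: packed_def)
  have finX: "finite X" using finite_jobs[OF XN] .
  have cb: "card (set Bs) = b" using distinct_card[OF dist] by (simp add: b_def)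
  have BN: "b \<noteq> 0 \<Longrightarrow> r < N" using XB rN by (cases "r = N") (auto simp: b_def)
  have v: "valid_state r u b" using rN c cb BN by (auto simp: valid_state_def u_def)
  have R: "all_regs (regs t)" "regs t 20 = real r" "regs t 21 = real u" "regs t 22 = real b" "regs t 23 = real k"
    using at by (auto simp: at_state_def)
  have pos: "0 < r + b" using go R by auto
  have \<mu>X: "\<forall>l\<in>X. machine_of s l < m" using X by (auto simp: packed_def schedules_def)
  have kl: "k < states"
  proof (cases "b = 0")
    case True
    then obtain r' where r': "r = Suc r'" using pos by (cases r) auto
    then have "ord r' \<notin> X" using XB ord_notin_later[of r'] rN by auto
    then show ?thesis unfolding k_def using key_less[OF XN ord_less _ \<mu>X, of r'] rN r' by simp
  next
    case False
    then obtain j where "j \<in> set Bs" by (cases Bs) (auto simp: b_def)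
    moreover then have "j < N" "j \<notin> X" using XB later_subset[of r] by auto
    ultimately show ?thesis unfolding k_def using key_less[OF XN _ _ \<mu>X, of j] by simp
  qed
  define d where "d = snd (snd (dp r u b k))"
  have un: "u \<le> n" "b \<le> n" using v by (auto simp: valid_state_def)
  have cl: "cell r u b k + 2 < aEND" using cell_bounds rN un kl by simp
  have "lin r u b k < lin (N + 1) 0 0 0"
    using lin_less[OF rN un, of k] kl by (simp add: lin_def)
  then have hd: "heap t (cell r u b k + 2) = real d"
    using tab v kl by (simp add: table_ok_def d_def)
  define fl where "fl = (if 0 < b \<and> \<not> same_group r then 1 else 0 :: real)"
  let ?t = "t\<lparr>regs := (regs t)(30 := fl, 27 := real d)\<rparr>"
  let ?Q = "\<lambda>t'. \<exists>l'<l. trace_inv l' t'"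
  let ?F = "block [Assign 28 (At xSP (Reg 20)), Assign 22 (Sub (Reg 22) (Lit 1)),
          Assign 29 (At xPND (Reg 22)), place_job]"
  let ?P = "If (Less (Reg 27) (Lit 2))
            (Seq (Store (Add (Lit 2) (Reg 29)) (Lit 0)) (Store (Add (Add (Lit 2) xN) (Reg 29)) (Lit 0)))
            (If (Less (Reg 27) (Lit 3))
              (Seq (Store (Add xPND (Reg 22)) (Reg 29)) (Assign 22 (Add (Reg 22) (Lit 1))))
              place_job)"
  let ?J = "block [Assign 20 (Sub (Reg 20) (Lit 1)), Assign 29 (At xORD (Reg 20)),
          Assign 28 (At xSP (Reg 20)), ?P]"
  have main: "if 0 < fl then line aEND ?F ?Q ?t else line aEND ?J ?Q ?t"
  proof (cases "0 < b \<and> \<not> same_group r")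
    case True
    then have fl: "fl = 1" by (simp add: fl_def)
    have rlt: "r < N" using BN True by simp
    have ne: "Bs \<noteq> []" using True by (auto simp: b_def)
    define j Bs' where "j = last Bs" and "Bs' = butlast Bs"
    have Bs: "Bs = Bs' @ [j]" using ne by (simp add: j_def Bs'_def)
    have bS: "b = Suc (length Bs')" by (simp add: b_def Bs)
    have jB: "j \<in> set Bs" by (simp add: Bs)
    obtain i where i: "i < m" "d = i + 3"
      and tr': "tracing r (insert j X) (set Bs - {j}) (append k j i s) ?e ?g"
      using dp_flush_step[OF tr] True ne jB cb by (auto simp: d_def u_def k_def)
    have sB: "set Bs - {j} = set Bs'" using dist by (auto simp: Bs)
    have jN: "j < N" and jX: "j \<notin> X" using jB XB later_subset[of r] by auto
    have pj: "p j = p (ord r)" using Bp jB by simp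
    let ?s = "append k j i s"
    let ?h = "(heap t)(2 + j := real (i + 1), 2 + N + j := real (digit k i) / V i)"
    have key': "key (machine_of ?s) (insert j X) = k + p j * T ^ i"
      using key_append[OF X jN jX i(1)] by (simp add: k_def)
    have u': "n - card (insert j X) = u - 1" using finX jX by (simp add: u_def)
    have out': "outputs ?h r (insert j X) Bs' ?s ?g"
      by (rule outputs_place[OF out XN jN _ jX]) (use un in \<open>auto simp: Bs b_def nth_append\<close>)
    have static': "static ?h" and tab': "table_ok ?h (lin (N + 1) 0 0 0)"
      using static tab by (simp_all only: output_upd[OF jN])
    have u0: "0 < u" using True v by (auto simp: valid_state_def)
    let ?r = "(regs t)(30 := fl, 27 := real d, 28 := real (p j), 22 := real (length Bs'), 29 := real j)"
    have pl: "line aEND place_job ?Q (t\<lparr>regs := ?r\<rparr>)"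
    proof (rule place_job[where r = r and u = u and b = "length Bs'" and k = k and i = i and j = j and q = "p j"])
      show "at_state (regs (t\<lparr>regs := ?r\<rparr>)) r u (length Bs') k"
        using R by (simp add: at_state_def all_regs_def base_regs_def params_def)
      fix f assume f: "at_state f r (u - 1) (length Bs') (k + p j * T ^ i)"
      show "?Q (t\<lparr>regs := ?r\<rparr>\<lparr>regs := f, heap := (heap (t\<lparr>regs := ?r\<rparr>))(2 + j := real (i + 1), 2 + N + j := real (digit k i) / V i)\<rparr>)"
        by (rule trace_invI[where Bs = Bs' and r = r and X = "insert j X" and s = ?s])
          (use dist tr' sB f key' u' static' tab' out' in \<open>auto simp: Bs l simp del: append_simps fun_upd_apply\<close>)
    qed (use static kl i jN u0 in simp_all)
    have "heap t (aPND + length Bs') = real j" using out by (simp add: outputs_def Bs)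
    then have "line aEND ?F ?Q ?t = line aEND place_job ?Q (t\<lparr>regs := ?r\<rparr>)"
      using R all_regsD[OF R(1)] static_at(2)[OF static rlt] bS un rlt pj
      by (simp add: is_address_iff)
    then show ?thesis using pl fl by simp
  next
    case False
    then have fl: "fl = 0" by (auto simp: fl_def)
    obtain r' where r': "r = Suc r'" using pos False by (cases r) (auto simp: same_group_def)
    let ?j = "ord r'"
    have r'N: "r' < N" using rN r' by simp
    have jN: "?j < N" using ord_less[OF r'N] .
    have jl: "?j \<notin> later r" using ord_notin_later[OF r'N] r' by simp
    have jX: "?j \<notin> X" and jB: "?j \<notin> set Bs" using jl XB by auto
    have bl: "length Bs \<le> n" using un by (simp add: b_def)
    let ?r = "(regs t)(30 := fl, 27 := real d, 20 := real r', 29 := real ?j, 28 := real (p ?j))"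
    let ?t' = "t\<lparr>regs := ?r\<rparr>"
    have a': "at_state ?r r' u b k"
      using R by (simp add: at_state_def all_regs_def base_regs_def params_def)
    note step = dp_job_step[OF tr[unfolded r']]
    have step: "d = 1 \<and> tracing r' X (set Bs) s ?e ?g \<or> d = 2 \<and> tracing r' X (insert ?j (set Bs)) s ?e ?g \<or>
      (\<exists>i<m. d = i + 3 \<and> tracing r' (insert ?j X) (set Bs) (append k ?j i s) ?e ?g)"
      using step False r' cb by (auto simp: d_def u_def k_def b_def)
    have "line aEND ?P ?Q ?t'"
      using step
    proof (elim disjE exE conjE)
      assume d: "d = 1" and tr': "tracing r' X (set Bs) s ?e ?g"
      let ?h = "(heap t)(2 + ?j := 0, 2 + N + ?j := 0)"
      have "outputs ?h r' X Bs s ?g"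
        using outputs_skip[OF _ XN bl r'N jX jB] out r' by simp
      moreover have "static ?h" "table_ok ?h (lin (N + 1) 0 0 0)"
        using static tab by (simp_all only: output_upd[OF jN])
      ultimately have "?Q (t\<lparr>regs := ?r, heap := ?h\<rparr>)"
        by (intro trace_invI[where Bs = Bs and r = r' and X = X and s = s])
          (use dist tr' a' in \<open>auto simp: l r' u_def b_def k_def simp del: fun_upd_apply\<close>)
      moreover have "2 + ?j < aORD" "2 + N + ?j < aORD" using jN by (simp_all add: aORD_def)
      then have "2 + ?j < aEND" "2 + N + ?j < aEND" by (simp_all only: bounds(10))
      ultimately show ?thesis
        using d R all_regsD[OF R(1)] by (simp add: is_address_iff)
    next
      assume d: "d = 2" and tr': "tracing r' X (insert ?j (set Bs)) s ?e ?g"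
      let ?h = "(heap t)(aPND + b := real ?j)"
      have "card (insert ?j (set Bs)) = b + 1" using jB cb by simp
      then have bn: "b < n" using tr' by (auto simp: tracing_def)
      have out': "outputs ?h r' X (Bs @ [?j]) s ?g"
        using outputs_tardy[OF _ XN r'N] out r' by (simp add: b_def)
      have "?Q (t\<lparr>heap := ?h, regs := ?r(22 := real b + 1)\<rparr>)"
        by (rule trace_invI[where Bs = "Bs @ [?j]" and r = r' and X = X and s = s])
          (use dist jB tr' a' static tab out' bn in
            \<open>auto simp: l r' table_ok_upd u_def b_def k_def at_state_def all_regs_def base_regs_def params_def\<close>)
      then show ?thesis
        using d R all_regsD[OF R(1)] bn by (simp add: is_address_iff)
    next
      fix i assume i: "i < m" "d = i + 3" and tr': "tracing r' (insert ?j X) (set Bs) (append k ?j i s) ?e ?g"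
      let ?s = "append k ?j i s"
      let ?h = "(heap t)(2 + ?j := real (i + 1), 2 + N + ?j := real (digit k i) / V i)"
      have key': "key (machine_of ?s) (insert ?j X) = k + p ?j * T ^ i"
        using key_append[OF X jN jX i(1)] by (simp add: k_def)
      have u': "n - card (insert ?j X) = u - 1" using finX jX by (simp add: u_def)
      have "card (insert ?j X) = card X + 1" using finX jX by simp
      then have u0: "0 < u" using tr' by (auto simp: tracing_def u_def)
      have out': "outputs ?h r' (insert ?j X) Bs ?s ?g"
        by (rule outputs_place[OF out XN jN bl jX]) (use later_Suc[OF r'N] r' in auto)
      have static': "static ?h" and tab': "table_ok ?h (lin (N + 1) 0 0 0)"
        using static tab by (simp_all only: output_upd[OF jN])
      have "line aEND place_job ?Q ?t'"
      proof (rule place_job[where r = r' and u = u and b = b and k = k and i = i and j = ?j and q = "p ?j"])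
        fix f assume f: "at_state f r' (u - 1) b (k + p ?j * T ^ i)"
        show "?Q (?t'\<lparr>regs := f, heap := (heap ?t')(2 + ?j := real (i + 1), 2 + N + ?j := real (digit k i) / V i)\<rparr>)"
          by (rule trace_invI[where Bs = Bs and r = r' and X = "insert ?j X" and s = ?s])
            (use dist tr' f key' u' static' tab' out' in \<open>auto simp: l r' b_def simp del: append_simps fun_upd_apply\<close>)
      qed (use a' static kl i jN u0 in simp_all)
      then show ?thesis using i by simp
    qed
    moreover have "line aEND ?J ?Q ?t = line aEND ?P ?Q ?t'"
      using R all_regsD[OF R(1)] static_at(1,2)[OF static r'N] r'N r'
      by (simp add: is_address_iff del: line.simps(5))
    ultimately show ?thesis using fl by simp
  qed
  have "line aEND group_end_test (line aEND (Seq (Assign 27 (At (cell_expr (Reg 20) (Reg 21) (Reg 22) (Reg 23)) (Lit 2)))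
      (If (Less (Lit 0) (Reg 30)) ?F ?J)) ?Q) t"
  proof (rule group_end_test[OF at static])
    show "r < N \<or> b = 0" using BN by auto
    have "line aEND (Seq (Assign 27 (At (cell_expr (Reg 20) (Reg 21) (Reg 22) (Reg 23)) (Lit 2)))
      (If (Less (Lit 0) (Reg 30)) ?F ?J)) ?Q (set_reg t 30 fl)
      = (if 0 < fl then line aEND ?F ?Q ?t else line aEND ?J ?Q ?t)"
      using R cl hd by (simp add: is_address_iff del: block.simps)
    then show "line aEND (Seq (Assign 27 (At (cell_expr (Reg 20) (Reg 21) (Reg 22) (Reg 23)) (Lit 2)))
      (If (Less (Lit 0) (Reg 30)) ?F ?J)) ?Q (set_reg t 30 (if 0 < b \<and> \<not> same_group r then 1 else 0))"
      using main unfolding fl_def by blast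
  qed
  then show ?thesis unfolding output_step_def by simp
qed


abbreviation "output_time \<equiv>
  line_cost output_start + ((2 * N) * (line_cost output_step + 5) + 5)"

lemma write_output:
  assumes "all_regs (regs t)" "static (heap t)" "table_ok (heap t) (lin (N + 1) 0 0 0)"
  shows "run aEND write_output output_time (\<lambda>t'. \<exists>X s. bilevel_optimal P X s \<and>
    (\<forall>a<length (encode_solution P X s). heap t' a = encode_solution P X s ! a)) t"
  unfolding write_output_def
proof (rule run_Seq, rule run_mono[OF run_line order_refl])
  let ?g = "fst (snd first_entry)"
  have nN: "n \<le> N" using valid by (simp add: valid_instance_def)
  have v: "valid_state N n 0" by (simp add: valid_state_def)
  have "lin N n 0 0 < lin (N + 1) 0 0 0" using lin_less[of N n 0 0] by (simp add: lin_def)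
  then have e: "heap t (cell N n 0 0 + 1) = ?g" using assms(3) v unfolding table_ok_def by simp
  have big: "aTB \<le> cell N n 0 0" by (simp add: cell_def)
  have c: "cell N n 0 0 + 1 < aEND" using cell_bounds[of N n 0 0] by simp
  have tb: "0 < aTB" "1 < aTB" using lt_aTB(1)[of 0] lt_aTB(1)[of 1] by auto
  have key0: "key \<mu> {} = 0" for \<mu> by (simp add: load_index_def load_def)
  let ?h = "(heap t)(0 := 1, 1 := ?g)"
  let ?r = "(regs t)(20 := real N, 21 := real n, 22 := 0, 23 := 0)"
  have out: "outputs ?h N {} [] s ?g" for s by (simp add: outputs_def)
  have "trace_inv (2 * N) (t\<lparr>heap := ?h, regs := ?r\<rparr>)"
    unfolding trace_inv_def
    by (rule exI[of _ N], rule exI[of _ "{}"], rule exI[of _ "[]"], rule exI[of _ "\<lparr>machine_of = \<lambda>_. 0, start_of = \<lambda>_. 0\<rparr>"])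
      (use out assms tb tracing_start in \<open>simp add: at_state_def table_ok_upd key0\<close>)
  then show "line aEND output_start (trace_inv (2 * N)) t"
    using assms(1) all_regsD[OF assms(1)] e c
    by (simp add: output_start_def is_address_iff cell_def)
next
  fix t :: state assume "trace_inv (2 * N) t"
  let ?b = "Less (Lit 0) (Add (Reg 20) (Reg 22))"
  have "run aEND (While ?b output_step) (2 * N * (line_cost output_step + cond_cost ?b) + cond_cost ?b)
    (\<lambda>t'. (\<exists>l. trace_inv l t') \<and> \<not> cond_val ?b t') t"
  proof (rule run_While[where I = trace_inv])
    fix k :: nat and s :: state
    assume "trace_inv k s"
    then show "cond_ok aEND ?b s \<and> (cond_val ?b s \<longrightarrow>
        run aEND output_step (line_cost output_step) (\<lambda>s'. \<exists>k'<k. trace_inv k' s') s)"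
      using run_line[OF output_step] by simp
  qed fact
  then show "run aEND (While ?b output_step) ((2 * N) * (line_cost output_step + 5) + 5)
    (\<lambda>t'. \<exists>X s. bilevel_optimal P X s \<and>
    (\<forall>a<length (encode_solution P X s). heap t' a = encode_solution P X s ! a)) t"
  proof (rule run_mono)
    fix t' :: state assume t': "(\<exists>l. trace_inv l t') \<and> \<not> cond_val ?b t'"
    then obtain r X Bs s where
      tr: "tracing r X (set Bs) s (fst first_entry) (fst (snd first_entry))"
      and at: "at_state (regs t') r (n - card X) (length Bs) (key (machine_of s) X)"
      and out: "outputs (heap t') r X Bs s (fst (snd first_entry))"
      unfolding trace_inv_def by blast
    have "\<not> 0 < real r + real (length Bs)" using t' at by (auto simp: at_state_def)
    then have "r + length Bs = 0" by linarith
    then have r: "r = 0" "Bs = []" by auto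
    have opt: "bilevel_optimal P X s" "weighted_tardy P X s = fst (snd first_entry)"
      using tracing_optimal tr r by auto
    have o: "heap t' 0 = 1" "heap t' 1 = weighted_tardy P X s"
      "\<And>j. j \<in> X \<Longrightarrow> heap t' (2 + j) = real (machine_of s j + 1) \<and> heap t' (2 + N + j) = start_of s j"
      "\<And>j. j < N \<Longrightarrow> j \<notin> X \<Longrightarrow> heap t' (2 + j) = 0 \<and> heap t' (2 + N + j) = 0"
      using out opt(2) unfolding outputs_def r later_0 by auto
    have "heap t' a = encode_solution P X s ! a" if a: "a < length (encode_solution P X s)" for a
    proof -
      have len: "length (encode_solution P X s) = 2 + N + N" by (simp add: encode_solution_def)
      consider "a = 0" | "a = 1" | j where "a = 2 + j" "j < N" | j where "a = 2 + N + j" "j < N"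
      proof (cases "a < 2 + N")
        case True
        then show ?thesis using that(1,2) that(3)[of "a - 2"] by (cases "a < 2") force+
      next
        case False
        then show ?thesis using that(4)[of "a - (2 + N)"] a len by simp
      qed
      then show ?thesis
      proof cases
        case (3 j)
        then show ?thesis using o(3)[of j] o(4)[of j]
          by (cases "j \<in> X") (auto simp: encode_solution_def nth_append)
      next
        case (4 j)
        then show ?thesis using o(3)[of j] o(4)[of j]
          by (cases "j \<in> X") (auto simp: encode_solution_def nth_append)
      qed (use o in \<open>auto simp: encode_solution_def\<close>)
    qed
    then show "\<exists>X s. bilevel_optimal P X s \<and>
      (\<forall>a<length (encode_solution P X s). heap t' a = encode_solution P X s ! a)"
      using opt(1) by blast
  qed (simp add: eval_nat_numeral)
qed

abbreviation "program_time \<equiv> line_cost read_parameters + (9 + (2 + (N * 14 + 5) + (line_cost layout_arrays +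
  (m * (line_cost machine_step + 7) + 5 + 6 + (sort_time + (coef_time + (digit_time + (table_time + output_time))))))))"

lemma program_correct:
  "run aEND program program_time (\<lambda>t'. \<exists>X s. bilevel_optimal P X s \<and>
    (\<forall>a<length (encode_solution P X s). heap t' a = encode_solution P X s ! a))
   (initial_state (encode_instance P))"
  (is "run aEND program program_time ?Q _")
  unfolding program_def block.simps
proof (rule run_then[OF run_line[OF read_parameters]])
  have 1: "run aEND (Seq table write_output) (table_time + output_time) ?Q s"
    if "all_regs (regs s)" "static (heap s)" for s
    by (rule run_then[OF table[OF that]]) (elim conjE, rule write_output; assumption)
  have 2: "run aEND (Seq digit_table (Seq table write_output)) (digit_time + (table_time + output_time)) ?Q s"
    if "all_regs (regs s)" "machine_data (heap s) m" "sorted_jobs (heap s) N" "coefs (heap s) n" for s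
    by (rule run_then[OF digit_table[OF that]]) (elim conjE, rule 1; assumption)
  have 3: "run aEND (Seq coefficients (Seq digit_table (Seq table write_output)))
      (coef_time + (digit_time + (table_time + output_time))) ?Q s"
    if "all_regs (regs s)" "machine_data (heap s) m" "counts (heap s) (\<lambda>_. 0) m" "sorted_jobs (heap s) N" for s
    by (rule run_then[OF coefficients[OF that]]) (elim conjE, rule 2; assumption)
  have 4: "run aEND (Seq sort_jobs (Seq coefficients (Seq digit_table (Seq table write_output))))
      (sort_time + (coef_time + (digit_time + (table_time + output_time)))) ?Q s"
    if "all_regs (regs s)" "input (heap s)" "machine_data (heap s) m" "counts (heap s) (\<lambda>_. 0) m" for s
    by (rule run_then[OF sort_jobs[OF that]]) (elim conjE, rule 3; assumption)
  have 5: "run aEND (Seq machine_arrays (Seq sort_jobs (Seq coefficients (Seq digit_table (Seq table write_output)))))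
      (m * (line_cost machine_step + 7) + 5 + 6 + (sort_time + (coef_time + (digit_time + (table_time + output_time))))) ?Q s"
    if "base_regs (regs s)" "regs s 8 = 1" "input (heap s)" for s
    by (rule run_then[OF machine_arrays[OF that]]) (elim conjE, rule 4; assumption)
  have 6: "run aEND (Seq layout_arrays (Seq machine_arrays (Seq sort_jobs (Seq coefficients (Seq digit_table (Seq table write_output))))))
      (line_cost layout_arrays + (m * (line_cost machine_step + 7) + 5 + 6 +
        (sort_time + (coef_time + (digit_time + (table_time + output_time)))))) ?Q s"
    if "params (regs s)" "regs s 7 = real T" "input (heap s)" for s
    by (rule run_then[OF run_line[OF layout_arrays[OF that(1,2)]]]) (elim conjE, rule 5, assumption, assumption, simp only: that(3))
  fix s :: state
  assume s: "params (regs s) \<and> heap s = h0"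
  have "run aEND (If (And (Less xm (Lit 1)) (Less (Lit 0) xn)) (Store (Lit 0) (Lit 0))
      (Seq sum_processing (Seq layout_arrays (Seq machine_arrays (Seq sort_jobs (Seq coefficients
      (Seq digit_table (Seq table write_output))))))))
    (cond_cost (And (Less xm (Lit 1)) (Less (Lit 0) xn)) + (2 + (N * 14 + 5) + (line_cost layout_arrays +
      (m * (line_cost machine_step + 7) + 5 + 6 +
        (sort_time + (coef_time + (digit_time + (table_time + output_time)))))))) ?Q s"
  proof (rule run_If)
    assume "cond_val (And (Less xm (Lit 1)) (Less (Lit 0) xn)) s"
    then have False using s machines by (auto simp: params_def)
    then show "run aEND (Store (Lit 0) (Lit 0)) (2 + (N * 14 + 5) + (line_cost layout_arrays +
      (m * (line_cost machine_step + 7) + 5 + 6 +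
        (sort_time + (coef_time + (digit_time + (table_time + output_time))))))) ?Q s" ..
  next
    show "run aEND (Seq sum_processing (Seq layout_arrays (Seq machine_arrays (Seq sort_jobs (Seq coefficients
      (Seq digit_table (Seq table write_output))))))) (2 + (N * 14 + 5) + (line_cost layout_arrays +
      (m * (line_cost machine_step + 7) + 5 + 6 +
        (sort_time + (coef_time + (digit_time + (table_time + output_time))))))) ?Q s"
    proof (rule run_then[OF sum_processing])
      fix s1 :: state
      assume "params (regs s1) \<and> heap s1 = heap s \<and> regs s1 7 = real T"
      then show "run aEND (Seq layout_arrays (Seq machine_arrays (Seq sort_jobs (Seq coefficients
        (Seq digit_table (Seq table write_output)))))) (line_cost layout_arrays +
        (m * (line_cost machine_step + 7) + 5 + 6 +
          (sort_time + (coef_time + (digit_time + (table_time + output_time)))))) ?Q s1"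
        using s initial_heap by (intro 6) auto
    qed (use s initial_heap in auto)
  qed simp
  then show "run aEND (If (And (Less xm (Lit 1)) (Less (Lit 0) xn)) (Store (Lit 0) (Lit 0))
      (Seq sum_processing (Seq layout_arrays (Seq machine_arrays (Seq sort_jobs (Seq coefficients
      (Seq digit_table (Seq table write_output)))))))) (9 + (2 + (N * 14 + 5) + (line_cost layout_arrays +
  (m * (line_cost machine_step + 7) + 5 + 6 + (sort_time + (coef_time + (digit_time + (table_time + output_time)))))))) ?Q s"
    by (rule run_mono[OF _ add_right_mono]) simp_all
qed

end

section \<open>The bound\<close>

text \<open>
  The number of the entries of the table, times the number of decisions for an entry up to a
  constant. Every phase of the program takes at most a constant times this product.
\<close>

definition size_bound :: "nat \<Rightarrow> nat \<Rightarrow> nat \<Rightarrow> nat \<Rightarrow> nat" where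
  "size_bound m S N n = (m + 1) * ((N + 1) * (n + 1) * (n + 1) * (S + 1))"

text \<open>
  The costs of all loop-free parts, the step of the final loop twice since it is executed at most
  \<open>2 * N\<close> times; the summand 300 covers the administration of the loops.
\<close>

definition time_factor :: nat where
  "time_factor = line_cost read_parameters + line_cost layout_arrays + line_cost machine_step + line_cost rank_step +
     line_cost copy_job + line_cost pick_step + line_cost coef_store + line_cost digit_step + line_cost digit_next +
     line_cost prepare_entry + line_cost try_machine + line_cost store_entry + line_cost output_start +
     2 * line_cost output_step + 300"

lemma size_bound_ge:
  assumes "N \<le> S"
  shows "1 \<le> size_bound m S N n" "N \<le> size_bound m S N n" "m \<le> size_bound m S N n" "n \<le> size_bound m S N n"
    "S \<le> size_bound m S N n" "S * m \<le> size_bound m S N n" "n * m \<le> size_bound m S N n"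
    "N * N \<le> size_bound m S N n"
    "(N + 1) * (n + 1) * (n + 1) * (S + 1) \<le> size_bound m S N n"
    "m * ((N + 1) * (n + 1) * (n + 1) * (S + 1)) \<le> size_bound m S N n"
proof -
  have eq: "size_bound m S N n = (m + 1) * ((S + 1) * ((N + 1) * ((n + 1) * (n + 1))))"
    by (simp add: size_bound_def algebra_simps)
  have n1: "n \<le> (n + 1) * (n + 1)" "1 \<le> (n + 1) * (n + 1)" by auto
  have mono: "a * (b * (c * d)) \<le> size_bound m S N n"
    if "a \<le> m + 1" "b \<le> S + 1" "c \<le> N + 1" "d \<le> (n + 1) * (n + 1)" for a b c d
    unfolding eq by (intro mult_le_mono that)
  show "1 \<le> size_bound m S N n" using mono[of 1 1 1 1] by simp
  show "N \<le> size_bound m S N n" using mono[of 1 1 N 1] by simp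
  show "m \<le> size_bound m S N n" using mono[of m 1 1 1] by simp
  show "n \<le> size_bound m S N n" using mono[of 1 1 1 n] n1 by simp
  show "S \<le> size_bound m S N n" using mono[of 1 S 1 1] by simp
  show "S * m \<le> size_bound m S N n" using mono[of m S 1 1] by (simp add: mult.commute)
  show "n * m \<le> size_bound m S N n" using mono[of m 1 1 n] n1 by (simp add: mult.commute)
  show "N * N \<le> size_bound m S N n" using mono[of 1 N N 1] assms by simp
  show "(N + 1) * (n + 1) * (n + 1) * (S + 1) \<le> size_bound m S N n"
    unfolding size_bound_def by simp
  show "m * ((N + 1) * (n + 1) * (n + 1) * (S + 1)) \<le> size_bound m S N n"
    unfolding size_bound_def by simp
qed

lemma nested_loops:
  fixes a b c E :: nat
  assumes "1 \<le> a" "1 \<le> b" "1 \<le> c"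
  shows "a * (b * (b * (c * E + 7 + 9) + 7 + 9) + 7 + 9) + 7 \<le> a * b * b * c * (E + 55)"
proof -
  define Y where "Y = a * b * b * c"
  have 1: "a * b * b \<le> Y" "a * b \<le> a * b * b" "a \<le> a * b" "1 \<le> a"
    using assms by (simp_all add: Y_def)
  have "a * (b * (b * (c * E + 7 + 9) + 7 + 9) + 7 + 9) + 7 = Y * E + 16 * (a * b * b) + 16 * (a * b) + 16 * a + 7"
    by (simp add: Y_def algebra_simps)
  also have "\<dots> \<le> Y * E + 55 * Y" using 1 by linarith
  finally show ?thesis unfolding Y_def by (simp add: algebra_simps)
qed

context machines begin

lemma num_jobs_le_total: "N \<le> T"
proof -
  have "(\<Sum>j<N. 1) \<le> T" unfolding total_proc_def using p_pos by (intro sum_mono) (simp add: Suc_le_eq)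
  then show ?thesis by simp
qed

lemma num_jobs_le_states: "0 < m \<Longrightarrow> N \<le> states"
proof -
  assume m: "0 < m"
  show ?thesis
  proof (cases "T = 0")
    case True
    then show ?thesis using num_jobs_le_total by simp
  next
    case False
    have "T ^ 1 \<le> T ^ m" using m False by (intro power_increasing) auto
    then show ?thesis using num_jobs_le_total by (simp add: states_def)
  qed
qed

lemma program_time_le:
  assumes m: "0 < m"
  shows "program_time \<le> time_factor * size_bound m states N n"
proof -
  define B where "B = size_bound m states N n"
  define Y where "Y = (N + 1) * (n + 1) * (n + 1) * (states + 1)"
  have b: "1 \<le> B" "N \<le> B" "m \<le> B" "n \<le> B" "states \<le> B" "states * m \<le> B" "n * m \<le> B" "N * N \<le> B"
    "Y \<le> B" "m * Y \<le> B"
    using size_bound_ge[OF num_jobs_le_states[OF m], where m = m and n = n] unfolding B_def Y_def by (simp_all only:)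
  have c: "x * y \<le> y * B" if "x \<le> B" for x y using that by (metis mult.commute mult_le_mono2)
  have c1: "x \<le> x * B" for x using b(1) by simp
  have machine: "m * (a + 7) + 5 + 6 \<le> (a + 18) * B" for a
    using c[OF b(3), of a] b(1,3) by (simp only: distrib_left distrib_right mult.assoc; linarith)
  have sort: "N * (2 + (N * (a + 7) + 5 + d) + 7) + 5 \<le> (a + d + 26) * B" for a d
    using c[OF b(8), of a] c[OF b(2), of d] b(1,2,8) by (simp only: distrib_left distrib_right mult.assoc; linarith)
  have coef: "n * (2 + (m * (a + 7) + 5 + d) + 7) + 5 \<le> (a + d + 26) * B" for a d
    using c[OF b(7), of a] c[OF b(4), of d] b(1,4,7) by (simp only: distrib_left distrib_right mult.assoc; linarith)
  have digit: "2 + (2 + (states * (m * (a + 7) + 5 + d + 7) + 5)) \<le> (a + d + 28) * B" for a d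
    using c[OF b(6), of a] c[OF b(5), of d] b(1,5,6) by (simp only: distrib_left distrib_right mult.assoc; linarith)
  have table: "(N + 1) * ((n + 1) * ((n + 1) * ((states + 1) * (a + (3 + (m * (d + 7) + 5) + e) + 9) + 7 + 9) + 7 + 9) + 7 + 9) + 7
      \<le> (a + d + e + 79) * B" for a d e
  proof -
    have "(N + 1) * ((n + 1) * ((n + 1) * ((states + 1) * (a + (3 + (m * (d + 7) + 5) + e) + 9) + 7 + 9) + 7 + 9) + 7 + 9) + 7
      \<le> Y * (a + (3 + (m * (d + 7) + 5) + e) + 9 + 55)"
      unfolding Y_def by (rule nested_loops) auto
    also have "\<dots> = Y * a + (m * Y) * d + Y * e + 7 * (m * Y) + 72 * Y" by (simp add: algebra_simps)
    also have "\<dots> \<le> a * B + d * B + e * B + 7 * B + 72 * B"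
      using c[OF b(9), of a] c[OF b(10), of d] c[OF b(9), of e] b(9,10) by linarith
    finally show ?thesis by (simp only: distrib_right; linarith)
  qed
  have out: "a + ((2 * N) * (d + 5) + 5) \<le> (a + 2 * d + 15) * B" for a d
    using c[OF b(2), of d] c1[of a] b(1,2) by (simp only: distrib_left distrib_right mult.assoc; linarith)
  have sum: "2 + (N * 14 + 5) \<le> 21 * B" using b(1,2) by linarith
  have 9: "9 \<le> 9 * B" using b(1) by simp
  note parts = add_mono[OF c1[of "line_cost read_parameters"] add_mono[OF 9 add_mono[OF sum
    add_mono[OF c1[of "line_cost layout_arrays"] add_mono[OF machine add_mono[OF sort add_mono[OF coef
    add_mono[OF digit add_mono[OF table out]]]]]]]]]
  have "program_time \<le> line_cost read_parameters * B + (9 * B + (21 * B + (line_cost layout_arrays * B +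
     ((line_cost machine_step + 18) * B + ((line_cost rank_step + line_cost copy_job + 26) * B +
     ((line_cost pick_step + line_cost coef_store + 26) * B + ((line_cost digit_step + line_cost digit_next + 28) * B +
     ((line_cost prepare_entry + line_cost try_machine + line_cost store_entry + 79) * B +
      (line_cost output_start + 2 * line_cost output_step + 15) * B))))))))"
    by (rule parts)
  also have "\<dots> \<le> time_factor * B"
    by (simp only: add_mult_distrib[symmetric] time_factor_def) (rule mult_right_mono, simp_all)
  finally show ?thesis by (simp only: B_def)
qed

lemma space_le:
  assumes m: "0 < m"
  shows "aEND \<le> 22 * size_bound m states N n"
  using size_bound_ge[OF num_jobs_le_states[OF m], where m = m and n = n]
  unfolding aEND_def aTB_def layout by linarith

lemma size_bound_le:
  assumes m: "0 < m" and n: "0 < n"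
  shows "real (size_bound m states N n) \<le> 16 * dp_bound P"
proof -
  have nN: "n \<le> N" using valid by (simp add: valid_instance_def)
  have N0: "0 < N" using n nN by simp
  have S0: "0 < states" using num_jobs_le_states[OF m] N0 by simp
  \<comment> \<open>Four doublings give the factor 16.\<close>
  have "m < 2 ^ m" by (rule less_exp)
  then have "m + 1 \<le> 2 ^ m" by linarith
  moreover have "N + 1 \<le> 2 * N" "n + 1 \<le> 2 * n" "states + 1 \<le> 2 * states" using N0 n S0 by auto
  ultimately have "size_bound m states N n \<le> 2 ^ m * ((2 * N) * (2 * n) * (2 * n) * (2 * states))"
    unfolding size_bound_def by (intro mult_le_mono)
  also have "\<dots> = 16 * (2 ^ m * states * N * n ^ 2)" by (simp add: power2_eq_square)
  finally have "real (size_bound m states N n) \<le> real (16 * (2 ^ m * states * N * n ^ 2))"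
    by (simp only: of_nat_le_iff)
  also have "\<dots> = 16 * (2 ^ m * real T ^ m * real N * real n ^ 2)" by (simp add: states_def)
  also have "\<dots> \<le> 16 * dp_bound P"
  proof -
    have "2 ^ m * real T ^ m * real N * real n ^ 2 * 1
      \<le> 2 ^ m * real T ^ m * real N * real n ^ 2 * max 1 (log 2 (real n))"
      by (intro mult_left_mono) auto
    then show ?thesis by (simp add: dp_bound_def total_proc_def)
  qed
  finally show ?thesis .
qed

lemma solves:
  "\<exists>ys time space. computes_within program (encode_instance P) ys time space \<and> exact_output P ys \<and>
    (1 \<le> n \<longrightarrow> real time \<le> 16 * real time_factor * dp_bound P \<and> real space \<le> 16 * real time_factor * dp_bound P)"
proof -
  obtain time s' X s where r: "exec aEND program (initial_state (encode_instance P)) time s'" "time \<le> program_time"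
    "bilevel_optimal P X s" "\<forall>a<length (encode_solution P X s). heap s' a = encode_solution P X s ! a"
    using program_correct unfolding run_def by blast
  have "computes_within program (encode_instance P) (encode_solution P X s) time aEND"
    using r(1,4) by (auto simp: computes_within_def encode_instance_def encode_solution_def aEND_def aTB_def layout)
  moreover have "exact_output P (encode_solution P X s)"
    using r(3) unfolding exact_output_def by auto
  moreover have "real time \<le> 16 * real time_factor * dp_bound P \<and> real aEND \<le> 16 * real time_factor * dp_bound P"
    if n: "1 \<le> n"
  proof -
    have m: "0 < m" using machines n by auto
    let ?B = "size_bound m states N n"
    have f: "22 \<le> time_factor" by (simp add: time_factor_def)
    have "time \<le> time_factor * ?B" using r(2) program_time_le[OF m] by linarith
    moreover have "22 * ?B \<le> time_factor * ?B" using f by (rule mult_right_mono) simp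
    then have "aEND \<le> time_factor * ?B" using space_le[OF m] by linarith
    moreover have "real (time_factor * ?B) \<le> 16 * real time_factor * dp_bound P"
      using mult_left_mono[OF size_bound_le[OF m], of "real time_factor"] n by simp
    ultimately show ?thesis by (meson of_nat_le_iff order_trans)
  qed
  ultimately show ?thesis by blast
qed

end

section \<open>Instances without machines\<close>

text \<open>
  Without machines the bound degenerates to the number of jobs times a function of the number of
  selected jobs, less than sorting may take; hence the early exit of the program.
\<close>

lemma no_machines:
  assumes valid: "valid_instance P" and m: "num_machines P = 0" and n: "0 < num_selected P"
  shows "\<exists>ys time space. computes_within program (encode_instance P) ys time space \<and> exact_output P ys \<and>
    real time \<le> 16 * real time_factor * dp_bound P \<and> real space \<le> 16 * real time_factor * dp_bound P"
proof -
  let ?N = "num_jobs P" and ?s = "initial_state (encode_instance P)"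
  have N: "1 \<le> ?N" using valid n by (simp add: valid_instance_def)
  have m01: "low_machines P = 0" "high_machines P = 0" using m by (auto simp: num_machines_def)
  have h: "heap ?s 0 = 0" "heap ?s 1 = 0" "heap ?s 4 = real ?N" "heap ?s 5 = real (num_selected P)"
    using m01 by (auto simp: initial_state_def encode_instance_def)
  have "run (6 + 3 * ?N) program (line_cost read_parameters + (9 + 3)) (\<lambda>s. heap s 0 = 0) ?s"
    unfolding program_def
  proof (rule run_then[OF run_line])
    show "line (6 + 3 * ?N) read_parameters (\<lambda>s. regs s 6 = 0 \<and> regs s 5 = real (num_selected P) \<and> heap s 0 = 0) ?s"
      using h by (simp add: read_parameters_def is_address_iff)
    fix s :: state
    assume s: "regs s 6 = 0 \<and> regs s 5 = real (num_selected P) \<and> heap s 0 = 0"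
    have "run (6 + 3 * ?N) (If (And (Less xm (Lit 1)) (Less (Lit 0) xn)) (Store (Lit 0) (Lit 0))
       (block [sum_processing, layout_arrays, machine_arrays, sort_jobs, coefficients, digit_table, table, write_output]))
       (cond_cost (And (Less xm (Lit 1)) (Less (Lit 0) xn)) + 3) (\<lambda>s. heap s 0 = 0) s"
    proof (rule run_If)
      show "run (6 + 3 * ?N) (Store (Lit 0) (Lit 0)) 3 (\<lambda>s. heap s 0 = 0) s"
        by (rule run_line_le) (simp_all add: is_address_iff)
    qed (use s n in simp_all)
    then show "run (6 + 3 * ?N) (If (And (Less xm (Lit 1)) (Less (Lit 0) xn)) (Store (Lit 0) (Lit 0))
       (block [sum_processing, layout_arrays, machine_arrays, sort_jobs, coefficients, digit_table, table, write_output]))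
       (9 + 3) (\<lambda>s. heap s 0 = 0) s"
      by (rule run_mono) simp_all
  qed
  then obtain time s' where r: "exec (6 + 3 * ?N) program ?s time s'" "time \<le> line_cost read_parameters + (9 + 3)"
    "heap s' 0 = 0" unfolding run_def by blast
  have "computes_within program (encode_instance P) [0] time (6 + 3 * ?N)"
    using r(1,3) by (auto simp: computes_within_def encode_instance_def)
  moreover have "exact_output P [0]"
  proof -
    have "\<not> bilevel_optimal P I s" for I s
    proof
      assume "bilevel_optimal P I s"
      then have "bilevel_feasible P (I, s)" by (simp add: bilevel_optimal_def is_arg_min_def)
      then have c: "card I = num_selected P" and s: "s \<in> schedules P I"
        by (auto simp: bilevel_feasible_def lex_argmin_def is_arg_min_def)
      then obtain j where "j \<in> I" using n by fastforce
      then show False using s m by (auto simp: schedules_def)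
    qed
    then show ?thesis by (simp add: exact_output_def)
  qed
  moreover have "real ?N \<le> dp_bound P"
  proof -
    have "1 \<le> real (num_selected P) ^ 2 * max 1 (log 2 (real (num_selected P)))"
      using mult_mono[of 1 "real (num_selected P) ^ 2" 1 "max 1 (log 2 (real (num_selected P)))"] n by simp
    then have "real ?N * 1 \<le> real ?N * (real (num_selected P) ^ 2 * max 1 (log 2 (real (num_selected P))))"
      by (intro mult_left_mono) auto
    then show ?thesis using m by (simp add: dp_bound_def mult.assoc)
  qed
  moreover have "time \<le> time_factor * ?N" "6 + 3 * ?N \<le> time_factor * ?N"
  proof -
    have "time \<le> time_factor" using r(2) by (simp add: time_factor_def)
    also have "\<dots> \<le> time_factor * ?N" using N by simp
    finally show "time \<le> time_factor * ?N" .
    have "6 + 3 * ?N \<le> 9 * ?N" using N by simp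
    also have "\<dots> \<le> time_factor * ?N" by (rule mult_right_mono) (simp_all add: time_factor_def)
    finally show "6 + 3 * ?N \<le> time_factor * ?N" .
  qed
  moreover have "real (time_factor * ?N) \<le> 16 * real time_factor * dp_bound P"
    if "real ?N \<le> dp_bound P"
  proof -
    have "real time_factor * real ?N \<le> (16 * real time_factor) * dp_bound P"
      using that by (intro mult_mono) auto
    then show ?thesis by simp
  qed
  ultimately show ?thesis by (meson of_nat_le_iff order_trans)
qed

theorem mainTheorem2:
  shows "\<exists>(prog :: com) (C :: real). \<forall>P :: bilevel_instance. valid_instance P \<longrightarrow>
    (\<exists>(ys :: real list) (time :: nat) (space :: nat).
       computes_within prog (encode_instance P) ys time space \<and>
       exact_output P ys \<and>
       (1 \<le> num_selected P \<longrightarrow>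
          real time \<le> C * dp_bound P \<and> real space \<le> C * dp_bound P))"
proof (rule exI[of _ program], rule exI[of _ "16 * real time_factor"], intro allI impI)
  fix P :: bilevel_instance
  assume valid: "valid_instance P"
  show "\<exists>(ys :: real list) (time :: nat) (space :: nat).
       computes_within program (encode_instance P) ys time space \<and> exact_output P ys \<and>
       (1 \<le> num_selected P \<longrightarrow> real time \<le> 16 * real time_factor * dp_bound P \<and>
          real space \<le> 16 * real time_factor * dp_bound P)"
  proof (cases "0 < num_machines P \<or> num_selected P = 0")
    case True
    then interpret machines P using valid by unfold_locales
    show ?thesis by (rule solves)
  next
    case False
    then show ?thesis using no_machines[OF valid] by blast
  qed
qed

end
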